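(* Let $s\in(\tfrac12,1)$, let $n\ge 1$ be an integer, and let $K$ and $W$ be as in the context. Let $a_1>a_2>0$ and $a(x):=a_1+a_2\cos(\epsilon x)$ for $x\in\mathbb{R}$, with $\epsilon>0$. Let $\zeta_1\in\mathbb{Z}^n$ and let $N\ge 2$ be an integer. If $\epsilon$ is sufficiently small (i.e. there is $\epsilon_*>0$ such that the following holds for every $\epsilon\in(0,\epsilon_*]$), then there exist $\zeta_2,\dots,\zeta_N\in\mathbb{Z}^n$ and $b_1,\dots,b_{2N-2}\in\mathbb{R}$, with $b_{i+1}\ge b_i+3$ for all $i=1,\dots,2N-3$, and a solution $Q_*:\mathbb{R}\to\mathbb{R}^n$ of $$\mathcal{L}(Q_* )(x)+a(x)\,\nabla W(Q_*(x))=0\qquad\text{for any }x\in\mathbb{R},$$ such that $$\zeta_{i+1}\ne\zeta_i\ \text{ for any } i\in\{1,\dots,N-1\},\qquad \lim_{x\to-\infty}Q_*(x)=\zeta_1,\qquad \sup_{x\in(-\infty,b_1]}|Q_*(x)-\zeta_1|\le\tfrac14,$$ $$\sup_{x\in[b_{2i},b_{2i+1}]}|Q_*(x)-\zeta_{i+1}|\le\tfrac14\ \text{ for all } i=1,\dots,N-2,$$ $$\sup_{x\in[b_{2N-2},+\infty)}|Q_*(x)-\zeta_N|\le\tfrac14,\qquad \lim_{x\to+\infty}Q_*(x)=\zeta_N.$$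
   Context: Kernel: $K:\mathbb{R}\to[0,+\infty]$ satisfies $K(-x)=K(x)$, $$\frac{\theta_0(1-s)\chi_{[-\rho_0,\rho_0]}(x)}{|x|^{1+2s}}\le K(x)\le\frac{\Theta_0(1-s)}{|x|^{1+2s}}$$ for some $\rho_0\in(0,1]$ and $\Theta_0\ge\theta_0>0$, and $|\nabla K(x)|\le\Theta_1|x|^{-2-2s}$ for some $\Theta_1>0$ (for $x\neq 0$). Potential: $W\in C^{1,1}(\mathbb{R}^n)$; $W(\tau+\zeta)=W(\tau)$ for all $\tau\in\mathbb{R}^n$, $\zeta\in\mathbb{Z}^n$; $W(\zeta)=0$ for $\zeta\in\mathbb{Z}^n$ and $W(\tau)>0$ for $\tau\in\mathbb{R}^n\setminus\mathbb{Z}^n$; and there exist $r\in(0,1/4]$, $c_0\in(0,1)$, $C_0\in(1,+\infty)$ with $c_0|\tau|^2\le W(\tau)\le C_0|\tau|^2$ for all $\tau\in B_r$ (ball of radius $r$ centred at $0$). Energy: for measurable $Q:\mathbb{R}\to\mathbb{R}^n$, $E(Q):=\iint_{\mathbb{R}\times\mathbb{R}}K(x-y)|Q(x)-Q(y)|^2\,dx\,dy$. Solutions: a measurable $Q$ with $E(Q)<+\infty$ is a solution of $\mathcal{L}(Q)(x)+f(x)=0$ in an interval $J$ if $$2\iint_{\mathbb{R}\times\mathbb{R}}K(x-y)\,(Q(x)-Q(y))\cdot(\psi(x)-\psi(y))\,dx\,dy+\int_{\mathbb{R}}f(x)\cdot\psi(x)\,dx=0$$ for every $\psi\in C_0^\infty(J,\mathbb{R}^n)$;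 here $f(x)=a(x)\nabla W(Q(x))$ and $J=\mathbb{R}$. Functions with $E(Q)<+\infty$ are identified with their continuous representative. *)

theory Defs
  imports "HOL-Analysis.Analysis"
begin

definition int_lattice :: "(real ^ 'n) set"
  where "int_lattice = {\<zeta>. \<forall>i. \<zeta> $ i \<in> \<int>}"

definition grad :: "(real ^ 'n \<Rightarrow> real) \<Rightarrow> real ^ 'n \<Rightarrow> real ^ 'n"
  where "grad W x = (THE D. GDERIV W x :> D)"

text \<open>The kernel takes values in \<open>[0, \<infinity>]\<close>, and its two-sided bound is imposed at every
  point in the extended sense: at \<open>0\<close> the quotients below are a positive constant divided by
  \<open>0\<close>, that is \<open>\<infinity>\<close> in \<^typ>\<open>ennreal\<close>, so \<open>K 0 = \<infinity>\<close>. Away from \<open>0\<close> the upper bound makes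
  \<open>K\<close> finite, so that \<^const>\<open>enn2real\<close> loses nothing in the gradient bound.\<close>

definition admissible_kernel :: "real \<Rightarrow> (real \<Rightarrow> ennreal) \<Rightarrow> bool"
  where "admissible_kernel s K \<longleftrightarrow>
    (\<forall>x. K (- x) = K x) \<and>
    (\<exists>\<rho>\<^sub>0 \<theta>\<^sub>0 \<Theta>\<^sub>0 :: real. 0 < \<rho>\<^sub>0 \<and> \<rho>\<^sub>0 \<le> 1 \<and> 0 < \<theta>\<^sub>0 \<and> \<theta>\<^sub>0 \<le> \<Theta>\<^sub>0 \<and>
      (\<forall>x. ennreal (\<theta>\<^sub>0 * (1 - s)) * indicator {- \<rho>\<^sub>0..\<rho>\<^sub>0} x / ennreal (\<bar>x\<bar> powr (1 + 2 * s)) \<le> K x \<and>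
           K x \<le> ennreal (\<Theta>\<^sub>0 * (1 - s)) / ennreal (\<bar>x\<bar> powr (1 + 2 * s)))) \<and>
    (\<exists>\<Theta>\<^sub>1 > 0. \<forall>x. x \<noteq> 0 \<longrightarrow>
      (\<lambda>y. enn2real (K y)) differentiable (at x) \<and>
      \<bar>deriv (\<lambda>y. enn2real (K y)) x\<bar> \<le> \<Theta>\<^sub>1 * \<bar>x\<bar> powr (- 2 - 2 * s))"

text \<open>The class \<open>C\<^sup>1\<^sup>,\<^sup>1(\<real>\<^sup>n)\<close>: differentiable with Lipschitz gradient. For the periodic
  functions considered here it makes no difference whether the Lipschitz condition is local or
  global, or whether the function and its gradient are also required to be bounded.\<close>

definition C11 :: "(real ^ 'n \<Rightarrow> real) \<Rightarrow> bool"
  where "C11 W \<longleftrightarrow> (\<forall>x. W differentiable (at x)) \<and> (\<exists>L. L-lipschitz_on UNIV (grad W))"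

definition admissible_potential :: "(real ^ 'n \<Rightarrow> real) \<Rightarrow> bool"
  where "admissible_potential W \<longleftrightarrow>
    C11 W \<and>
    (\<forall>\<tau>. \<forall>\<zeta> \<in> int_lattice. W (\<tau> + \<zeta>) = W \<tau>) \<and>
    (\<forall>\<zeta> \<in> int_lattice. W \<zeta> = 0) \<and>
    (\<forall>\<tau>. \<tau> \<notin> int_lattice \<longrightarrow> W \<tau> > 0) \<and>
    (\<exists>r c\<^sub>0 C\<^sub>0 :: real. 0 < r \<and> r \<le> 1/4 \<and> 0 < c\<^sub>0 \<and> c\<^sub>0 < 1 \<and> 1 < C\<^sub>0 \<and>
      (\<forall>\<tau> \<in> ball 0 r. c\<^sub>0 * (norm \<tau>)\<^sup>2 \<le> W \<tau> \<and> W \<tau> \<le> C\<^sub>0 * (norm \<tau>)\<^sup>2))"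

definition energy :: "(real \<Rightarrow> ennreal) \<Rightarrow> (real \<Rightarrow> real ^ 'n) \<Rightarrow> ennreal"
  where "energy K Q =
    (\<integral>\<^sup>+ (x, y). K (x - y) * ennreal ((norm (Q x - Q y))\<^sup>2) \<partial>(lebesgue :: (real \<times> real) measure))"

text \<open>Smoothness means that every iterated derivative is differentiable everywhere.\<close>

definition test_functions :: "real set \<Rightarrow> (real \<Rightarrow> real ^ 'n) set"
  where "test_functions J = {\<psi>.
    (\<forall>k x. ((\<lambda>f t. vector_derivative f (at t)) ^^ k) \<psi> differentiable (at x)) \<and>
    compact (closure {x. \<psi> x \<noteq> 0}) \<and> closure {x. \<psi> x \<noteq> 0} \<subseteq> J}"

text \<open>Solutions of \<open>\<L>(Q) + f = 0\<close> in \<open>J\<close>. The integrability clauses say that the two integrals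
  exist, since otherwise the Bochner integral would have the value \<open>0\<close> by convention. The value
  \<open>K 0 = \<infinity>\<close>, which \<^const>\<open>enn2real\<close> sends to \<open>0\<close>, only matters on the diagonal, a null set
  on which the increments vanish anyway.\<close>

definition weak_solution ::
  "(real \<Rightarrow> ennreal) \<Rightarrow> real set \<Rightarrow> (real \<Rightarrow> real ^ 'n) \<Rightarrow> (real \<Rightarrow> real ^ 'n) \<Rightarrow> bool"
  where "weak_solution K J f Q \<longleftrightarrow>
    Q \<in> borel_measurable lebesgue \<and> energy K Q < \<infinity> \<and>
    (\<forall>\<psi> \<in> test_functions J.
      integrable (lebesgue :: (real \<times> real) measure)
        (\<lambda>(x, y). enn2real (K (x - y)) * ((Q x - Q y) \<bullet> (\<psi> x - \<psi> y))) \<and>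
      integrable lebesgue (\<lambda>x. f x \<bullet> \<psi> x) \<and>
      2 * (\<integral>(x, y). enn2real (K (x - y)) * ((Q x - Q y) \<bullet> (\<psi> x - \<psi> y))
             \<partial>(lebesgue :: (real \<times> real) measure))
        + (\<integral>x. f x \<bullet> \<psi> x \<partial>lebesgue) = 0)"

end

theory Submission
  imports Defs "HOL-Complex_Analysis.Great_Picard"
begin

text \<open>The solution is a minimizer of the action
  \<open>\<integral>\<integral> K(x - y) |Q(x) - Q(y)|\<^sup>2 + \<integral> a W(Q)\<close> among the continuous \<open>Q\<close> that stay within \<open>r/2\<close> of
  \<open>\<zeta>\<^sub>i = \<zeta>\<^sub>1 + (i - 1) v\<close> on the \<open>i\<close>-th region where \<open>cos (\<epsilon> x) \<ge> 0\<close>; the first and the last region are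
  extended to half-lines. Here \<open>v\<close> is the jump of an almost optimal transition for the constant
  weight \<open>c = a\<^sub>1 - a\<^sub>2 = min a\<close>, whose optimal cost is \<open>m\<close>. Such a \<open>Q\<close> solves the equation as soon as
  it does not touch the constraints.

  Translates of the almost optimal transition, centred at the minima of \<open>a\<close>, have total action at
  most \<open>(N - 1) m + o(1)\<close>, because their mutual interaction vanishes as the distance \<open>2 \<pi> / \<epsilon>\<close>
  grows. Conversely, multiplying by a cutoff that varies on a scale \<open>L\<close> costs only
  \<open>O(L\<^bsup>1 - 2s\<^esup>)\<close>, which tends to \<open>0\<close> since \<open>s > 1/2\<close>. So each of the \<open>N - 1\<close> periods of \<open>a\<close>, across which
  \<open>Q\<close> passes from \<open>\<zeta>\<^sub>i\<close> to \<open>\<zeta>\<^sub>i\<^sub>+\<^sub>1\<close>, contributes at least \<open>m - o(1)\<close>, even if \<open>a\<close> is replaced by \<open>c\<close> there.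
  A contact point would add a fixed amount: by uniform continuity \<open>W(Q)\<close> is bounded
  below on an interval of fixed length around it, and there \<open>a - c \<ge> a\<^sub>2/2\<close>, unless that part of the
  interval lies outside the periods that have been counted.\<close>

text \<open>The interaction is nonlocal, hence not additive over intervals, and both comparisons
  have to get around this. From below, only pairs of points inside a common period are kept; the
  others contribute a nonnegative amount. From above, two points closer than the gap between
  transitions see at most one of them, so the cross terms of a superposition of translates live at
  distances that grow with \<open>1 / \<epsilon>\<close>. The lower bound is an infimum over
  transitions between any two distinct lattice points, so it applies to every period whatever
  \<open>v\<close> is. Jumping by the same \<open>v\<close> each time makes every transition a
  translate of one profile up to a lattice vector, which \<open>W\<close> does not see. Besides the
  cutoffs, \<open>s > 1/2\<close> also gives a Hoelder estimate that depends only on the energy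
  bound. It provides the compactness needed for minimizers to exist and the length of the interval
  around a contact point. That length is fixed before the error tolerance, and the tolerance before
  the profile and \<open>\<epsilon>\<close>, so the choices are not circular.\<close>

text \<open>Applied pointwise, with \<open>f i\<close> supported on essentially disjoint sets: this
  is how contributions of different intervals are added without exceeding a single total.\<close>

lemma sum_at_most_one_le:
  fixes f :: "nat \<Rightarrow> 'b::ordered_comm_monoid_add"
  assumes "\<And>i j. i < n \<Longrightarrow> j < n \<Longrightarrow> f i \<noteq> 0 \<Longrightarrow> f j \<noteq> 0 \<Longrightarrow> i = j"
    and "\<And>i. i < n \<Longrightarrow> f i \<le> c" "0 \<le> c"
  shows "(\<Sum>i<n. f i) \<le> c"
proof (cases "\<exists>i<n. f i \<noteq> 0")
  case True
  then obtain i where i: "i < n" "f i \<noteq> 0" by blast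
  have "(\<Sum>j<n. f j) = (\<Sum>j\<in>{i}. f j)"
    using i assms(1) by (intro sum.mono_neutral_right) auto
  then show ?thesis
    using assms(2)[OF i(1)] by simp
next
  case False
  then have "(\<Sum>j<n. f j) = 0"
    by (intro sum.neutral) auto
  then show ?thesis
    using assms(3) by simp
qed

section \<open>The interaction energy\<close>

lemma borel_measurable_fst_snd:
  fixes f :: "real \<Rightarrow> 'b::topological_space"
  assumes "f \<in> borel_measurable borel"
  shows "(\<lambda>p::real \<times> real. f (fst p)) \<in> borel_measurable borel"
    and "(\<lambda>p::real \<times> real. f (snd p)) \<in> borel_measurable borel"
    and "(\<lambda>p::real \<times> real. f (fst p - snd p)) \<in> borel_measurable borel"
proof -
  have "(\<lambda>p::real \<times> real. fst p) \<in> borel_measurable borel" "(\<lambda>p::real \<times> real. snd p) \<in> borel_measurable borel"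
    "(\<lambda>p::real \<times> real. fst p - snd p) \<in> borel_measurable borel"
    by (intro borel_measurable_continuous_onI continuous_intros)+
  with assms show "(\<lambda>p::real \<times> real. f (fst p)) \<in> borel_measurable borel"
    and "(\<lambda>p::real \<times> real. f (snd p)) \<in> borel_measurable borel"
    and "(\<lambda>p::real \<times> real. f (fst p - snd p)) \<in> borel_measurable borel"
    by (auto intro: measurable_compose)
qed

lemma nn_integral_lborel_pair:
  fixes f :: "real \<times> real \<Rightarrow> ennreal"
  assumes "f \<in> borel_measurable borel"
  shows "(\<integral>\<^sup>+p. f p \<partial>lborel) = (\<integral>\<^sup>+x. \<integral>\<^sup>+y. f (x, y) \<partial>lborel \<partial>lborel)"
proof -
  have "f \<in> borel_measurable (lborel \<Otimes>\<^sub>M lborel)"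
    using assms by (simp add: lborel_prod)
  from lborel.nn_integral_fst[OF this] show ?thesis
    by (simp add: lborel_prod)
qed

text \<open>The coordinates \<open>z = x - y\<close> and \<open>x\<close> isolate the argument of
  the kernel: for each lag \<open>z\<close> there remains an integral over positions.\<close>

lemma nn_integral_lborel_shear:
  fixes f :: "real \<times> real \<Rightarrow> ennreal"
  assumes f[measurable]: "f \<in> borel_measurable (borel \<Otimes>\<^sub>M borel)"
  shows "(\<integral>\<^sup>+p. f p \<partial>lborel) = (\<integral>\<^sup>+z. \<integral>\<^sup>+x. f (x, x - z) \<partial>lborel \<partial>lborel)"
proof -
  have "(\<integral>\<^sup>+p. f p \<partial>lborel) = (\<integral>\<^sup>+x. \<integral>\<^sup>+y. f (x, y) \<partial>lborel \<partial>lborel)"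
    using f by (intro nn_integral_lborel_pair) (simp add: borel_prod)
  also have "\<dots> = (\<integral>\<^sup>+x. \<integral>\<^sup>+z. f (x, x - z) \<partial>lborel \<partial>lborel)"
  proof (rule nn_integral_cong)
    fix x :: real
    show "(\<integral>\<^sup>+y. f (x, y) \<partial>lborel) = (\<integral>\<^sup>+z. f (x, x - z) \<partial>lborel)"
      using nn_integral_real_affine[of "\<lambda>y. f (x, y)" "-1" x] by simp
  qed
  also have "\<dots> = (\<integral>\<^sup>+z. \<integral>\<^sup>+x. f (x, x - z) \<partial>lborel \<partial>lborel)"
    by (rule lborel_pair.Fubini') (simp add: borel_measurable_subalgebra)
  finally show ?thesis .
qed

text \<open>In sheared coordinates a diagonal translation moves only the position and leaves the lag
  alone, so invariance of one-dimensional Lebesgue measure suffices.\<close>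

lemma nn_integral_shift:
  fixes f :: "real \<times> real \<Rightarrow> ennreal"
  assumes "f \<in> borel_measurable borel"
  shows "(\<integral>\<^sup>+p. f (fst p - c, snd p - c) \<partial>lborel) = (\<integral>\<^sup>+p. f p \<partial>lborel)"
proof -
  have [measurable]: "f \<in> borel_measurable (borel \<Otimes>\<^sub>M borel)"
    using assms by (simp add: borel_prod)
  have "(\<integral>\<^sup>+p. f (fst p - c, snd p - c) \<partial>lborel) = (\<integral>\<^sup>+z. \<integral>\<^sup>+x. f (x - c, x - z - c) \<partial>lborel \<partial>lborel)"
    by (subst nn_integral_lborel_shear) auto
  also have "\<dots> = (\<integral>\<^sup>+z. \<integral>\<^sup>+x. f (x, x - z) \<partial>lborel \<partial>lborel)"
  proof (rule nn_integral_cong)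
    fix z :: real
    show "(\<integral>\<^sup>+x. f (x - c, x - z - c) \<partial>lborel) = (\<integral>\<^sup>+x. f (x, x - z) \<partial>lborel)"
      using nn_integral_real_affine[of "\<lambda>x. f (x, x - z)" "1" "-c"]
      by (simp add: algebra_simps)
  qed
  also have "\<dots> = (\<integral>\<^sup>+p. f p \<partial>lborel)"
    by (simp add: nn_integral_lborel_shear)
  finally show ?thesis .
qed

text \<open>For a \<open>\<Lambda>\<close>-Lipschitz function that is constant on either side of an
  interval of length \<open>L\<close> and has oscillation at most \<open>M\<close>, this bounds the
  integral of the squared increments at lag \<open>z\<close>: the square of the largest increment
  times the length of the set of positions where the increment can be nonzero.\<close>

abbreviation (input) layer_weight :: "real \<Rightarrow> real \<Rightarrow> real \<Rightarrow> real \<Rightarrow> real" where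
  "layer_weight M \<Lambda> L z \<equiv> (min M (\<Lambda> * \<bar>z\<bar>))\<^sup>2 * (L + \<bar>z\<bar>)"

abbreviation (input) far :: "real \<Rightarrow> (real \<times> real) set" where
  "far D \<equiv> {p. D \<le> \<bar>fst p - snd p\<bar>}"

text \<open>\<open>k\<close> stands for the kernel as a real function, and \<open>\<theta>\<close>,
  \<open>\<Theta>\<close> absorb the factor \<open>1 - s\<close>.\<close>

locale kernel =
  fixes k :: "real \<Rightarrow> real" and s \<rho> \<theta> \<Theta> :: real
  assumes s: "1/2 < s" "s < 1"
    and k_measurable[measurable]: "k \<in> borel_measurable borel"
    and k_nonneg: "\<And>z. 0 \<le> k z"
    and \<rho>_pos: "0 < \<rho>" and \<theta>_pos: "0 < \<theta>"
    and k_upper: "\<And>z. z \<noteq> 0 \<Longrightarrow> k z \<le> \<Theta> * \<bar>z\<bar> powr (- 1 - 2 * s)"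
    and k_lower: "\<And>z. 0 < \<bar>z\<bar> \<Longrightarrow> \<bar>z\<bar> \<le> \<rho> \<Longrightarrow> \<theta> * \<bar>z\<bar> powr (- 1 - 2 * s) \<le> k z"
begin

abbreviation (input) density :: "(real \<Rightarrow> 'a::euclidean_space) \<Rightarrow> real \<times> real \<Rightarrow> real" where
  "density Q p \<equiv> k (fst p - snd p) * (norm (Q (fst p) - Q (snd p)))\<^sup>2"

abbreviation (input) cross_density :: "(real \<Rightarrow> 'a::euclidean_space) \<Rightarrow> (real \<Rightarrow> 'a) \<Rightarrow> real \<times> real \<Rightarrow> real" where
  "cross_density Q \<psi> p \<equiv> k (fst p - snd p) * ((Q (fst p) - Q (snd p)) \<bullet> (\<psi> (fst p) - \<psi> (snd p)))"

text \<open>Both points range over \<open>A\<close>, so the interactions of essentially disjoint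
  sets add up to at most the interaction of the whole line.\<close>

definition interaction :: "real set \<Rightarrow> (real \<Rightarrow> 'a::euclidean_space) \<Rightarrow> ennreal" where
  "interaction A Q = (\<integral>\<^sup>+p. ennreal (density Q p) * indicator (A \<times> A) p \<partial>lborel)"

lemma Theta_nonneg: "0 \<le> \<Theta>"
  using k_upper[of 1] k_nonneg[of 1] by simp

lemma interaction_measurable:
  fixes Q :: "real \<Rightarrow> 'a::euclidean_space"
  assumes "Q \<in> borel_measurable borel"
  shows "(\<lambda>p. ennreal (density Q p)) \<in> borel_measurable borel"
    and "A \<in> sets borel \<Longrightarrow> (\<lambda>p. ennreal (density Q p) * indicator (A \<times> A) p) \<in> borel_measurable borel"
proof -
  note [measurable] = borel_measurable_fst_snd[OF assms] borel_measurable_fst_snd(3)[OF k_measurable]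
  show 1: "(\<lambda>p. ennreal (density Q p)) \<in> borel_measurable borel"
    by measurable
  assume "A \<in> sets borel"
  then have "A \<times> A \<in> sets (borel :: (real \<times> real) measure)"
    by (metis borel_prod pair_measureI)
  with 1 show "(\<lambda>p. ennreal (density Q p) * indicator (A \<times> A) p) \<in> borel_measurable borel"
    by (intro borel_measurable_times_ennreal borel_measurable_indicator) auto
qed

lemma interaction_mono: "A \<subseteq> B \<Longrightarrow> interaction A Q \<le> interaction B Q"
  unfolding interaction_def
  by (intro nn_integral_mono mult_left_mono indicator_leI) auto

lemma interaction_shift:
  fixes Q :: "real \<Rightarrow> 'a::euclidean_space"
  assumes "Q \<in> borel_measurable borel"
  shows "interaction UNIV (\<lambda>x. Q (x - c)) = interaction UNIV Q"
  using nn_integral_shift[OF interaction_measurable(1)[OF assms], of c]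
  unfolding interaction_def by simp

text \<open>Near \<open>0\<close> the integrand is at most a multiple of
  \<open>\<bar>z\<bar> powr (1 - 2 * s)\<close>, integrable because \<open>s < 1\<close>; for large
  lags it is at most a multiple of \<open>\<bar>z\<bar> powr (- 2 * s)\<close>, integrable because
  \<open>s > 1/2\<close>. Finiteness and decay of the interaction of cutoffs and test functions rest
  on this moment.\<close>

lemma kernel_moment: "(\<integral>\<^sup>+z. ennreal (k z * min (z\<^sup>2) \<bar>z\<bar>) \<partial>lborel) < \<infinity>"
proof -
  define F where "F z = ennreal (k z * min (z\<^sup>2) \<bar>z\<bar>)" for z
  define G where "G z = (ennreal (\<Theta> * z powr (1 - 2 * s)) * indicator {0..1} z
     + ennreal (\<Theta> * z powr (- 2 * s)) * indicator {1..} z)" for z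
  have [measurable]: "G \<in> borel_measurable borel"
    unfolding G_def by measurable
  \<comment> \<open>\<open>G\<close> is supported on the nonnegative half-line; its reflection takes
    care of negative \<open>z\<close>.\<close>
  have FG: "F z \<le> G z + G (- z)" for z
  proof (cases "z = 0")
    case False
    have k1: "k z \<le> \<Theta> * \<bar>z\<bar> powr (- 1 - 2 * s)"
      using k_upper[OF False] .
    have small: "k z * z\<^sup>2 \<le> \<Theta> * \<bar>z\<bar> powr (1 - 2 * s)"
    proof -
      have "\<bar>z\<bar> powr (- 1 - 2 * s) * z\<^sup>2 = \<bar>z\<bar> powr (- 1 - 2 * s) * \<bar>z\<bar> powr 2"
        using False by (simp add: powr_numeral)
      also have "\<dots> = \<bar>z\<bar> powr (1 - 2 * s)"
        by (simp only: powr_add[symmetric]) simp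
      finally show ?thesis
        using mult_right_mono[OF k1, of "z\<^sup>2"] by (simp add: mult.assoc)
    qed
    have large: "k z * \<bar>z\<bar> \<le> \<Theta> * \<bar>z\<bar> powr (- 2 * s)"
    proof -
      have "\<bar>z\<bar> powr (- 1 - 2 * s) * \<bar>z\<bar> = \<bar>z\<bar> powr (- 1 - 2 * s) * \<bar>z\<bar> powr 1"
        using False by simp
      also have "\<dots> = \<bar>z\<bar> powr (- 2 * s)"
        by (simp only: powr_add[symmetric]) simp
      finally show ?thesis
        using mult_right_mono[OF k1, of "\<bar>z\<bar>"] by (simp add: mult.assoc)
    qed
    have le1: "k z * min (z\<^sup>2) \<bar>z\<bar> \<le> k z * z\<^sup>2" "k z * min (z\<^sup>2) \<bar>z\<bar> \<le> k z * \<bar>z\<bar>"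
      by (auto intro!: mult_left_mono k_nonneg)
    show ?thesis
    proof (cases "\<bar>z\<bar> \<le> 1")
      case True
      then have "F z \<le> ennreal (\<Theta> * \<bar>z\<bar> powr (1 - 2 * s))"
        unfolding F_def using le1 small by (intro ennreal_leI) linarith
      also have "\<dots> \<le> G \<bar>z\<bar>"
        using True by (auto simp: G_def)
      also have "\<dots> \<le> G z + G (- z)"
        by (auto simp: abs_if)
      finally show ?thesis .
    next
      case F: False
      then have "F z \<le> ennreal (\<Theta> * \<bar>z\<bar> powr (- 2 * s))"
        unfolding F_def using le1 large by (intro ennreal_leI) linarith
      also have "\<dots> \<le> G \<bar>z\<bar>"
        using F by (auto simp: G_def)
      also have "\<dots> \<le> G z + G (- z)"
        by (auto simp: abs_if)
      finally show ?thesis .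
    qed
  qed (simp add: F_def)
  have "(\<integral>\<^sup>+z. F z \<partial>lborel) \<le> (\<integral>\<^sup>+z. G z + G (- z) \<partial>lborel)"
    by (rule nn_integral_mono) (rule FG)
  also have "\<dots> = (\<integral>\<^sup>+z. G z \<partial>lborel) + (\<integral>\<^sup>+z. G (- z) \<partial>lborel)"
    by (rule nn_integral_add) auto
  also have "(\<integral>\<^sup>+z. G (- z) \<partial>lborel) = (\<integral>\<^sup>+z. G z \<partial>lborel)"
    using nn_integral_real_affine[of G "-1" 0] by simp
  finally have 1: "(\<integral>\<^sup>+z. F z \<partial>lborel) \<le> (\<integral>\<^sup>+z. G z \<partial>lborel) + (\<integral>\<^sup>+z. G z \<partial>lborel)" .
  have "((\<lambda>z. \<Theta> * z powr (1 - 2 * s)) has_integral \<Theta> * (1 powr (1 - 2 * s + 1) / (1 - 2 * s + 1))) {0..1}"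
    using s by (intro has_integral_mult_right has_integral_powr_from_0) auto
  then have 2: "(\<integral>\<^sup>+z. ennreal (\<Theta> * z powr (1 - 2 * s)) * indicator {0..1} z \<partial>lborel) < \<infinity>"
    using Theta_nonneg by (subst nn_integral_has_integral_lebesgue') auto
  have "((\<lambda>z. \<Theta> * z powr (- 2 * s)) has_integral \<Theta> * (- (1 powr (- 2 * s + 1)) / (- 2 * s + 1))) {1..}"
    using s by (intro has_integral_mult_right has_integral_powr_to_inf) auto
  then have 3: "(\<integral>\<^sup>+z. ennreal (\<Theta> * z powr (- 2 * s)) * indicator {1..} z \<partial>lborel) < \<infinity>"
    using Theta_nonneg by (subst nn_integral_has_integral_lebesgue') auto
  have "(\<integral>\<^sup>+z. G z \<partial>lborel)
    = (\<integral>\<^sup>+z. ennreal (\<Theta> * z powr (1 - 2 * s)) * indicator {0..1} z \<partial>lborel)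
    + (\<integral>\<^sup>+z. ennreal (\<Theta> * z powr (- 2 * s)) * indicator {1..} z \<partial>lborel)"
    unfolding G_def by (rule nn_integral_add) auto
  also have "\<dots> < \<infinity>"
    using 2 3 by (simp only: ennreal_add_less_top infinity_ennreal_def)
  finally have "(\<integral>\<^sup>+z. G z \<partial>lborel) + (\<integral>\<^sup>+z. G z \<partial>lborel) < \<infinity>"
    by (simp only: ennreal_add_less_top infinity_ennreal_def)
  with 1 show ?thesis
    unfolding F_def by (rule le_less_trans)
qed

text \<open>At lag \<open>z\<close> the increment can be nonzero only for \<open>x\<close> between
  \<open>min p (p + z)\<close> and \<open>max q (q + z)\<close>, an interval of length
  \<open>q - p + \<bar>z\<bar>\<close>.\<close>

lemma interaction_layer:
  fixes \<phi> :: "real \<Rightarrow> 'a::euclidean_space"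
  assumes "continuous_on UNIV \<phi>"
    and M: "\<And>x y. norm (\<phi> x - \<phi> y) \<le> M" and \<Lambda>: "\<And>x y. norm (\<phi> x - \<phi> y) \<le> \<Lambda> * \<bar>x - y\<bar>"
    and "p \<le> q"
    and left: "\<And>x. x \<le> p \<Longrightarrow> \<phi> x = \<phi> p" and right: "\<And>x. q \<le> x \<Longrightarrow> \<phi> x = \<phi> q"
  shows "interaction UNIV \<phi> \<le> (\<integral>\<^sup>+z. ennreal (k z * layer_weight M \<Lambda> (q - p) z) \<partial>lborel)"
proof -
  have [measurable]: "\<phi> \<in> borel_measurable borel"
    using assms(1) by (rule borel_measurable_continuous_onI)
  have "interaction UNIV \<phi> = (\<integral>\<^sup>+z. \<integral>\<^sup>+x. ennreal (k z * (norm (\<phi> x - \<phi> (x - z)))\<^sup>2) \<partial>lborel \<partial>lborel)"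
    unfolding interaction_def by (subst nn_integral_lborel_shear) auto
  also have "\<dots> \<le> (\<integral>\<^sup>+z. ennreal (k z * layer_weight M \<Lambda> (q - p) z) \<partial>lborel)"
  proof (rule nn_integral_mono)
    fix z :: real
    define m where "m = (min M (\<Lambda> * \<bar>z\<bar>))\<^sup>2"
    have "ennreal (k z * (norm (\<phi> x - \<phi> (x - z)))\<^sup>2)
       \<le> ennreal (k z * m) * indicator {min p (p + z)..max q (q + z)} x" for x
    proof (cases "x \<in> {min p (p + z)..max q (q + z)}")
      case True
      have "norm (\<phi> x - \<phi> (x - z)) \<le> min M (\<Lambda> * \<bar>z\<bar>)"
        using M[of x "x - z"] \<Lambda>[of x "x - z"] by simp
      then have "(norm (\<phi> x - \<phi> (x - z)))\<^sup>2 \<le> m"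
        unfolding m_def by (intro power_mono) auto
      then show ?thesis
        using True k_nonneg by (auto intro!: ennreal_leI mult_left_mono)
    next
      case False
      then have "\<phi> x = \<phi> (x - z)"
      proof -
      from False consider "x \<le> p" "x - z \<le> p" | "q \<le> x" "q \<le> x - z"
        by (auto simp: min_def max_def split: if_splits)
      then show ?thesis
        by cases (metis left, metis right)
    qed
      then show ?thesis by simp
    qed
    then have "(\<integral>\<^sup>+x. ennreal (k z * (norm (\<phi> x - \<phi> (x - z)))\<^sup>2) \<partial>lborel)
      \<le> (\<integral>\<^sup>+x. ennreal (k z * m) * indicator {min p (p + z)..max q (q + z)} x \<partial>lborel)"
      by (rule nn_integral_mono)
    also have "\<dots> = ennreal (k z * m) * ennreal (max q (q + z) - min p (p + z))"
      using \<open>p \<le> q\<close> by (subst nn_integral_cmult_indicator) auto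
    also have "max q (q + z) - min p (p + z) = q - p + \<bar>z\<bar>"
      by auto
    also have "ennreal (k z * m) * ennreal (q - p + \<bar>z\<bar>) = ennreal (k z * (m * (q - p + \<bar>z\<bar>)))"
      using k_nonneg[of z] \<open>p \<le> q\<close> by (subst ennreal_mult[symmetric]) (auto simp: m_def mult.assoc)
    finally show "(\<integral>\<^sup>+x. ennreal (k z * (norm (\<phi> x - \<phi> (x - z)))\<^sup>2) \<partial>lborel)
      \<le> ennreal (k z * layer_weight M \<Lambda> (q - p) z)"
      unfolding m_def .
  qed
  finally show ?thesis .
qed

text \<open>The layer bound for a ramp from \<open>0\<close> to \<open>1\<close> of length
  \<open>L\<close>, whose slope is \<open>1 / L\<close>.\<close>

definition cutoff_cost :: "real \<Rightarrow> ennreal" where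
  "cutoff_cost L = (\<integral>\<^sup>+z. ennreal (k z * (layer_weight 1 (1 / L) L z)) \<partial>lborel)"

text \<open>The Lipschitz bound controls small lags and the bound on the oscillation large ones;
  together they dominate the weight by a multiple of \<open>min (z\<^sup>2) \<bar>z\<bar>\<close>,
  whose integral against the kernel is finite.\<close>

lemma interaction_layer_finite:
  fixes \<phi> :: "real \<Rightarrow> 'a::euclidean_space"
  assumes "continuous_on UNIV \<phi>"
    and M: "\<And>x y. norm (\<phi> x - \<phi> y) \<le> M" and \<Lambda>: "\<And>x y. norm (\<phi> x - \<phi> y) \<le> \<Lambda> * \<bar>x - y\<bar>"
    and "p \<le> q"
    and left: "\<And>x. x \<le> p \<Longrightarrow> \<phi> x = \<phi> p" and right: "\<And>x. q \<le> x \<Longrightarrow> \<phi> x = \<phi> q"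
  shows "interaction UNIV \<phi> < \<infinity>"
proof -
  have M0: "M \<ge> 0" and \<Lambda>0: "\<Lambda> \<ge> 0"
    using M[of 0 0] order_trans[OF norm_ge_zero \<Lambda>[of 1 0]] by auto
  define C where "C = (M\<^sup>2 + \<Lambda>\<^sup>2) * (q - p + 1)"
  have C0: "C \<ge> 0"
    unfolding C_def using \<open>p \<le> q\<close> by auto
  have bound: "layer_weight M \<Lambda> (q - p) z \<le> C * min (z\<^sup>2) \<bar>z\<bar>" for z
  proof (cases "\<bar>z\<bar> \<le> 1")
    case True
    have "(min M (\<Lambda> * \<bar>z\<bar>))\<^sup>2 \<le> (\<Lambda> * \<bar>z\<bar>)\<^sup>2"
      using M0 \<Lambda>0 by (intro power_mono) auto
    also have "\<dots> \<le> (M\<^sup>2 + \<Lambda>\<^sup>2) * z\<^sup>2"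
      by (simp add: power_mult_distrib algebra_simps)
    finally have "layer_weight M \<Lambda> (q - p) z \<le> (M\<^sup>2 + \<Lambda>\<^sup>2) * z\<^sup>2 * (q - p + 1)"
      using True \<open>p \<le> q\<close> by (intro mult_mono) auto
    moreover have "z\<^sup>2 \<le> \<bar>z\<bar>"
      using True mult_right_mono[of "\<bar>z\<bar>" 1 "\<bar>z\<bar>"] by (simp add: power2_eq_square)
    ultimately show ?thesis
      by (simp add: C_def min_def mult_ac)
  next
    case False
    have "(min M (\<Lambda> * \<bar>z\<bar>))\<^sup>2 \<le> M\<^sup>2"
      using M0 \<Lambda>0 by (intro power_mono) auto
    also have "\<dots> \<le> M\<^sup>2 + \<Lambda>\<^sup>2" by simp
    finally have 1: "(min M (\<Lambda> * \<bar>z\<bar>))\<^sup>2 \<le> M\<^sup>2 + \<Lambda>\<^sup>2" .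
    have "q - p \<le> (q - p) * \<bar>z\<bar>"
      using False \<open>p \<le> q\<close> by (simp add: mult_le_cancel_left1)
    then have "q - p + \<bar>z\<bar> \<le> (q - p + 1) * \<bar>z\<bar>"
      by (simp add: algebra_simps)
    with 1 have "layer_weight M \<Lambda> (q - p) z \<le> (M\<^sup>2 + \<Lambda>\<^sup>2) * ((q - p + 1) * \<bar>z\<bar>)"
      using \<open>p \<le> q\<close> by (intro mult_mono) auto
    moreover have "\<bar>z\<bar> \<le> z\<^sup>2"
      using False mult_right_mono[of 1 "\<bar>z\<bar>" "\<bar>z\<bar>"] by (simp add: power2_eq_square)
    ultimately show ?thesis
      by (simp add: C_def min_def mult_ac)
  qed
  have "interaction UNIV \<phi> \<le> (\<integral>\<^sup>+z. ennreal (k z * layer_weight M \<Lambda> (q - p) z) \<partial>lborel)"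
    by (rule interaction_layer[OF assms])
  also have "\<dots> \<le> (\<integral>\<^sup>+z. ennreal C * ennreal (k z * min (z\<^sup>2) \<bar>z\<bar>) \<partial>lborel)"
  proof (rule nn_integral_mono)
    fix z
    show "ennreal (k z * layer_weight M \<Lambda> (q - p) z) \<le> ennreal C * ennreal (k z * min (z\<^sup>2) \<bar>z\<bar>)"
      using mult_left_mono[OF bound[of z] k_nonneg[of z]] C0 k_nonneg[of z]
      by (subst ennreal_mult[symmetric]) (auto simp: mult_ac intro!: ennreal_leI)
  qed
  also have "\<dots> = ennreal C * (\<integral>\<^sup>+z. ennreal (k z * min (z\<^sup>2) \<bar>z\<bar>) \<partial>lborel)"
    by (rule nn_integral_cmult) auto
  also have "\<dots> < \<infinity>"
    using kernel_moment by (simp add: ennreal_mult_less_top)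
  finally show ?thesis .
qed

text \<open>Dominated convergence: for lengths at least \<open>1\<close> the weight is at most
  \<open>2 * min (z\<^sup>2) \<bar>z\<bar>\<close> and, for fixed \<open>z\<close>, at most
  \<open>(1 + \<bar>z\<bar>) * z\<^sup>2\<close> divided by the length.\<close>

lemma cutoff_cost_tendsto_0: "(cutoff_cost \<longlongrightarrow> 0) at_top"
proof (rule tendsto_at_topI_sequentially)
  fix X :: "nat \<Rightarrow> real"
  assume X: "filterlim X at_top sequentially"
  \<comment> \<open>Both bounds on the weight need the length to be at least \<open>1\<close>, which
    is guaranteed only eventually along \<open>X\<close>.\<close>
  define Y where "Y n = max 1 (X n)" for n
  define f where "f n z = ennreal (k z * (layer_weight 1 (1 / Y n) (Y n) z))" for n z
  have Y: "filterlim Y at_top sequentially"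
    unfolding Y_def by (rule filterlim_at_top_mono[OF X]) auto
  have Y1: "Y n \<ge> 1" for n by (simp add: Y_def)
  have bound: "layer_weight 1 (1 / Y n) (Y n) z \<le> 2 * min (z\<^sup>2) \<bar>z\<bar>"
    and bound': "layer_weight 1 (1 / Y n) (Y n) z \<le> (1 + \<bar>z\<bar>) * z\<^sup>2 / Y n" for n z
  proof -
    let ?y = "Y n"
    have y: "?y \<ge> 1" by (rule Y1)
    have A: "(min 1 (1 / ?y * \<bar>z\<bar>))\<^sup>2 \<le> (1 / ?y * \<bar>z\<bar>)\<^sup>2"
      using y by (intro power_mono) auto
    have "?y + \<bar>z\<bar> \<le> ?y + ?y * \<bar>z\<bar>"
      using y by (simp add: mult_le_cancel_right1)
    then have "layer_weight 1 (1 / ?y) ?y z \<le> (1 / ?y * \<bar>z\<bar>)\<^sup>2 * (?y + ?y * \<bar>z\<bar>)"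
      using A y by (intro mult_mono) auto
    also have "\<dots> = (1 + \<bar>z\<bar>) * z\<^sup>2 / ?y"
      using y by (simp add: field_simps power2_eq_square)
    finally show "layer_weight 1 (1 / ?y) ?y z \<le> (1 + \<bar>z\<bar>) * z\<^sup>2 / ?y" .
    show "layer_weight 1 (1 / ?y) ?y z \<le> 2 * min (z\<^sup>2) \<bar>z\<bar>"
    proof (cases "\<bar>z\<bar> \<le> ?y")
      case True
      have "layer_weight 1 (1 / ?y) ?y z \<le> (1 / ?y * \<bar>z\<bar>)\<^sup>2 * (?y + ?y)"
        using A True y by (intro mult_mono) auto
      also have "\<dots> = 2 * (z\<^sup>2 / ?y)"
        using y by (simp add: field_simps power2_eq_square)
      finally have *: "layer_weight 1 (1 / ?y) ?y z \<le> 2 * (z\<^sup>2 / ?y)" .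
      have "z\<^sup>2 / ?y \<le> z\<^sup>2"
        using y by (simp add: divide_le_eq mult_le_cancel_left1)
      moreover have "z\<^sup>2 / ?y \<le> \<bar>z\<bar>"
      proof -
        have "\<bar>z\<bar> * \<bar>z\<bar> \<le> \<bar>z\<bar> * ?y" using True by (intro mult_left_mono) auto
        then have "z\<^sup>2 \<le> \<bar>z\<bar> * ?y" by (simp add: power2_eq_square)
        then show ?thesis using y by (subst pos_divide_le_eq) auto
      qed
      ultimately show ?thesis using * by auto
    next
      case False
      have "(min 1 (1 / ?y * \<bar>z\<bar>))\<^sup>2 \<le> 1\<^sup>2"
        using y by (intro power_mono) auto
      then have "layer_weight 1 (1 / ?y) ?y z \<le> 1 * (\<bar>z\<bar> + \<bar>z\<bar>)"
        using False y by (intro mult_mono) auto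
      moreover have "\<bar>z\<bar> \<le> z\<^sup>2"
        using False y mult_right_mono[of 1 "\<bar>z\<bar>" "\<bar>z\<bar>"] by (simp add: power2_eq_square)
      ultimately show ?thesis by auto
    qed
  qed
  have "(\<lambda>n. \<integral>\<^sup>+z. f n z \<partial>lborel) \<longlonglongrightarrow> (\<integral>\<^sup>+z. 0 \<partial>(lborel :: real measure))"
  proof (rule nn_integral_dominated_convergence[where w = "\<lambda>z. ennreal 2 * ennreal (k z * min (z\<^sup>2) \<bar>z\<bar>)"])
    show "f i \<in> borel_measurable lborel" for i
      unfolding f_def by measurable
    show "(\<integral>\<^sup>+z. ennreal 2 * ennreal (k z * min (z\<^sup>2) \<bar>z\<bar>) \<partial>lborel) < \<infinity>"
      using kernel_moment by (subst nn_integral_cmult) (auto simp: ennreal_mult_less_top)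
    show "AE x in lborel. f j x \<le> ennreal 2 * ennreal (k x * min (x\<^sup>2) \<bar>x\<bar>)" for j
    proof (rule AE_I2)
      fix z :: real
      have "k z * (layer_weight 1 (1 / Y j) (Y j) z) \<le> 2 * (k z * min (z\<^sup>2) \<bar>z\<bar>)"
        using mult_left_mono[OF bound[of j z] k_nonneg[of z]] by (simp only: mult_ac)
      then show "f j z \<le> ennreal 2 * ennreal (k z * min (z\<^sup>2) \<bar>z\<bar>)"
        unfolding f_def using k_nonneg[of z] by (subst ennreal_mult[symmetric]) (auto intro!: ennreal_leI)
    qed
    show "AE x in lborel. (\<lambda>i. f i x) \<longlonglongrightarrow> 0"
    proof (rule AE_I2)
      fix z :: real
      have lim: "(\<lambda>i. k z * ((1 + \<bar>z\<bar>) * z\<^sup>2 / Y i)) \<longlonglongrightarrow> 0"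
        by (rule tendsto_mult_right_zero[OF real_tendsto_divide_at_top[OF tendsto_const Y]])
      have "(\<lambda>i. k z * (layer_weight 1 (1 / Y i) (Y i) z)) \<longlonglongrightarrow> 0"
      proof (rule tendsto_sandwich[OF always_eventually always_eventually tendsto_const lim]; rule allI)
        fix i
        show "0 \<le> k z * (layer_weight 1 (1 / Y i) (Y i) z)"
          using k_nonneg[of z] Y1[of i] by (intro mult_nonneg_nonneg) auto
        show "k z * (layer_weight 1 (1 / Y i) (Y i) z) \<le> k z * ((1 + \<bar>z\<bar>) * z\<^sup>2 / Y i)"
          by (rule mult_left_mono[OF bound' k_nonneg])
      qed
      then show "(\<lambda>i. f i z) \<longlonglongrightarrow> 0"
        unfolding f_def by (rule tendsto_ennrealI[of _ 0, unfolded ennreal_0])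
    qed
  qed auto
  then have "(\<lambda>n. cutoff_cost (Y n)) \<longlonglongrightarrow> 0"
    unfolding f_def cutoff_cost_def by simp
  moreover have "\<forall>\<^sub>F n in sequentially. cutoff_cost (Y n) = cutoff_cost (X n)"
    using filterlim_at_top[THEN iffD1, OF X, rule_format, of 1]
    by eventually_elim (simp add: Y_def)
  ultimately show "(\<lambda>n. cutoff_cost (X n)) \<longlonglongrightarrow> 0"
    by (rule Lim_transform_eventually)
qed

end

section \<open>Hoelder estimate\<close>

lemma nn_integral_continuous_interval:
  fixes g :: "real \<Rightarrow> real"
  assumes "continuous_on {a..b} g" "\<And>x. x \<in> {a..b} \<Longrightarrow> 0 \<le> g x"
  shows "(\<integral>\<^sup>+x. ennreal (g x) * indicator {a..b} x \<partial>lborel) = ennreal (integral {a..b} g)"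
  using assms
  by (intro nn_integral_has_integral_lebesgue') (auto intro: integrable_integral integrable_continuous_interval)

definition average :: "real \<Rightarrow> real \<Rightarrow> (real \<Rightarrow> 'a::euclidean_space) \<Rightarrow> 'a" where
  "average a b Q = (1 / (b - a)) *\<^sub>R integral {a..b} Q"

lemma average_diff:
  fixes Q :: "real \<Rightarrow> 'a::euclidean_space"
  assumes "continuous_on {a..b} Q" "a < b"
  shows "v - average a b Q = average a b (\<lambda>y. v - Q y)"
    and "average a b Q - v = average a b (\<lambda>y. Q y - v)"
proof -
  have "integral {a..b} (\<lambda>y. v - Q y) = (b - a) *\<^sub>R v - integral {a..b} Q"
    "integral {a..b} (\<lambda>y. Q y - v) = integral {a..b} Q - (b - a) *\<^sub>R v"
    using assms integrable_continuous_interval[OF assms(1)]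
    by (simp_all add: Henstock_Kurzweil_Integration.integral_diff integrable_const_ivl)
  then show "v - average a b Q = average a b (\<lambda>y. v - Q y)"
    and "average a b Q - v = average a b (\<lambda>y. Q y - v)"
    using assms(2) by (simp_all add: average_def scaleR_right_diff_distrib)
qed

lemma norm_average_le:
  fixes Q :: "real \<Rightarrow> 'a::euclidean_space"
  assumes "continuous_on {a..b} Q" "a < b" "continuous_on {a..b} g" "\<And>y. y \<in> {a..b} \<Longrightarrow> norm (Q y) \<le> g y"
  shows "norm (average a b Q) \<le> average a b g"
proof -
  have "norm (integral {a..b} Q) \<le> integral {a..b} g"
    using assms by (intro integral_norm_bound_integral integrable_continuous_interval) auto
  then show ?thesis
    using assms(2) by (simp add: average_def mult_left_mono divide_right_mono)
qed

lemma average_tendsto: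
  fixes Q :: "real \<Rightarrow> 'a::euclidean_space"
  assumes Q: "continuous_on UNIV Q"
    and uv: "\<And>n. u n \<le> x" "\<And>n. x \<le> v n" "\<And>n. u n < v n" and lim: "(\<lambda>n. v n - u n) \<longlonglongrightarrow> 0"
  shows "(\<lambda>n::nat. average (u n) (v n) Q) \<longlonglongrightarrow> Q x"
proof (rule LIMSEQ_I)
  fix e :: real
  assume "0 < e"
  then obtain d where d: "d > 0" "\<And>y. dist y x < d \<Longrightarrow> dist (Q y) (Q x) < e / 2"
    using Q unfolding continuous_on_iff by (metis UNIV_I half_gt_zero)
  obtain n0 where n0: "\<And>n. n \<ge> n0 \<Longrightarrow> norm (v n - u n - 0) < d"
    using LIMSEQ_D[OF lim d(1)] by blast
  have "norm (average (u n) (v n) Q - Q x) < e" if "n \<ge> n0" for n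
  proof -
    have c: "continuous_on {u n..v n} Q"
      using Q continuous_on_subset by blast
    have "norm (average (u n) (v n) (\<lambda>y. Q y - Q x)) \<le> average (u n) (v n) (\<lambda>y. e / 2)"
    proof (rule norm_average_le)
      fix y
      assume "y \<in> {u n..v n}"
      then have "dist y x < d"
        using n0[OF that] uv[of n] by (auto simp: dist_real_def)
      then show "norm (Q y - Q x) \<le> e / 2"
        using d(2)[of y] by (simp add: dist_norm)
    qed (use uv c in \<open>auto intro!: continuous_intros\<close>)
    also have "\<dots> = e / 2"
      using uv(3)[of n] by (simp add: average_def)
    finally show ?thesis
      using average_diff(2)[OF c uv(3)] \<open>0 < e\<close> by simp
  qed
  then show "\<exists>no. \<forall>n\<ge>no. norm (average (u n) (v n) Q - Q x) < e"
    by blast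
qed

section \<open>Hoelder continuity from the interaction energy, by averages over halved
  intervals\<close>

context kernel
begin

text \<open>The pointwise bound \<open>g \<le> t/2 + g\<^sup>2/(2t)\<close> with \<open>t = (b - a)\<^bsup>s - 1/2\<^esup>\<close> replaces the Cauchy-Schwarz
  inequality, at the price of a bound that is linear in \<open>B\<close> instead of \<open>\<surd>B\<close>.\<close>

lemma average_compare:
  fixes Q :: "real \<Rightarrow> 'a::euclidean_space"
  assumes Q: "continuous_on UNIV Q"
    and B: "interaction UNIV Q \<le> ennreal B" "0 \<le> B"
    and ab: "a < b" "b - a \<le> \<rho>" and cd: "a \<le> c" "d \<le> b" "d - c = (b - a) / 2"
  shows "norm (average a b Q - average c d Q) \<le> (1/2 + B / \<theta>) * (b - a) powr (s - 1/2)"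
proof -
  define l where "l = b - a"
  define t where "t = l powr (s - 1/2)"
  define H where "H x = integral {c..d} (\<lambda>y. (norm (Q x - Q y))\<^sup>2)" for x
  have l: "l > 0" and t: "t > 0" and cd': "c < d"
    using ab cd by (auto simp: l_def t_def)
  have [measurable]: "Q \<in> borel_measurable borel"
    using Q by (rule borel_measurable_continuous_onI)
  have Qc: "continuous_on S Q" for S
    using Q continuous_on_subset by blast
  have Hc: "continuous_on {a..b} H"
    unfolding H_def
  proof -
    have "continuous_on ({a..b} \<times> cbox c d) (\<lambda>(x, y). (norm (Q x - Q y))\<^sup>2)"
      unfolding split_beta
      by (intro continuous_intros continuous_on_compose2[OF Qc[of UNIV]]) auto
    then show "continuous_on {a..b} (\<lambda>x. integral {c..d} (\<lambda>y. (norm (Q x - Q y))\<^sup>2))"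
      using integral_continuous_on_param[of "{a..b}" c d "\<lambda>x y. (norm (Q x - Q y))\<^sup>2"] by simp
  qed
  have H0: "H x \<ge> 0" for x
    unfolding H_def by (rule integral_nonneg) (auto intro!: integrable_continuous_interval continuous_intros Qc)
  have amgm: "g \<le> t / 2 + g\<^sup>2 / (2 * t)" for g :: real
  proof -
    have "0 \<le> (t - g)\<^sup>2 / (2 * t)" using t by simp
    also have "(t - g)\<^sup>2 / (2 * t) = t / 2 + g\<^sup>2 / (2 * t) - g"
      using t by (simp add: field_simps power2_eq_square)
    finally show ?thesis by simp
  qed
  have 1: "norm (Q x - average c d Q) \<le> t / 2 + H x / (t * l)" for x
  proof -
    have "norm (Q x - average c d Q) = norm (average c d (\<lambda>y. Q x - Q y))"
      by (simp add: average_diff(1)[OF Qc cd'])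
    also have "\<dots> \<le> average c d (\<lambda>y. t / 2 + (norm (Q x - Q y))\<^sup>2 / (2 * t))"
      using cd' t by (intro norm_average_le amgm) (auto intro!: continuous_intros Qc)
    also have "\<dots> = t / 2 + H x / (t * l)"
    proof -
      have "integral {c..d} (\<lambda>y. t / 2 + (norm (Q x - Q y))\<^sup>2 / (2 * t)) = (d - c) * (t / 2) + H x / (2 * t)"
        unfolding H_def using cd' t
        by (subst integral_add) (auto intro!: integrable_continuous_interval continuous_intros Qc)
      then show ?thesis
        unfolding average_def using cd(3) l t by (simp add: l_def[symmetric] field_simps)
    qed
    finally show ?thesis .
  qed
  have "norm (average a b Q - average c d Q) = norm (average a b (\<lambda>x. Q x - average c d Q))"
    by (simp add: average_diff(2)[OF Qc ab(1)])
  also have "\<dots> \<le> average a b (\<lambda>x. t / 2 + H x / (t * l))"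
    using ab t l by (intro norm_average_le 1) (auto intro!: continuous_intros Qc Hc)
  also have "\<dots> = t / 2 + integral {a..b} H / (t * l\<^sup>2)"
  proof -
    have "integral {a..b} (\<lambda>x. t / 2 + H x / (t * l)) = l * (t / 2) + integral {a..b} H / (t * l)"
      using ab t l
      by (subst integral_add) (auto intro!: integrable_continuous_interval continuous_intros Hc simp: l_def)
    then show ?thesis
      unfolding average_def using l t by (simp add: l_def[symmetric] field_simps power2_eq_square)
  qed
  also have "integral {a..b} H \<le> l powr (1 + 2 * s) / \<theta> * B"
  proof -
    define C where "C = l powr (1 + 2 * s) / \<theta>"
    have C: "C \<ge> 0" using \<theta>_pos by (simp add: C_def)
    \<comment> \<open>On an interval of length \<open>l \<le> \<rho>\<close> the kernel is at least
      \<open>\<theta> * l powr (- 1 - 2 * s)\<close>, which is \<open>1 / C\<close>.\<close>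
    have pt: "(norm (Q x - Q y))\<^sup>2 \<le> C * (k (x - y) * (norm (Q x - Q y))\<^sup>2)"
      if "x \<in> {a..b}" "y \<in> {c..d}" for x y
    proof (cases "x = y")
      case False
      have xy: "0 < \<bar>x - y\<bar>" "\<bar>x - y\<bar> \<le> l"
        using that False cd by (auto simp: l_def)
      have "\<theta> * l powr (- 1 - 2 * s) \<le> \<theta> * \<bar>x - y\<bar> powr (- 1 - 2 * s)"
        using xy s \<theta>_pos by (intro mult_left_mono powr_mono2') auto
      also have "\<dots> \<le> k (x - y)"
        using xy ab by (intro k_lower) (auto simp: l_def)
      finally have "C * (\<theta> * l powr (- 1 - 2 * s)) \<le> C * k (x - y)"
        using C by (rule mult_left_mono)
      moreover have "C * (\<theta> * l powr (- 1 - 2 * s)) = 1"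
      proof -
        have "C * (\<theta> * l powr (- 1 - 2 * s)) = l powr (1 + 2 * s) * l powr (- 1 - 2 * s)"
          using \<theta>_pos by (simp add: C_def)
        also have "\<dots> = 1"
          using l by (simp only: powr_add[symmetric]) simp
        finally show ?thesis .
      qed
      ultimately show ?thesis
        using mult_right_mono[of 1 "C * k (x - y)" "(norm (Q x - Q y))\<^sup>2"] by (simp add: mult.assoc)
    qed simp
    have "ennreal (integral {a..b} H) = (\<integral>\<^sup>+x. ennreal (H x) * indicator {a..b} x \<partial>lborel)"
      using Hc H0 by (subst nn_integral_continuous_interval) auto
    also have "\<dots> \<le> (\<integral>\<^sup>+x. \<integral>\<^sup>+y. ennreal C * ennreal (k (x - y) * (norm (Q x - Q y))\<^sup>2) \<partial>lborel \<partial>lborel)"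
    proof (rule nn_integral_mono)
      fix x
      show "ennreal (H x) * indicator {a..b} x \<le> (\<integral>\<^sup>+y. ennreal C * ennreal (k (x - y) * (norm (Q x - Q y))\<^sup>2) \<partial>lborel)"
      proof (cases "x \<in> {a..b}")
        case True
        have "ennreal (H x) = (\<integral>\<^sup>+y. ennreal ((norm (Q x - Q y))\<^sup>2) * indicator {c..d} y \<partial>lborel)"
          unfolding H_def by (subst nn_integral_continuous_interval) (auto intro!: continuous_intros Qc)
        also have "\<dots> \<le> (\<integral>\<^sup>+y. ennreal C * ennreal (k (x - y) * (norm (Q x - Q y))\<^sup>2) \<partial>lborel)"
        proof (rule nn_integral_mono)
          fix y
          show "ennreal ((norm (Q x - Q y))\<^sup>2) * indicator {c..d} y \<le> ennreal C * ennreal (k (x - y) * (norm (Q x - Q y))\<^sup>2)"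
            using pt[OF True, of y] C k_nonneg[of "x - y"]
            by (subst ennreal_mult[symmetric]) (auto simp: indicator_def intro!: ennreal_leI)
        qed
        finally show ?thesis using True by simp
      qed simp
    qed
    also have "\<dots> = (\<integral>\<^sup>+p. ennreal C * ennreal (density Q p) \<partial>lborel)"
      using interaction_measurable(1)[of Q] by (subst nn_integral_lborel_pair) auto
    also have "\<dots> = ennreal C * interaction UNIV Q"
      unfolding interaction_def using interaction_measurable(1)[of Q] by (subst nn_integral_cmult) auto
    also have "\<dots> \<le> ennreal C * ennreal B"
      by (rule mult_left_mono[OF B(1)]) auto
    also have "\<dots> = ennreal (C * B)"
      using C B by (simp add: ennreal_mult)
    finally have "integral {a..b} H \<le> C * B"
      using C B by (subst (asm) ennreal_le_iff) auto
    then show ?thesis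
      by (simp add: C_def)
  qed
  \<comment> \<open>This is what fixes the exponent of \<open>t\<close>: since
    \<open>l powr (1 + 2 * s) = t\<^sup>2 * l\<^sup>2\<close>, both terms become multiples of
    \<open>t\<close>.\<close>
  also have "t / 2 + l powr (1 + 2 * s) / \<theta> * B / (t * l\<^sup>2) = (1/2 + B / \<theta>) * t"
  proof -
    have "l powr (1 + 2 * s) = l powr ((s - 1/2) + (s - 1/2) + 2)"
      by simp
    also have "\<dots> = t * t * l\<^sup>2"
      using l by (simp only: powr_add t_def) (simp add: powr_numeral)
    finally show ?thesis
      using t l \<theta>_pos by (simp add: field_simps)
  qed
  finally show ?thesis
    using t l by (simp add: t_def l_def divide_right_mono)
qed

text \<open>The denominator comes from the geometric series with ratio
  \<open>2 powr (1/2 - s)\<close>, the factor gained each time the interval is halved; the ratio is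
  below \<open>1\<close> because \<open>s > 1/2\<close>.\<close>

definition holder_const :: "real \<Rightarrow> real" where
  "holder_const B = (1/2 + B / \<theta>) / (1 - 2 powr (1/2 - s))"

lemma holder_const_pos: "0 \<le> B \<Longrightarrow> 0 < holder_const B"
proof -
  assume "0 \<le> B"
  moreover have "2 powr (1/2 - s) < 2 powr 0"
    using s by (intro powr_less_mono) auto
  ultimately show ?thesis
    unfolding holder_const_def using \<theta>_pos by (intro divide_pos_pos add_pos_nonneg) auto
qed

text \<open>The argument of Morrey and Campanato: averages over shrinking intervals converge to the
  point value, and their successive differences are dominated by a geometric series. The intervals
  only have to be nested, halve in length and contain \<open>x\<close>, so they may shrink towards
  either end point.\<close>

lemma average_telescope:
  fixes Q :: "real \<Rightarrow> 'a::euclidean_space"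
  assumes Q: "continuous_on UNIV Q"
    and B: "interaction UNIV Q \<le> ennreal B" "0 \<le> B"
    and l: "0 < l" "l \<le> \<rho>"
    and uv: "\<And>n. v n - u n = l / 2 ^ n" "\<And>n. u n \<le> u (Suc n)" "\<And>n. v (Suc n) \<le> v n"
    and x: "\<And>n. u n \<le> x" "\<And>n. x \<le> v n"
  shows "norm (average (u 0) (v 0) Q - Q x) \<le> holder_const B * l powr (s - 1/2)"
proof -
  define q where "q = 2 powr (1/2 - s)"
  have q: "0 < q" "q < 1"
    using s powr_less_mono[of "1/2 - s" 0 2] by (auto simp: q_def)
  define C where "C = (1/2 + B / \<theta>) * l powr (s - 1/2)"
  have C: "C \<ge> 0"
    using B \<theta>_pos by (simp add: C_def)
  have uv': "u n < v n" for n
  proof -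
    have "0 < l / 2 ^ n" using l by simp
    then show ?thesis using uv(1)[of n] by linarith
  qed
  have step: "norm (average (u n) (v n) Q - average (u (Suc n)) (v (Suc n)) Q) \<le> C * q ^ n" for n
  proof -
    have "l / 2 ^ n \<le> l"
      using l by (simp add: divide_le_eq)
    then have "norm (average (u n) (v n) Q - average (u (Suc n)) (v (Suc n)) Q)
      \<le> (1/2 + B / \<theta>) * (v n - u n) powr (s - 1/2)"
      using uv' uv l by (intro average_compare[OF Q B]) auto
    also have "(v n - u n) powr (s - 1/2) = l powr (s - 1/2) * q ^ n"
    proof -
      have "q ^ n = (2 ^ n) powr (1/2 - s)"
        by (simp add: q_def powr_power mult.commute flip: powr_realpow) (simp add: powr_powr mult.commute)
      moreover have "(l / 2 ^ n) powr (s - 1/2) = l powr (s - 1/2) / (2 ^ n) powr (s - 1/2)"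
        using l by (simp add: powr_divide)
      moreover have "(2 ^ n) powr (1/2 - s) = 1 / (2 ^ n :: real) powr (s - 1/2)"
        using powr_minus_divide[of "2 ^ n :: real" "s - 1/2"] by simp
      ultimately show ?thesis by (simp add: uv)
    qed
    finally show ?thesis by (simp add: C_def mult.assoc)
  qed
  have sum: "norm (average (u 0) (v 0) Q - average (u n) (v n) Q) \<le> C * (\<Sum>j<n. q ^ j)" for n
  proof (induction n)
    case (Suc n)
    have "norm (average (u 0) (v 0) Q - average (u (Suc n)) (v (Suc n)) Q)
      \<le> norm (average (u 0) (v 0) Q - average (u n) (v n) Q)
       + norm (average (u n) (v n) Q - average (u (Suc n)) (v (Suc n)) Q)"
      using norm_triangle_ineq[of "average (u 0) (v 0) Q - average (u n) (v n) Q"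
          "average (u n) (v n) Q - average (u (Suc n)) (v (Suc n)) Q"] by simp
    also have "\<dots> \<le> C * (\<Sum>j<n. q ^ j) + C * q ^ n"
      using Suc step by (rule add_mono)
    finally show ?case by (simp add: algebra_simps)
  qed simp
  have bound: "norm (average (u 0) (v 0) Q - average (u n) (v n) Q) \<le> C / (1 - q)" for n
  proof -
    have "(\<Sum>j<n. q ^ j) \<le> 1 / (1 - q)"
      using q sum_le_suminf[OF summable_geometric[of q], of "{..<n}"] by (simp add: suminf_geometric)
    then show ?thesis
      using sum[of n] mult_left_mono[OF _ C] by fastforce
  qed
  have "(\<lambda>n. l / 2 ^ n) \<longlonglongrightarrow> 0"
    using tendsto_mult[OF tendsto_const[of l] LIMSEQ_realpow_zero[of "1/2::real"]]
    by (simp add: power_one_over)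
  then have "(\<lambda>n. average (u n) (v n) Q) \<longlonglongrightarrow> Q x"
    by (intro average_tendsto[OF Q x uv']) (simp add: uv)
  then have "(\<lambda>n. norm (average (u 0) (v 0) Q - average (u n) (v n) Q)) \<longlonglongrightarrow> norm (average (u 0) (v 0) Q - Q x)"
    by (intro tendsto_intros)
  then have "norm (average (u 0) (v 0) Q - Q x) \<le> C / (1 - q)"
    by (rule LIMSEQ_le_const2) (use bound in blast)
  then show ?thesis
    by (simp add: C_def holder_const_def q_def)
qed

text \<open>One and the same average over \<open>{x..y}\<close> is compared with \<open>Q x\<close>,
  by shrinking to the left end, and with \<open>Q y\<close>, by shrinking to the right end.\<close>

lemma holder_estimate:
  fixes Q :: "real \<Rightarrow> 'a::euclidean_space"
  assumes Q: "continuous_on UNIV Q"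
    and B: "interaction UNIV Q \<le> ennreal B" "0 \<le> B"
    and xy: "\<bar>x - y\<bar> \<le> \<rho>"
  shows "norm (Q x - Q y) \<le> 2 * holder_const B * \<bar>x - y\<bar> powr (s - 1/2)"
  using xy
proof (induction x y rule: linorder_wlog)
  case (le x y)
  show ?case
  proof (cases "x = y")
    case False
    define l where "l = y - x"
    have l: "0 < l" "l \<le> \<rho>"
      using le False by (auto simp: l_def)
    have l2: "l / 2 ^ n > 0" "l / (2 * 2 ^ n) \<le> l / 2 ^ n" "l / 2 ^ n \<le> l" for n
      using l by (auto simp: field_simps)
    have "norm (average x y Q - Q x) \<le> holder_const B * l powr (s - 1/2)"
      using average_telescope[OF Q B l, of "\<lambda>n. x + l / 2 ^ n" "\<lambda>n. x" x] l2 l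
      by (simp add: l_def less_imp_le)
    moreover have "norm (average x y Q - Q y) \<le> holder_const B * l powr (s - 1/2)"
      using average_telescope[OF Q B l, of "\<lambda>n. y" "\<lambda>n. y - l / 2 ^ n" y] l2 l
      by (simp add: l_def less_imp_le)
    ultimately have "norm (Q x - Q y) \<le> 2 * holder_const B * l powr (s - 1/2)"
      using norm_triangle_ineq4[of "average x y Q - Q y" "average x y Q - Q x"] by simp
    then show ?thesis
      using l by (simp add: l_def abs_minus_commute)
  qed simp
next
  case (sym x y)
  then show ?case by (simp add: norm_minus_commute abs_minus_commute)
qed

text \<open>The length \<open>l\<close> depends on \<open>\<tau>\<close> and on the energy bound but
  not on \<open>Q\<close>. This uniformity makes minimizing sequences equicontinuous and lets the
  size of contact intervals be fixed before \<open>\<epsilon>\<close>.\<close>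

lemma modulus_of_continuity:
  assumes "0 < \<tau>" "0 \<le> B"
  obtains l where "0 < l"
    "\<And>(Q :: real \<Rightarrow> 'a::euclidean_space) x y. continuous_on UNIV Q \<Longrightarrow> interaction UNIV Q \<le> ennreal B \<Longrightarrow>
       \<bar>x - y\<bar> \<le> l \<Longrightarrow> norm (Q x - Q y) \<le> \<tau>"
proof -
  define C where "C = 2 * holder_const B"
  define l where "l = min \<rho> ((\<tau> / C) powr (1 / (s - 1/2)))"
  have C: "C > 0"
    using holder_const_pos[OF assms(2)] by (simp add: C_def)
  have "0 < l"
    using \<rho>_pos C assms by (simp add: l_def)
  moreover have "norm (Q x - Q y) \<le> \<tau>"
    if "continuous_on UNIV Q" "interaction UNIV Q \<le> ennreal B" "\<bar>x - y\<bar> \<le> l"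
    for Q :: "real \<Rightarrow> 'a" and x y
  proof -
    have "norm (Q x - Q y) \<le> C * \<bar>x - y\<bar> powr (s - 1/2)"
      using holder_estimate[OF that(1,2) assms(2), of x y] that(3) by (simp add: l_def C_def)
    also have "\<dots> \<le> C * ((\<tau> / C) powr (1 / (s - 1/2))) powr (s - 1/2)"
      using C s that(3) by (intro mult_left_mono powr_mono2) (auto simp: l_def)
    also have "\<dots> = \<tau>"
      using C s assms by (simp add: powr_powr)
    finally show ?thesis .
  qed
  ultimately show ?thesis using that by blast
qed

end

section \<open>Periodic potentials and existence of minimizers\<close>

lemma liminf_add_le_ennreal:
  fixes f g :: "nat \<Rightarrow> ennreal"
  shows "liminf f + liminf g \<le> liminf (\<lambda>n. f n + g n)"
proof -
  have "liminf f + liminf g = (SUP n. (INF m\<in>{n..}. f m) + (INF m\<in>{n..}. g m))"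
    unfolding liminf_SUP_INF
    by (intro ennreal_SUP_add[symmetric]) (auto intro!: incseq_SucI INF_superset_mono)
  also have "\<dots> \<le> (SUP n. INF m\<in>{n..}. f m + g m)"
    by (intro SUP_mono) (auto intro!: INF_greatest add_mono INF_lower)
  finally show ?thesis
    by (simp add: liminf_SUP_INF)
qed

locale potential =
  fixes W :: "real ^ 'n \<Rightarrow> real" and g :: "real ^ 'n \<Rightarrow> real ^ 'n" and r c0 C0 Lg :: real
  assumes W_deriv: "\<And>x. (W has_derivative (\<lambda>h. h \<bullet> g x)) (at x)"
    and g_lip: "\<And>x y. norm (g x - g y) \<le> Lg * norm (x - y)"
    and W_periodic: "\<And>\<tau> \<zeta>. \<zeta> \<in> int_lattice \<Longrightarrow> W (\<tau> + \<zeta>) = W \<tau>"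
    and W_lattice: "\<And>\<zeta>. \<zeta> \<in> int_lattice \<Longrightarrow> W \<zeta> = 0"
    and W_pos: "\<And>\<tau>. \<tau> \<notin> int_lattice \<Longrightarrow> 0 < W \<tau>"
    and r: "0 < r" "r \<le> 1/4" and c0: "0 < c0" and C0: "0 < C0"
    and W_quadratic: "\<And>\<tau>. norm \<tau> < r \<Longrightarrow> c0 * (norm \<tau>)\<^sup>2 \<le> W \<tau>" "\<And>\<tau>. norm \<tau> < r \<Longrightarrow> W \<tau> \<le> C0 * (norm \<tau>)\<^sup>2"
begin

lemma W_continuous: "continuous_on S W"
  by (rule has_derivative_continuous_on[OF has_derivative_at_withinI[OF W_deriv]])

lemma W_measurable[measurable]: "W \<in> borel_measurable borel"
  by (rule borel_measurable_continuous_onI[OF W_continuous])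

lemma W_nonneg: "0 \<le> W \<tau>"
  by (metis W_lattice W_pos less_eq_real_def)

lemma g_continuous: "continuous_on S g"
proof (rule continuous_on_subset[of UNIV])
  have "Lg-lipschitz_on UNIV g" if "Lg \<ge> 0"
    using g_lip that by (auto simp: lipschitz_on_def dist_norm)
  moreover have "0 \<le> Lg"
    using order_trans[OF norm_ge_zero g_lip[of "axis undefined 1" 0]] by simp
  ultimately show "continuous_on UNIV g"
    using lipschitz_on_continuous_on by blast
qed simp

lemma lattice_uminus: "\<zeta> \<in> int_lattice \<Longrightarrow> - \<zeta> \<in> int_lattice"
  by (simp add: int_lattice_def)

lemma lattice_add: "\<zeta> \<in> int_lattice \<Longrightarrow> \<zeta>' \<in> int_lattice \<Longrightarrow> \<zeta> + \<zeta>' \<in> int_lattice"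
  by (simp add: int_lattice_def)

lemma lattice_scale: "\<zeta> \<in> int_lattice \<Longrightarrow> real m *\<^sub>R \<zeta> \<in> int_lattice"
  by (simp add: int_lattice_def)

lemma W_periodic_diff: "\<zeta> \<in> int_lattice \<Longrightarrow> W (\<tau> - \<zeta>) = W \<tau>"
  using W_periodic[OF lattice_uminus, of \<zeta> \<tau>] by simp

lemma W_quadratic_lattice:
  assumes "\<zeta> \<in> int_lattice" "norm (\<tau> - \<zeta>) < r"
  shows "c0 * (norm (\<tau> - \<zeta>))\<^sup>2 \<le> W \<tau>" "W \<tau> \<le> C0 * (norm (\<tau> - \<zeta>))\<^sup>2"
  using W_quadratic[OF assms(2)] W_periodic_diff[OF assms(1), of \<tau>] by auto

lemma Lg_nonneg: "0 \<le> Lg"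
  using order_trans[OF norm_ge_zero g_lip[of "axis undefined 1" 0]] by simp

text \<open>A one-sided bound is enough for the Euler-Lagrange equation, because it only serves to
  bound the action of a competitor from above.\<close>

lemma W_taylor: "W (x + h) \<le> W x + h \<bullet> g x + Lg * (norm h)\<^sup>2"
proof -
  have "\<exists>t\<in>{0<..<1}. W (x + 1 *\<^sub>R h) - W (x + 0 *\<^sub>R h) = ((1 - 0) *\<^sub>R h) \<bullet> g (x + t *\<^sub>R h)"
  proof (rule mvt_simple)
    fix t :: real
    have "((\<lambda>t. W (x + t *\<^sub>R h)) has_derivative (\<lambda>u. (u *\<^sub>R h) \<bullet> g (x + t *\<^sub>R h))) (at t)"
      by (rule has_derivative_compose[OF _ W_deriv, of "\<lambda>t. x + t *\<^sub>R h"]) (auto intro!: derivative_eq_intros)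
    then show "((\<lambda>t. W (x + t *\<^sub>R h)) has_derivative (\<lambda>u. (u *\<^sub>R h) \<bullet> g (x + t *\<^sub>R h))) (at t within {0..1})"
      by (rule has_derivative_at_withinI)
  qed simp
  then obtain t where t: "0 < t" "t < 1" "W (x + h) - W x = h \<bullet> g (x + t *\<^sub>R h)"
    by auto
  have "h \<bullet> (g (x + t *\<^sub>R h) - g x) \<le> norm h * norm (g (x + t *\<^sub>R h) - g x)"
    by (rule norm_cauchy_schwarz)
  also have "\<dots> \<le> norm h * (Lg * norm (t *\<^sub>R h))"
    using g_lip[of "x + t *\<^sub>R h" x] by (intro mult_left_mono) auto
  also have "\<dots> = t * (Lg * (norm h)\<^sup>2)"
    using t by (simp add: power2_eq_square)
  also have "\<dots> \<le> 1 * (Lg * (norm h)\<^sup>2)"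
    using t Lg_nonneg by (intro mult_right_mono) auto
  finally show ?thesis
    using t(3) by (simp add: inner_diff_right)
qed

text \<open>By periodicity \<open>\<tau>\<close> may be moved into the unit cube. The points there
  with some coordinate within \<open>1/4\<close> of \<open>1/2\<close> form a compact set without
  lattice points, on which \<open>W\<close> attains a positive minimum.\<close>

lemma W_crossing:
  obtains w where "0 < w" "\<And>\<tau> j m. \<bar>\<tau> $ j - (of_int m + 1/2)\<bar> \<le> 1/4 \<Longrightarrow> w \<le> W \<tau>"
proof -
  define K :: "(real ^ 'n) set" where "K = {\<tau> \<in> cbox 0 (\<chi> i. 1). \<exists>j::'n. \<bar>\<tau> $ j - 1/2\<bar> \<le> 1/4}"
  have "K = (\<Union>j. cbox 0 (\<chi> i. 1) \<inter> {\<tau>. \<bar>\<tau> $ j - 1/2\<bar> \<le> 1/4})"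
    by (auto simp: K_def)
  then have K: "compact K"
    by (auto intro!: compact_UN compact_Int_closed closed_Collect_le continuous_intros)
  have "(\<chi> i. 1/2) \<in> K"
    by (auto simp: K_def mem_box_cart)
  then obtain \<tau>0 where \<tau>0: "\<tau>0 \<in> K" "\<And>\<tau>. \<tau> \<in> K \<Longrightarrow> W \<tau>0 \<le> W \<tau>"
    using continuous_attains_inf[OF K _ W_continuous] by blast
  have "\<tau>0 \<notin> int_lattice"
  proof
    assume lat: "\<tau>0 \<in> int_lattice"
    from \<tau>0(1) obtain j where j: "\<bar>\<tau>0 $ j - 1/2\<bar> \<le> 1/4"
      by (auto simp: K_def)
    from lat obtain m where "\<tau>0 $ j = of_int m"
      by (auto simp: int_lattice_def Ints_def)
    with j have "0 < (of_int m :: real)" "(of_int m :: real) < 1"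
      by (auto simp: abs_if split: if_splits)
    then show False by simp
  qed
  then have "0 < W \<tau>0"
    by (rule W_pos)
  moreover have "W \<tau>0 \<le> W \<tau>" if "\<bar>\<tau> $ j - (of_int m + 1/2)\<bar> \<le> 1/4" for \<tau> j m
  proof -
    define \<zeta> :: "real ^ 'n" where "\<zeta> = (\<chi> i. of_int \<lfloor>\<tau> $ i\<rfloor>)"
    have "\<zeta> \<in> int_lattice"
      by (simp add: \<zeta>_def int_lattice_def)
    have "\<lfloor>\<tau> $ j\<rfloor> = m"
      using that by (intro floor_unique) (auto simp: abs_if split: if_splits)
    then have "\<tau> - \<zeta> \<in> K"
      using that unfolding K_def \<zeta>_def mem_box_cart
      by (auto simp: abs_le_iff algebra_simps intro!: exI[of _ j]) linarith+
    then show ?thesis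
      using \<tau>0(2) W_periodic_diff[OF \<open>\<zeta> \<in> int_lattice\<close>, of \<tau>] by fastforce
  qed
  ultimately show ?thesis using that by blast
qed

definition pot :: "(real \<Rightarrow> real) \<Rightarrow> (real \<Rightarrow> real ^ 'n) \<Rightarrow> ennreal" where
  "pot a Q = (\<integral>\<^sup>+x. ennreal (a x * W (Q x)) \<partial>lborel)"

lemma pot_mono: "(\<And>x. a x \<le> b x) \<Longrightarrow> pot a Q \<le> pot b Q"
  unfolding pot_def by (intro nn_integral_mono ennreal_leI mult_right_mono W_nonneg)

lemma pot_interval_lower:
  assumes "\<And>x. x \<in> {p..q} \<Longrightarrow> w \<le> a x * W (Q x)" "p \<le> q" "0 \<le> w"
  shows "ennreal (w * (q - p)) \<le> pot a Q"
proof -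
  have "ennreal (w * (q - p)) = (\<integral>\<^sup>+x. ennreal w * indicator {p..q} x \<partial>lborel)"
    using assms by (simp add: nn_integral_cmult_indicator ennreal_mult)
  also have "\<dots> \<le> pot a Q"
    unfolding pot_def using assms(1) by (intro nn_integral_mono) (auto simp: indicator_def intro!: ennreal_leI)
  finally show ?thesis .
qed

lemma pot_cmult:
  assumes [measurable]: "Q \<in> borel_measurable borel" "a \<in> borel_measurable borel"
    and "\<And>x. 0 \<le> a x" "0 \<le> c"
  shows "pot (\<lambda>x. c * a x) Q = ennreal c * pot a Q"
proof -
  have "ennreal (c * a x * W (Q x)) = ennreal c * ennreal (a x * W (Q x))" for x
    using assms W_nonneg by (simp add: mult.assoc ennreal_mult)
  then show ?thesis
    unfolding pot_def by (simp add: nn_integral_cmult)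
qed

lemma pot_add:
  assumes [measurable]: "Q \<in> borel_measurable borel" "a \<in> borel_measurable borel" "b \<in> borel_measurable borel"
    and "\<And>x. 0 \<le> a x" "\<And>x. 0 \<le> b x"
  shows "pot (\<lambda>x. a x + b x) Q = pot a Q + pot b Q"
proof -
  have "ennreal ((a x + b x) * W (Q x)) = ennreal (a x * W (Q x)) + ennreal (b x * W (Q x))" for x
    using assms W_nonneg by (simp add: distrib_right)
  then show ?thesis
    unfolding pot_def by (simp add: nn_integral_add)
qed

end

section \<open>Oscillation bound and the direct method\<close>

locale transition_problem = kernel k s \<rho> \<theta> \<Theta> + potential W g r c0 C0 Lg
  for k :: "real \<Rightarrow> real" and s \<rho> \<theta> \<Theta> :: real
    and W :: "real ^ 'n \<Rightarrow> real" and g :: "real ^ 'n \<Rightarrow> real ^ 'n" and r c0 C0 Lg :: real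
begin

text \<open>Each half-integer level crossed by a coordinate of \<open>Q\<close> costs a fixed amount of potential energy,
  and crossings of different levels take place on disjoint intervals.\<close>

lemma oscillation_bound:
  assumes "0 \<le> B"
  obtains R where "0 < R"
    "\<And>(Q :: real \<Rightarrow> real ^ 'n) x y. continuous_on UNIV Q \<Longrightarrow> interaction UNIV Q \<le> ennreal B \<Longrightarrow>
       pot (\<lambda>_. 1) Q \<le> ennreal B \<Longrightarrow> norm (Q x - Q y) \<le> R"
proof -
  obtain w where w: "0 < w" "\<And>\<tau> j m. \<bar>\<tau> $ j - (of_int m + 1/2)\<bar> \<le> 1/4 \<Longrightarrow> w \<le> W \<tau>"
    using W_crossing by blast
  obtain l where l: "0 < l"
    "\<And>(Q :: real \<Rightarrow> real ^ 'n) x y. continuous_on UNIV Q \<Longrightarrow> interaction UNIV Q \<le> ennreal B \<Longrightarrow>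
       \<bar>x - y\<bar> \<le> l \<Longrightarrow> norm (Q x - Q y) \<le> 1/4"
    using modulus_of_continuity[of "1/4" B] assms by auto
  \<comment> \<open>\<open>M\<close> disjoint intervals of length \<open>2 * l\<close> on which
    \<open>W\<close> is at least \<open>w\<close> exceed the budget \<open>B\<close>.\<close>
  obtain M :: nat where M: "B / (2 * l * w) < M"
    using reals_Archimedean2 by blast
  have coord: "Q y $ j' - Q x $ j' \<le> M + 1"
    if Q: "continuous_on UNIV Q" "interaction UNIV Q \<le> ennreal B" "pot (\<lambda>_. 1) Q \<le> ennreal B"
    for Q :: "real \<Rightarrow> real ^ 'n" and x y j'
  proof (rule ccontr)
    assume neg: "\<not> Q y $ j' - Q x $ j' \<le> M + 1"
    \<comment> \<open>\<open>m0 + 1/2\<close> is the lowest half-integer level at or above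
      \<open>Q x $ j'\<close>; a rise by more than \<open>M + 1\<close> meets the \<open>M\<close>
      levels that start there.\<close>
    define m0 where "m0 = \<lceil>Q x $ j' - 1/2\<rceil>"
    have "\<exists>t. Q t $ j' = of_int (m0 + int i) + 1/2" if "i < M" for i
    proof -
      have "connected (range (\<lambda>t. Q t $ j'))"
        using Q(1) by (intro connected_continuous_image continuous_intros) auto
      moreover have "Q x $ j' \<le> of_int (m0 + int i) + 1/2" "of_int (m0 + int i) + 1/2 \<le> Q y $ j'"
        using neg that unfolding m0_def by linarith+
      ultimately have "of_int (m0 + int i) + 1/2 \<in> range (\<lambda>t. Q t $ j')"
        by (meson connected_contains_Icc atLeastAtMost_iff rangeI subsetD)
      then show ?thesis by auto
    qed
    then obtain t where t: "\<And>i. i < M \<Longrightarrow> Q (t i) $ j' = of_int (m0 + int i) + 1/2"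
      by metis
    have near: "\<bar>Q u $ j' - (of_int (m0 + int i) + 1/2)\<bar> \<le> 1/4" if "i < M" "u \<in> {t i - l..t i + l}" for i u
    proof -
      have "\<bar>(Q u - Q (t i)) $ j'\<bar> \<le> norm (Q u - Q (t i))"
        by (rule component_le_norm_cart)
      also have "\<dots> \<le> 1/4"
        using that by (intro l(2) Q) (auto simp: abs_le_iff)
      finally show ?thesis
        using t[OF that(1)] by simp
    qed
    \<comment> \<open>Different levels are at least \<open>1\<close> apart, so their bands of
      half-width \<open>1/4\<close> are disjoint and \<open>u\<close> belongs to at most one of the
      intervals.\<close>
    have pt: "(\<Sum>i<M. ennreal w * indicator {t i - l..t i + l} u) \<le> ennreal (1 * W (Q u))" for u
    proof (rule sum_at_most_one_le)
      fix i j
      assume "i < M" "j < M" and "ennreal w * indicator {t i - l..t i + l} u \<noteq> 0"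
        "ennreal w * indicator {t j - l..t j + l} u \<noteq> 0"
      then have "\<bar>Q u $ j' - (of_int (m0 + int i) + 1/2)\<bar> \<le> 1/4" "\<bar>Q u $ j' - (of_int (m0 + int j) + 1/2)\<bar> \<le> 1/4"
        using near by (auto simp: indicator_def split: if_splits)
      then have "\<bar>real i - real j\<bar> \<le> 1/2"
        unfolding of_int_add of_int_of_nat_eq by linarith
      then show "i = j" by linarith
    next
      fix i
      assume "i < M"
      then show "ennreal w * indicator {t i - l..t i + l} u \<le> ennreal (1 * W (Q u))"
        using w(2)[OF near, of i u] by (auto simp: indicator_def intro!: ennreal_leI)
    qed simp
    have "ennreal (real M * (w * (2 * l))) = (\<Sum>i<M. ennreal (w * (2 * l)))"
      using w(1) l(1) by (subst sum_ennreal) auto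
    also have "\<dots> = (\<Sum>i<M. \<integral>\<^sup>+u. ennreal w * indicator {t i - l..t i + l} u \<partial>lborel)"
      using w(1) l(1) by (intro sum.cong refl) (simp add: nn_integral_cmult_indicator ennreal_mult)
    also have "\<dots> = (\<integral>\<^sup>+u. (\<Sum>i<M. ennreal w * indicator {t i - l..t i + l} u) \<partial>lborel)"
      by (rule nn_integral_sum[symmetric]) auto
    also have "\<dots> \<le> pot (\<lambda>_. 1) Q"
      unfolding pot_def by (rule nn_integral_mono) (rule pt)
    also have "\<dots> \<le> ennreal B"
      by (rule Q(3))
    finally have "real M * (w * (2 * l)) \<le> B"
      using assms by simp
    with M w(1) l(1) show False
      by (simp add: field_simps)
  qed
  show ?thesis
  proof (rule that)
    show "0 < real CARD('n) * (real M + 1)"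
      by simp
    fix Q :: "real \<Rightarrow> real ^ 'n" and x y
    assume Q: "continuous_on UNIV Q" "interaction UNIV Q \<le> ennreal B" "pot (\<lambda>_. 1) Q \<le> ennreal B"
    have "norm (Q x - Q y) \<le> (\<Sum>j\<in>UNIV. \<bar>(Q x - Q y) $ j\<bar>)"
      by (rule norm_le_l1_cart)
    also have "\<dots> \<le> (\<Sum>j\<in>(UNIV::'n set). real M + 1)"
    proof (rule sum_mono)
      fix j
      show "\<bar>(Q x - Q y) $ j\<bar> \<le> real M + 1"
        using coord[OF Q, of y j x] coord[OF Q, of x j y] by (simp add: abs_le_iff)
    qed
    finally show "norm (Q x - Q y) \<le> real CARD('n) * (real M + 1)"
      by simp
  qed
qed

definition action :: "(real \<Rightarrow> real) \<Rightarrow> (real \<Rightarrow> real ^ 'n) \<Rightarrow> ennreal" where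
  "action a Q = interaction UNIV Q + pot a Q"

lemma pot_le_action:
  assumes "Q \<in> borel_measurable borel" "0 < c" "\<And>x. c \<le> a x" "action a Q \<le> ennreal B" "0 \<le> B"
  shows "interaction UNIV Q \<le> ennreal B" "pot (\<lambda>_. 1) Q \<le> ennreal (B / c)"
proof -
  show "interaction UNIV Q \<le> ennreal B"
    using assms(4) unfolding action_def by (meson add_increasing2 order_trans zero_le order_refl)
  have "ennreal c * pot (\<lambda>_. 1) Q = pot (\<lambda>_. c) Q"
    using pot_cmult[of Q "\<lambda>_. 1" c] assms by simp
  also have "\<dots> \<le> pot a Q"
    by (rule pot_mono) (rule assms)
  also have "\<dots> \<le> ennreal B"
    using assms(4) unfolding action_def by (meson add_increasing order_trans zero_le order_refl)
  finally have "ennreal (1 / c) * (ennreal c * pot (\<lambda>_. 1) Q) \<le> ennreal (1 / c) * ennreal B"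
    by (rule mult_left_mono) simp
  then show "pot (\<lambda>_. 1) Q \<le> ennreal (B / c)"
    using assms(2,5) by (simp add: mult.assoc[symmetric] ennreal_mult[symmetric])
qed

text \<open>The direct method. Bounded action makes a minimizing sequence equicontinuous and of
  bounded oscillation; the bounded constraint at \<open>x0\<close> then prevents it from drifting
  off along the lattice. Pointwise limits preserve closed pointwise constraints, and Fatou's lemma
  makes both parts of the action lower semicontinuous, although the line is not compact.\<close>

lemma minimizer_exists:
  fixes a :: "real \<Rightarrow> real" and S :: "real \<Rightarrow> (real ^ 'n) set" and Q0 :: "real \<Rightarrow> real ^ 'n"
  assumes a[measurable]: "a \<in> borel_measurable borel" and c: "0 < c" "\<And>x. c \<le> a x"
    and S: "\<And>x. closed (S x)" "bounded (S x0)"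
    and Q0: "continuous_on UNIV Q0" "\<And>x. Q0 x \<in> S x" "action a Q0 < \<infinity>"
  obtains Q where "continuous_on UNIV Q" "\<And>x. Q x \<in> S x"
    "\<And>P. continuous_on UNIV P \<Longrightarrow> (\<And>x. P x \<in> S x) \<Longrightarrow> action a Q \<le> action a P"
proof -
  define \<Gamma> where "\<Gamma> = {P. continuous_on UNIV P \<and> (\<forall>x. P x \<in> S x)}"
  define m where "m = Inf (action a ` \<Gamma>)"
  have "Q0 \<in> \<Gamma>"
    using Q0 by (auto simp: \<Gamma>_def)
  then have m_le: "m \<le> action a P" if "P \<in> \<Gamma>" for P
    using that by (auto simp: m_def intro: INF_lower)
  have m_fin: "m < \<infinity>"
    using m_le[OF \<open>Q0 \<in> \<Gamma>\<close>] Q0(3) by (rule le_less_trans)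
  obtain U where U: "\<And>n. U n \<in> action a ` \<Gamma>" "U \<longlonglongrightarrow> m"
    using Inf_as_limit[of "action a ` \<Gamma>"] \<open>Q0 \<in> \<Gamma>\<close> unfolding m_def by blast
  define B where "B = enn2real m + 1"
  have B: "0 \<le> B" "m < ennreal B"
  proof -
    show "0 \<le> B" by (simp add: B_def)
    have "m = ennreal (enn2real m)" using m_fin by simp
    also have "\<dots> < ennreal B"
      by (intro ennreal_lessI) (auto simp: B_def intro: add_nonneg_pos)
    finally show "m < ennreal B" .
  qed
  have "eventually (\<lambda>n. U n < ennreal B) sequentially"
    using order_tendstoD(2)[OF U(2) B(2)] .
  then obtain n0 where n0: "\<And>n. n \<ge> n0 \<Longrightarrow> U n < ennreal B"
    by (auto simp: eventually_sequentially)
  define V where "V n = U (n + n0)" for n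
  have V: "V n \<in> action a ` \<Gamma>" "V n \<le> ennreal B" for n
    using U(1) n0[of "n + n0"] by (auto simp: V_def)
  have "V \<longlonglongrightarrow> m"
    unfolding V_def using U(2) by (rule LIMSEQ_ignore_initial_segment)
  have "\<exists>p. \<forall>n. p n \<in> \<Gamma> \<and> V n = action a (p n)"
    using V(1) by (intro choice) auto
  then obtain p where p: "\<And>n. p n \<in> \<Gamma>" "\<And>n. V n = action a (p n)"
    by blast
  have pc: "continuous_on UNIV (p n)" "p n x \<in> S x" for n x
    using p(1)[of n] by (auto simp: \<Gamma>_def)
  have [measurable]: "p n \<in> borel_measurable borel" for n
    using pc(1) by (rule borel_measurable_continuous_onI)
  \<comment> \<open>A single bound for the interaction and for the potential with weight
    \<open>1\<close>; the latter costs a factor \<open>1 / c\<close> because \<open>a\<close> is at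
    least \<open>c\<close>.\<close>
  define B' where "B' = max B (B / c)"
  have B': "0 \<le> B'" "B \<le> B'" "B / c \<le> B'"
    using B by (auto simp: B'_def)
  have en: "interaction UNIV (p n) \<le> ennreal B'" "pot (\<lambda>_. 1) (p n) \<le> ennreal B'" for n
    using pot_le_action[of "p n" c a B] c B(1) V(2)[of n] p(2)[of n] B'
    by (auto intro: order_trans ennreal_leI)
  obtain R where R: "\<And>Q x y. continuous_on UNIV Q \<Longrightarrow> interaction UNIV Q \<le> ennreal B' \<Longrightarrow>
       pot (\<lambda>_. 1) Q \<le> ennreal B' \<Longrightarrow> norm (Q x - Q y) \<le> R"
    using oscillation_bound[OF B'(1)] by metis
  obtain b where b: "\<And>v. v \<in> S x0 \<Longrightarrow> norm v \<le> b"
    using S(2) by (auto simp: bounded_iff)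
  have pb: "norm (p n x) \<le> b + R" for n x
    using norm_triangle_ineq[of "p n x0" "p n x - p n x0"] b[OF pc(2)[of n x0]]
      R[OF pc(1) en, of n x x0] by simp
  \<comment> \<open>A diagonal subsequence converges on the rationals; equicontinuity will extend
    the convergence to all points.\<close>
  obtain \<sigma> where \<sigma>: "strict_mono \<sigma>" "\<And>x. x \<in> \<rat> \<Longrightarrow> \<exists>l. (\<lambda>n. p (\<sigma> n) x) \<longlonglongrightarrow> l"
    using function_convergent_subsequence[of "\<rat> :: real set" p "b + R"] pb countable_rat by blast
  have conv: "\<exists>l. (\<lambda>n. p (\<sigma> n) x) \<longlonglongrightarrow> l" for x
  proof -
    have "Cauchy (\<lambda>n. p (\<sigma> n) x)"
    proof (rule metric_CauchyI)
      fix e :: real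
      assume "0 < e"
      then obtain l where l: "0 < l"
        "\<And>(Q :: real \<Rightarrow> real ^ 'n) x y. continuous_on UNIV Q \<Longrightarrow> interaction UNIV Q \<le> ennreal B' \<Longrightarrow>
         \<bar>x - y\<bar> \<le> l \<Longrightarrow> norm (Q x - Q y) \<le> e / 4"
        using modulus_of_continuity[of "e / 4" B'] B'(1) by auto
      obtain y where y: "y \<in> \<rat>" "x < y" "y < x + l"
        using Rats_dense_in_real[of x "x + l"] l(1) by auto
      have "Cauchy (\<lambda>n. p (\<sigma> n) y)"
        using \<sigma>(2)[OF y(1)] by (auto intro: LIMSEQ_imp_Cauchy)
      then obtain M where M: "\<And>m n. m \<ge> M \<Longrightarrow> n \<ge> M \<Longrightarrow> dist (p (\<sigma> m) y) (p (\<sigma> n) y) < e / 4"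
        using \<open>0 < e\<close> by (meson metric_CauchyD zero_less_divide_iff zero_less_numeral)
      have "dist (p (\<sigma> m) x) (p (\<sigma> n) x) < e" if "m \<ge> M" "n \<ge> M" for m n
      proof -
        have "dist (p (\<sigma> j) x) (p (\<sigma> j) y) \<le> e / 4" for j
          unfolding dist_norm using y by (intro l(2) pc en) auto
        from this[of m] this[of n] M[OF that]
        have "dist (p (\<sigma> m) x) (p (\<sigma> m) y) + dist (p (\<sigma> m) y) (p (\<sigma> n) y) + dist (p (\<sigma> n) y) (p (\<sigma> n) x) < e"
          using \<open>0 < e\<close> dist_commute[of "p (\<sigma> n) y" "p (\<sigma> n) x"] by linarith
        then show ?thesis
          using dist_triangle[of "p (\<sigma> m) x" "p (\<sigma> n) x" "p (\<sigma> m) y"]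
            dist_triangle[of "p (\<sigma> m) y" "p (\<sigma> n) x" "p (\<sigma> n) y"] by linarith
      qed
      then show "\<exists>M. \<forall>m\<ge>M. \<forall>n\<ge>M. dist (p (\<sigma> m) x) (p (\<sigma> n) x) < e"
        by blast
    qed
    then show ?thesis
      by (simp add: Cauchy_convergent convergentD)
  qed
  then obtain Q where Q: "\<And>x. (\<lambda>n. p (\<sigma> n) x) \<longlonglongrightarrow> Q x"
    by metis
  have Qc: "continuous_on UNIV Q"
    unfolding continuous_on_iff
  proof (intro ballI allI impI)
    fix x e :: real
    assume "0 < e"
    then obtain l where l: "0 < l"
      "\<And>(Q :: real \<Rightarrow> real ^ 'n) x y. continuous_on UNIV Q \<Longrightarrow> interaction UNIV Q \<le> ennreal B' \<Longrightarrow>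
       \<bar>x - y\<bar> \<le> l \<Longrightarrow> norm (Q x - Q y) \<le> e / 2"
      using modulus_of_continuity[of "e / 2" B'] B'(1) by auto
    have "dist (Q y) (Q x) < e" if "dist y x < l" for y
    proof -
      have "(\<lambda>n. norm (p (\<sigma> n) y - p (\<sigma> n) x)) \<longlonglongrightarrow> norm (Q y - Q x)"
        by (intro tendsto_intros Q)
      moreover have "norm (p (\<sigma> n) y - p (\<sigma> n) x) \<le> e / 2" for n
        using that by (intro l(2) pc en) (auto simp: dist_real_def)
      ultimately have "norm (Q y - Q x) \<le> e / 2"
        by (intro LIMSEQ_le_const2) auto
      then show ?thesis
        using \<open>0 < e\<close> by (simp add: dist_norm)
    qed
    then show "\<exists>d>0. \<forall>y\<in>UNIV. dist y x < d \<longrightarrow> dist (Q y) (Q x) < e"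
      using l(1) by blast
  qed
  have [measurable]: "Q \<in> borel_measurable borel"
    using Qc by (rule borel_measurable_continuous_onI)
  have QS: "Q x \<in> S x" for x
    using closed_sequentially[OF S(1) _ Q] pc(2) by blast
  have I: "interaction UNIV Q \<le> liminf (\<lambda>n. interaction UNIV (p (\<sigma> n)))"
  proof -
    have "interaction UNIV Q = (\<integral>\<^sup>+z. liminf (\<lambda>n. ennreal (k (fst z - snd z) *
        (norm (p (\<sigma> n) (fst z) - p (\<sigma> n) (snd z)))\<^sup>2)) \<partial>lborel)"
      unfolding interaction_def
    proof (rule nn_integral_cong)
      fix z :: "real \<times> real"
      have "(\<lambda>n. ennreal (density (p (\<sigma> n)) z))
        \<longlonglongrightarrow> ennreal (density Q z)"
        by (intro tendsto_intros Q)
      from lim_imp_Liminf[OF _ this]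
      show "ennreal (density Q z) * indicator (UNIV \<times> UNIV) z
        = liminf (\<lambda>n. ennreal (density (p (\<sigma> n)) z))"
        by simp
    qed
    also have "\<dots> \<le> liminf (\<lambda>n. \<integral>\<^sup>+z. ennreal (k (fst z - snd z) *
        (norm (p (\<sigma> n) (fst z) - p (\<sigma> n) (snd z)))\<^sup>2) \<partial>lborel)"
    proof (rule nn_integral_liminf)
      show "(\<lambda>z. ennreal (density (p (\<sigma> n)) z))
          \<in> borel_measurable lborel" for n
        using interaction_measurable(1)[of "p (\<sigma> n)"] by simp
    qed
    also have "\<dots> = liminf (\<lambda>n. interaction UNIV (p (\<sigma> n)))"
      by (simp add: interaction_def)
    finally show ?thesis .
  qed
  have V': "pot a Q \<le> liminf (\<lambda>n. pot a (p (\<sigma> n)))"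
  proof -
    have "pot a Q = (\<integral>\<^sup>+x. liminf (\<lambda>n. ennreal (a x * W (p (\<sigma> n) x))) \<partial>lborel)"
      unfolding pot_def
    proof (rule nn_integral_cong)
      fix x :: real
      have "(\<lambda>n. ennreal (a x * W (p (\<sigma> n) x))) \<longlonglongrightarrow> ennreal (a x * W (Q x))"
        using W_continuous[of UNIV] by (intro tendsto_intros continuous_on_tendsto_compose[OF _ Q]) auto
      from lim_imp_Liminf[OF _ this]
      show "ennreal (a x * W (Q x)) = liminf (\<lambda>n. ennreal (a x * W (p (\<sigma> n) x)))"
        by simp
    qed
    also have "\<dots> \<le> liminf (\<lambda>n. pot a (p (\<sigma> n)))"
      unfolding pot_def by (rule nn_integral_liminf) measurable
    finally show ?thesis .
  qed
  have "action a Q \<le> liminf (\<lambda>n. interaction UNIV (p (\<sigma> n)) + pot a (p (\<sigma> n)))"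
    unfolding action_def using add_mono[OF I V'] liminf_add_le_ennreal by (rule order_trans)
  also have "\<dots> = liminf (V \<circ> \<sigma>)"
    by (simp add: p(2) action_def comp_def)
  also have "\<dots> = m"
    using LIMSEQ_subseq_LIMSEQ[OF \<open>V \<longlonglongrightarrow> m\<close> \<sigma>(1)] by (intro lim_imp_Liminf) auto
  finally have "action a Q \<le> m" .
  then show ?thesis
    using Qc QS m_le by (intro that[of Q]) (auto simp: \<Gamma>_def intro: order_trans)
qed

end

section \<open>The Euler-Lagrange equation\<close>

lemma norm_add_scaleR_square:
  fixes u v :: "'a::real_inner"
  shows "(norm (u + t *\<^sub>R v))\<^sup>2 = (norm u)\<^sup>2 + 2 * t * (u \<bullet> v) + t\<^sup>2 * (norm v)\<^sup>2"
  by (simp only: power2_norm_eq_inner)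
    (simp add: inner_add_left inner_add_right inner_commute power2_eq_square algebra_simps)

lemma first_order_vanishes:
  fixes X Y t0 :: real
  assumes "0 < t0" "\<And>t. \<bar>t\<bar> \<le> t0 \<Longrightarrow> 0 \<le> t * X + t\<^sup>2 * Y"
  shows "X = 0"
proof (rule ccontr)
  assume X: "X \<noteq> 0"
  \<comment> \<open>Small enough that the quadratic term is at most half of the linear one; the sign
    of \<open>t\<close> will be opposite to that of \<open>X\<close>.\<close>
  define u where "u = min t0 (\<bar>X\<bar> / (2 * (\<bar>Y\<bar> + 1)))"
  have u: "0 < u" "u \<le> t0"
    using assms(1) X by (auto simp: u_def)
  have "u \<le> \<bar>X\<bar> / (2 * (\<bar>Y\<bar> + 1))"
    by (simp add: u_def)
  then have u3: "u * (2 * (\<bar>Y\<bar> + 1)) \<le> \<bar>X\<bar>"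
    by (subst (asm) pos_le_divide_eq) auto
  have "0 \<le> (- sgn X * u) * X + (- sgn X * u)\<^sup>2 * Y"
    using u by (intro assms(2)) (auto simp: abs_mult sgn_if)
  also have "\<dots> = u * (u * Y - \<bar>X\<bar>)"
    using X by (auto simp: sgn_if power2_eq_square algebra_simps)
  finally have "\<bar>X\<bar> \<le> u * Y"
    using u(1) by (simp add: zero_le_mult_iff)
  also have "\<dots> \<le> u * \<bar>Y\<bar>"
    using u(1) by (intro mult_left_mono) auto
  finally show False
    using u u3 X by (simp add: algebra_simps)
qed

lemma integrable_compact_support:
  fixes f :: "real \<Rightarrow> 'a::euclidean_space"
  assumes "continuous_on UNIV f" "\<And>x. R < \<bar>x\<bar> \<Longrightarrow> f x = 0"
  shows "integrable lborel f"
proof -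
  have "integrable lborel (\<lambda>x. indicator {-R..R} x *\<^sub>R f x)"
    by (rule borel_integrable_compact) (use assms(1) continuous_on_subset in auto)
  moreover have "indicator {-R..R} x *\<^sub>R f x = f x" for x
    using assms(2)[of x] by (cases "R < \<bar>x\<bar>") (auto simp: indicator_def)
  ultimately show ?thesis by simp
qed

section \<open>First variation of the interaction energy\<close>

context kernel
begin

lemma interaction_integrable:
  fixes Q :: "real \<Rightarrow> 'a::euclidean_space"
  assumes "Q \<in> borel_measurable borel" "interaction UNIV Q < \<infinity>"
  shows "integrable lborel (\<lambda>p. density Q p)"
    and "interaction UNIV Q = ennreal (\<integral>p. density Q p \<partial>lborel)"
proof -
  note m = borel_measurable_fst_snd[OF assms(1)] borel_measurable_fst_snd(3)[OF k_measurable]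
  have [measurable]: "(\<lambda>p. density Q p) \<in> borel_measurable borel"
    using m by measurable
  show *: "integrable lborel (\<lambda>p. density Q p)"
    using assms(2) by (intro integrableI_nonneg) (auto simp: interaction_def k_nonneg)
  show "interaction UNIV Q = ennreal (\<integral>p. density Q p \<partial>lborel)"
    using nn_integral_eq_integral[OF *] k_nonneg by (simp add: interaction_def)
qed

lemma interaction_cross_integrable:
  fixes Q \<psi> :: "real \<Rightarrow> 'a::euclidean_space"
  assumes "Q \<in> borel_measurable borel" "interaction UNIV Q < \<infinity>"
    and "\<psi> \<in> borel_measurable borel" "interaction UNIV \<psi> < \<infinity>"
  shows "integrable lborel (\<lambda>p. cross_density Q \<psi> p)"
proof (rule Bochner_Integration.integrable_bound)
  note m = borel_measurable_fst_snd[OF assms(1)] borel_measurable_fst_snd[OF assms(3)]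
    borel_measurable_fst_snd(3)[OF k_measurable]
  show "integrable lborel (\<lambda>p. density Q p
      + density \<psi> p)"
    by (intro Bochner_Integration.integrable_add interaction_integrable assms)
  show "(\<lambda>p. cross_density Q \<psi> p) \<in> borel_measurable lborel"
    using m by measurable
  show "AE p in lborel. norm (cross_density Q \<psi> p)
     \<le> norm (density Q p
      + density \<psi> p)"
  proof (rule AE_I2)
    fix p :: "real \<times> real"
    let ?u = "Q (fst p) - Q (snd p)" and ?v = "\<psi> (fst p) - \<psi> (snd p)" and ?k = "k (fst p - snd p)"
    have "\<bar>?u \<bullet> ?v\<bar> \<le> norm ?u * norm ?v"
      by (rule Cauchy_Schwarz_ineq2)
    also have "\<dots> \<le> (norm ?u)\<^sup>2 + (norm ?v)\<^sup>2"
      using zero_le_power2[of "norm ?u - norm ?v"] mult_nonneg_nonneg[OF norm_ge_zero norm_ge_zero, of ?u ?v]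
      unfolding power2_diff mult.assoc by linarith
    finally have "?k * \<bar>?u \<bullet> ?v\<bar> \<le> ?k * ((norm ?u)\<^sup>2 + (norm ?v)\<^sup>2)"
      by (rule mult_left_mono) (rule k_nonneg)
    then show "norm (?k * (?u \<bullet> ?v)) \<le> norm (?k * (norm ?u)\<^sup>2 + ?k * (norm ?v)\<^sup>2)"
      using k_nonneg[of "fst p - snd p"] by (simp add: abs_mult distrib_left)
  qed
qed

text \<open>Expanding the square gives an exact quadratic polynomial in \<open>t\<close>. Its
  nonnegativity is recorded because \<open>ennreal\<close> sends negative reals to \<open>0\<close>;
  with it the identity can be carried over to inequalities between reals.\<close>

lemma interaction_variation:
  fixes Q \<psi> :: "real \<Rightarrow> 'a::euclidean_space"
  assumes "Q \<in> borel_measurable borel" "interaction UNIV Q < \<infinity>"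
    and "\<psi> \<in> borel_measurable borel" "interaction UNIV \<psi> < \<infinity>"
  shows "interaction UNIV (\<lambda>x. Q x + t *\<^sub>R \<psi> x) = ennreal (
     (\<integral>p. density Q p \<partial>lborel)
     + 2 * t * (\<integral>p. cross_density Q \<psi> p \<partial>lborel)
     + t\<^sup>2 * (\<integral>p. density \<psi> p \<partial>lborel))"
    and "0 \<le> (\<integral>p. density Q p \<partial>lborel)
     + 2 * t * (\<integral>p. cross_density Q \<psi> p \<partial>lborel)
     + t\<^sup>2 * (\<integral>p. density \<psi> p \<partial>lborel)"
proof -
  define F where "F p = density Q p" for p
  define G where "G p = cross_density Q \<psi> p" for p
  define H where "H p = density \<psi> p" for p
  have int: "integrable lborel F" "integrable lborel G" "integrable lborel H"
    unfolding F_def G_def H_def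
    by (rule interaction_integrable[OF assms(1,2)] interaction_integrable[OF assms(3,4)]
        interaction_cross_integrable[OF assms])+
  have expand: "k (fst p - snd p) * (norm ((Q (fst p) + t *\<^sub>R \<psi> (fst p)) - (Q (snd p) + t *\<^sub>R \<psi> (snd p))))\<^sup>2
     = F p + 2 * t * G p + t\<^sup>2 * H p" for p
  proof -
    have "(Q (fst p) + t *\<^sub>R \<psi> (fst p)) - (Q (snd p) + t *\<^sub>R \<psi> (snd p))
      = (Q (fst p) - Q (snd p)) + t *\<^sub>R (\<psi> (fst p) - \<psi> (snd p))"
      by (simp add: algebra_simps)
    then show ?thesis
      by (simp only: F_def G_def H_def norm_add_scaleR_square distrib_left mult_ac)
  qed
  have int3: "integrable lborel (\<lambda>p. F p + 2 * t * G p + t\<^sup>2 * H p)"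
    by (intro Bochner_Integration.integrable_add integrable_mult_right int)
  have nonneg: "0 \<le> F p + 2 * t * G p + t\<^sup>2 * H p" for p
    unfolding expand[symmetric] by (intro mult_nonneg_nonneg k_nonneg) auto
  have eq: "(\<integral>p. F p + 2 * t * G p + t\<^sup>2 * H p \<partial>lborel)
     = (\<integral>p. F p \<partial>lborel) + 2 * t * (\<integral>p. G p \<partial>lborel) + t\<^sup>2 * (\<integral>p. H p \<partial>lborel)"
    using int by (simp add: Bochner_Integration.integral_add)
  have "interaction UNIV (\<lambda>x. Q x + t *\<^sub>R \<psi> x) = (\<integral>\<^sup>+p. ennreal (F p + 2 * t * G p + t\<^sup>2 * H p) \<partial>lborel)"
    unfolding interaction_def expand by simp
  also have "\<dots> = ennreal (\<integral>p. F p + 2 * t * G p + t\<^sup>2 * H p \<partial>lborel)"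
    by (rule nn_integral_eq_integral[OF int3 AE_I2[OF nonneg]])
  finally show "interaction UNIV (\<lambda>x. Q x + t *\<^sub>R \<psi> x) = ennreal (
     (\<integral>p. density Q p \<partial>lborel)
     + 2 * t * (\<integral>p. cross_density Q \<psi> p \<partial>lborel)
     + t\<^sup>2 * (\<integral>p. density \<psi> p \<partial>lborel))"
    unfolding eq unfolding F_def G_def H_def .
  have "0 \<le> (\<integral>p. F p + 2 * t * G p + t\<^sup>2 * H p \<partial>lborel)"
    by (rule Bochner_Integration.integral_nonneg) (rule nonneg)
  then show "0 \<le> (\<integral>p. density Q p \<partial>lborel)
     + 2 * t * (\<integral>p. cross_density Q \<psi> p \<partial>lborel)
     + t\<^sup>2 * (\<integral>p. density \<psi> p \<partial>lborel)"
    unfolding eq unfolding F_def G_def H_def .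
qed

end

context transition_problem
begin

text \<open>The interaction of \<open>Q + t \<psi>\<close> is a quadratic polynomial in
  \<open>t\<close> and its potential is bounded by another one, so minimality makes a polynomial
  without constant term nonnegative for small \<open>t\<close> of both signs. Its linear
  coefficient, the left-hand side of the equation, must vanish.\<close>

lemma euler_lagrange:
  fixes Q \<psi> :: "real \<Rightarrow> real ^ 'n" and a :: "real \<Rightarrow> real"
  assumes a: "continuous_on UNIV a" "\<And>x. 0 \<le> a x"
    and Q: "continuous_on UNIV Q" "action a Q < \<infinity>"
    and \<psi>: "continuous_on UNIV \<psi>" "\<And>x. R < \<bar>x\<bar> \<Longrightarrow> \<psi> x = 0" "interaction UNIV \<psi> < \<infinity>"
    and min: "0 < t0" "\<And>t. \<bar>t\<bar> \<le> t0 \<Longrightarrow> action a Q \<le> action a (\<lambda>x. Q x + t *\<^sub>R \<psi> x)"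
  shows "integrable lborel (\<lambda>x. (a x *\<^sub>R g (Q x)) \<bullet> \<psi> x)"
    and "2 * (\<integral>p. cross_density Q \<psi> p \<partial>lborel)
      + (\<integral>x. (a x *\<^sub>R g (Q x)) \<bullet> \<psi> x \<partial>lborel) = 0"
proof -
  have Qm[measurable]: "Q \<in> borel_measurable borel" and \<psi>m[measurable]: "\<psi> \<in> borel_measurable borel"
    and am[measurable]: "a \<in> borel_measurable borel"
    using Q(1) \<psi>(1) a(1) by (auto intro: borel_measurable_continuous_onI)
  have gQ: "continuous_on UNIV (\<lambda>x. g (Q x))"
    by (rule continuous_on_compose2[OF g_continuous Q(1)]) auto
  show int1: "integrable lborel (\<lambda>x. (a x *\<^sub>R g (Q x)) \<bullet> \<psi> x)"
    using \<psi>(2) by (intro integrable_compact_support[of _ R] continuous_intros gQ a \<psi>(1)) auto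
  have int2: "integrable lborel (\<lambda>x. a x * (Lg * (norm (\<psi> x))\<^sup>2))"
    using \<psi>(2) by (intro integrable_compact_support[of _ R] continuous_intros a \<psi>(1)) auto
  have fin: "interaction UNIV Q < \<infinity>" "pot a Q < \<infinity>"
    using Q(2) by (auto simp: action_def)
  have int0: "integrable lborel (\<lambda>x. a x * W (Q x))"
    using fin(2) a(2) W_nonneg by (intro integrableI_nonneg) (auto simp: pot_def)
  define D where "D = (\<integral>p. cross_density Q \<psi> p \<partial>lborel)"
  define A where "A = (\<integral>p. density Q p \<partial>lborel)"
  define B where "B = (\<integral>p. density \<psi> p \<partial>lborel)"
  define P where "P = (\<integral>x. a x * W (Q x) \<partial>lborel)"
  define G where "G = (\<integral>x. (a x *\<^sub>R g (Q x)) \<bullet> \<psi> x \<partial>lborel)"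
  define N where "N = (\<integral>x. a x * (Lg * (norm (\<psi> x))\<^sup>2) \<partial>lborel)"
  have A0: "A \<ge> 0" unfolding A_def by (rule Bochner_Integration.integral_nonneg) (simp add: k_nonneg)
  have P0: "P \<ge> 0" unfolding P_def by (rule Bochner_Integration.integral_nonneg) (simp add: a W_nonneg)
  have "0 \<le> t * (2 * D + G) + t\<^sup>2 * (B + N)" if t: "\<bar>t\<bar> \<le> t0" for t
  proof -
    note var = interaction_variation[OF Qm fin(1) \<psi>m \<psi>(3), of t, folded A_def B_def D_def]
    note I = var(1) and I0 = var(2)
    have pt: "a x * W (Q x + t *\<^sub>R \<psi> x) \<le> a x * W (Q x) + t * ((a x *\<^sub>R g (Q x)) \<bullet> \<psi> x)
        + t\<^sup>2 * (a x * (Lg * (norm (\<psi> x))\<^sup>2))" for x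
      using mult_left_mono[OF W_taylor[of "Q x" "t *\<^sub>R \<psi> x"] a(2)[of x]]
      by (simp add: algebra_simps power_mult_distrib inner_commute)
    have int3: "integrable lborel (\<lambda>x. a x * W (Q x) + t * ((a x *\<^sub>R g (Q x)) \<bullet> \<psi> x)
        + t\<^sup>2 * (a x * (Lg * (norm (\<psi> x))\<^sup>2)))"
      by (intro Bochner_Integration.integrable_add integrable_mult_right int0 int1 int2)
    have nonneg: "0 \<le> a x * W (Q x) + t * ((a x *\<^sub>R g (Q x)) \<bullet> \<psi> x)
        + t\<^sup>2 * (a x * (Lg * (norm (\<psi> x))\<^sup>2))" for x
      by (rule order_trans[OF _ pt]) (intro mult_nonneg_nonneg a W_nonneg)
    have J: "(\<integral>x. a x * W (Q x) + t * ((a x *\<^sub>R g (Q x)) \<bullet> \<psi> x)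
        + t\<^sup>2 * (a x * (Lg * (norm (\<psi> x))\<^sup>2)) \<partial>lborel) = P + t * G + t\<^sup>2 * N"
      unfolding P_def G_def N_def
      by (subst Bochner_Integration.integral_add)
        (auto intro!: Bochner_Integration.integrable_add integrable_mult_right int0 int1 int2
          simp: Bochner_Integration.integral_add[OF int0 integrable_mult_right[OF int1]]
          simp del: inner_scaleR_left)
    have J0: "0 \<le> P + t * G + t\<^sup>2 * N"
      unfolding J[symmetric] by (rule Bochner_Integration.integral_nonneg) (rule nonneg)
    have "pot a (\<lambda>x. Q x + t *\<^sub>R \<psi> x) \<le> (\<integral>\<^sup>+x. ennreal (a x * W (Q x) + t * ((a x *\<^sub>R g (Q x)) \<bullet> \<psi> x)
        + t\<^sup>2 * (a x * (Lg * (norm (\<psi> x))\<^sup>2))) \<partial>lborel)"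
      unfolding pot_def by (intro nn_integral_mono ennreal_leI pt)
    also have "\<dots> = ennreal (P + t * G + t\<^sup>2 * N)"
      unfolding J[symmetric] using nonneg by (intro nn_integral_eq_integral int3 AE_I2)
    finally have V: "pot a (\<lambda>x. Q x + t *\<^sub>R \<psi> x) \<le> ennreal (P + t * G + t\<^sup>2 * N)" .
    have "ennreal (A + P) = action a Q"
      unfolding action_def using A0 P0 interaction_integrable(2)[OF Qm fin(1)]
        nn_integral_eq_integral[OF int0] a(2) W_nonneg
      by (simp add: A_def P_def pot_def ennreal_plus)
    also have "\<dots> \<le> action a (\<lambda>x. Q x + t *\<^sub>R \<psi> x)"
      by (rule min(2)[OF t])
    also have "\<dots> \<le> ennreal (A + 2 * t * D + t\<^sup>2 * B) + ennreal (P + t * G + t\<^sup>2 * N)"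
      unfolding action_def I by (rule add_left_mono) (rule V)
    also have "\<dots> = ennreal ((A + 2 * t * D + t\<^sup>2 * B) + (P + t * G + t\<^sup>2 * N))"
      using I0 J0 by (simp add: ennreal_plus)
    finally have "A + P \<le> (A + 2 * t * D + t\<^sup>2 * B) + (P + t * G + t\<^sup>2 * N)"
      using I0 J0 by (subst (asm) ennreal_le_iff) auto
    then show ?thesis
      by (simp add: algebra_simps)
  qed
  from first_order_vanishes[OF min(1) this] show "2 * D + G = 0" .
qed

end

text \<open>These are the properties that make the interaction of a test function finite. The bounds
  come from continuity of \<open>\<psi>\<close> and of its derivative on a compact interval outside
  which both vanish.\<close>

lemma test_function_regular:
  fixes \<psi> :: "real \<Rightarrow> real ^ 'n"
  assumes "\<psi> \<in> test_functions UNIV"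
  obtains R \<Lambda> M where "0 \<le> R" "continuous_on UNIV \<psi>" "\<And>x. R < \<bar>x\<bar> \<Longrightarrow> \<psi> x = 0"
    "\<And>x. norm (\<psi> x) \<le> M" "\<And>x y. norm (\<psi> x - \<psi> y) \<le> \<Lambda> * \<bar>x - y\<bar>"
proof -
  define \<psi>' where "\<psi>' = (\<lambda>t. vector_derivative \<psi> (at t))"
  have diff: "((\<lambda>f t. vector_derivative f (at t)) ^^ n) \<psi> differentiable (at x)" for n x
    using assms unfolding test_functions_def by blast
  have "\<psi> differentiable (at x)" "\<psi>' differentiable (at x)" for x
    using diff[of 0 x] diff[of 1 x] by (simp_all add: \<psi>'_def)
  then have \<psi>c: "continuous_on S \<psi>" and \<psi>'c: "continuous_on S \<psi>'" for S
    by (meson differentiable_at_withinI differentiable_imp_continuous_on differentiable_on_def)+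
  have deriv: "(\<psi> has_vector_derivative \<psi>' x) (at x)" for x
    using \<open>\<And>x. \<psi> differentiable (at x)\<close> by (simp add: \<psi>'_def vector_derivative_works)
  have "bounded (closure {x. \<psi> x \<noteq> 0})"
    using assms by (auto simp: test_functions_def compact_imp_bounded)
  then obtain R0 where R0: "\<And>x. x \<in> closure {x. \<psi> x \<noteq> 0} \<Longrightarrow> norm x \<le> R0"
    by (auto simp: bounded_iff)
  define R where "R = max 0 R0"
  have supp: "\<psi> x = 0" if "R < \<bar>x\<bar>" for x
    using R0[of x] that closure_subset[of "{x. \<psi> x \<noteq> 0}"] by (force simp: R_def)
  have supp': "\<psi>' x = 0" if "R < \<bar>x\<bar>" for x
  proof -
    have "((\<lambda>_. 0) has_vector_derivative 0) (at x)" by simp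
    then have "(\<psi> has_vector_derivative 0) (at x)"
    proof (rule has_vector_derivative_transform_within_open)
      show "open {x. R < \<bar>x\<bar>}"
        by (intro open_Collect_less continuous_intros)
    qed (use that supp in auto)
    with deriv show ?thesis
      by (rule vector_derivative_unique_at)
  qed
  have "bounded (\<psi> ` {-R..R})" "bounded (\<psi>' ` {-R..R})"
    by (intro compact_imp_bounded compact_continuous_image \<psi>c \<psi>'c compact_Icc)+
  then obtain M \<Lambda> where M: "\<And>x. x \<in> {-R..R} \<Longrightarrow> norm (\<psi> x) \<le> M" and \<Lambda>: "\<And>x. x \<in> {-R..R} \<Longrightarrow> norm (\<psi>' x) \<le> \<Lambda>"
    unfolding bounded_iff by (metis imageI)
  have R_nonneg: "0 \<le> R" by (simp add: R_def)
  have M0: "0 \<le> M" "0 \<le> \<Lambda>"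
    using order_trans[OF norm_ge_zero M[of 0]] order_trans[OF norm_ge_zero \<Lambda>[of 0]] R_nonneg by auto
  have M': "norm (\<psi> x) \<le> M" and \<Lambda>': "norm (\<psi>' x) \<le> \<Lambda>" for x
    using M[of x] \<Lambda>[of x] supp[of x] supp'[of x] M0 by (cases "R < \<bar>x\<bar>"; force simp: abs_le_iff)+
  have "norm (\<psi> x - \<psi> y) \<le> \<Lambda> * \<bar>x - y\<bar>" for x y
  proof -
    have "norm (\<psi> x - \<psi> y) \<le> \<Lambda> * norm (x - y)"
    proof (rule differentiable_bound[of UNIV \<psi> "\<lambda>x h. h *\<^sub>R \<psi>' x"])
      fix z :: real
      show "(\<psi> has_derivative (\<lambda>h. h *\<^sub>R \<psi>' z)) (at z within UNIV)"
        using deriv[of z] by (simp add: has_vector_derivative_def)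
      show "onorm (\<lambda>h. h *\<^sub>R \<psi>' z) \<le> \<Lambda>"
        using mult_left_mono[OF \<Lambda>'[of z] abs_ge_zero] by (intro onorm_le) (simp add: mult.commute)
    qed auto
    then show ?thesis by simp
  qed
  then show ?thesis
    using that[OF R_nonneg \<psi>c supp M'] by blast
qed

section \<open>The cost of a single transition\<close>

text \<open>Young's inequality with a free parameter: a small \<open>\<alpha>\<close> keeps the
  coefficient of the main term close to \<open>1\<close>, and the large factor
  \<open>1 + 1 / \<alpha>\<close> falls on an error term that can be made small afterwards.\<close>

lemma norm_add_square_le:
  fixes u v :: "'a::real_inner"
  assumes "0 < \<alpha>"
  shows "(norm (u + v))\<^sup>2 \<le> (1 + \<alpha>) * (norm u)\<^sup>2 + (1 + 1 / \<alpha>) * (norm v)\<^sup>2"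
proof -
  have "(norm (u + v))\<^sup>2 \<le> (norm u + norm v)\<^sup>2"
    by (intro power_mono norm_triangle_ineq) auto
  also have "\<dots> = (norm u)\<^sup>2 + (norm v)\<^sup>2 + 2 * norm u * norm v"
    by (simp add: power2_sum)
  also have "2 * norm u * norm v \<le> \<alpha> * (norm u)\<^sup>2 + (1 / \<alpha>) * (norm v)\<^sup>2"
  proof -
    have "0 \<le> (\<alpha> * norm u - norm v)\<^sup>2 / \<alpha>"
      using assms by simp
    also have "\<dots> = \<alpha> * (norm u)\<^sup>2 + (1 / \<alpha>) * (norm v)\<^sup>2 - 2 * norm u * norm v"
      using assms by (simp add: power2_diff power_mult_distrib field_simps power2_eq_square)
    finally show ?thesis by simp
  qed
  finally show ?thesis by (simp add: algebra_simps)
qed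

lemma ennreal_add_mult_add:
  assumes "0 \<le> a" "0 \<le> b" "0 \<le> c" "0 \<le> d"
  shows "ennreal (a + b * (c + d)) = ennreal a + ennreal b * (ennreal c + ennreal d)"
  using assms by (simp add: ennreal_mult[symmetric] ennreal_plus[symmetric] del: ennreal_plus)

definition ramp :: "real \<Rightarrow> real \<Rightarrow> real \<Rightarrow> real" where
  "ramp p L x = max 0 (min 1 ((x - p) / L))"

lemma ramp_bounds: "0 \<le> ramp p L x" "ramp p L x \<le> 1"
  by (auto simp: ramp_def)

lemma ramp_left: "0 < L \<Longrightarrow> x \<le> p \<Longrightarrow> ramp p L x = 0"
  by (auto simp: ramp_def max_def min_def divide_le_eq zero_le_divide_iff)

lemma ramp_right: "0 < L \<Longrightarrow> p + L \<le> x \<Longrightarrow> ramp p L x = 1"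
  by (auto simp: ramp_def max_def min_def divide_le_eq)

lemma ramp_continuous: "0 < L \<Longrightarrow> continuous_on S (ramp p L)"
  unfolding ramp_def by (intro continuous_intros) auto

lemma ramp_lipschitz:
  assumes "0 < L"
  shows "\<bar>ramp p L x - ramp p L y\<bar> \<le> 1 / L * \<bar>x - y\<bar>"
proof -
  have "\<bar>ramp p L x - ramp p L y\<bar> \<le> \<bar>(x - p) / L - (y - p) / L\<bar>"
    unfolding ramp_def by (auto simp: max_def min_def abs_if)
  also have "\<dots> = 1 / L * \<bar>x - y\<bar>"
    using assms by (simp add: diff_divide_distrib[symmetric] abs_divide)
  finally show ?thesis .
qed

context kernel
begin

lemma interaction_ramp:
  assumes "0 < L"
  shows "interaction UNIV (ramp p L) \<le> cutoff_cost L"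
proof -
  have "interaction UNIV (ramp p L) \<le> (\<integral>\<^sup>+z. ennreal (k z * (layer_weight 1 (1 / L) (p + L - p) z)) \<partial>lborel)"
  proof (rule interaction_layer)
    show "continuous_on UNIV (ramp p L)"
      by (rule ramp_continuous[OF assms])
    show "norm (ramp p L x - ramp p L y) \<le> 1" for x y
      using ramp_bounds[of p L x] ramp_bounds[of p L y] by auto
    show "norm (ramp p L x - ramp p L y) \<le> 1 / L * \<bar>x - y\<bar>" for x y
      using ramp_lipschitz[OF assms] by simp
  qed (use assms in \<open>auto simp: ramp_left ramp_right\<close>)
  then show ?thesis
    by (simp add: cutoff_cost_def)
qed

end

section \<open>Optimal cost of a transition and the lower bound on one cell\<close>

context transition_problem
begin

text \<open>Transitions that are exactly constant near both ends can be shifted and superposed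
  without error in the potential. All pairs of distinct lattice points are allowed, so that the
  infimum of the action bounds the cost of any passage from below.\<close>

definition layers :: "(real \<Rightarrow> real ^ 'n) set" where
  "layers = {Q. continuous_on UNIV Q \<and> (\<exists>\<zeta>\<in>int_lattice. \<exists>\<zeta>'\<in>int_lattice. \<exists>R.
     \<zeta> \<noteq> \<zeta>' \<and> (\<forall>x\<le>-R. Q x = \<zeta>) \<and> (\<forall>x\<ge>R. Q x = \<zeta>'))}"

definition layer_cost :: "real \<Rightarrow> ennreal" where
  "layer_cost c = (INF Q\<in>layers. action (\<lambda>_. c) Q)"

lemma layer_cost_finite:
  assumes "0 \<le> c"
  shows "layer_cost c < \<infinity>"
proof -
  obtain j :: 'n where True by simp
  define Q :: "real \<Rightarrow> real ^ 'n" where "Q x = ramp 0 1 x *\<^sub>R axis j 1" for x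
  have Qc: "continuous_on UNIV Q"
    unfolding Q_def by (intro continuous_intros ramp_continuous) simp
  have lat: "axis j 1 \<in> int_lattice" "(0 :: real ^ 'n) \<in> int_lattice"
    by (auto simp: int_lattice_def axis_def)
  have Q_ends: "x \<le> 0 \<Longrightarrow> Q x = 0" "1 \<le> x \<Longrightarrow> Q x = axis j 1" for x
    by (simp_all add: Q_def ramp_left ramp_right)
  have "Q \<in> layers"
    unfolding layers_def
  proof (intro CollectI conjI Qc bexI exI[of _ 1] allI impI)
    show "0 \<noteq> (axis j 1 :: real ^ 'n)"
      by (metis axis_eq_0_iff zero_neq_one)
  qed (use lat Q_ends in auto)
  have I: "interaction UNIV Q < \<infinity>"
  proof (rule interaction_layer_finite[OF Qc, of 1 1 0 1])
    fix x y
    have "norm (Q x - Q y) = \<bar>ramp 0 1 x - ramp 0 1 y\<bar>"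
      unfolding Q_def scaleR_diff_left[symmetric] by simp
    then show "norm (Q x - Q y) \<le> 1" "norm (Q x - Q y) \<le> 1 * \<bar>x - y\<bar>"
      using ramp_bounds[of 0 1 x] ramp_bounds[of 0 1 y] ramp_lipschitz[of 1 0 x y] by auto
  qed (auto simp: Q_ends)
  have "integrable lborel (\<lambda>x. c * W (Q x))"
  proof (rule integrable_compact_support[of _ 1])
    show "continuous_on UNIV (\<lambda>x. c * W (Q x))"
      by (intro continuous_intros continuous_on_compose2[OF W_continuous[of UNIV] Qc]) auto
    show "c * W (Q x) = 0" if "1 < \<bar>x\<bar>" for x
      using that Q_ends[of x] lat W_lattice by (cases "x \<ge> 0") auto
  qed
  then have "pot (\<lambda>_. c) Q = ennreal (\<integral>x. c * W (Q x) \<partial>lborel)"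
    unfolding pot_def using assms W_nonneg by (intro nn_integral_eq_integral) auto
  with I have "action (\<lambda>_. c) Q < \<infinity>"
    by (simp add: action_def)
  moreover have "layer_cost c \<le> action (\<lambda>_. c) Q"
    unfolding layer_cost_def using \<open>Q \<in> layers\<close> by (rule INF_lower)
  ultimately show ?thesis by (rule le_less_trans[rotated])
qed

text \<open>\<open>Q\<close> is turned into a competitor \<open>T\<close> for the optimal transition
  by blending it into \<open>\<zeta>\<close> on \<open>{p..p + L}\<close> and into
  \<open>\<zeta>'\<close> on \<open>{p'..p' + L}\<close>. On these blocks \<open>Q\<close> is close
  to the lattice points, where \<open>W\<close> is comparable to a quadratic function, so the
  potential of \<open>T\<close> is at most \<open>C0 / c0\<close> times that of \<open>Q\<close>.
  The increments of the cutoffs are multiplied by distances of at most \<open>R + 1\<close>, and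
  Young's inequality separates their energy from that of \<open>Q\<close>.\<close>

lemma cut_layer:
  fixes Q :: "real \<Rightarrow> real ^ 'n"
  assumes Q: "continuous_on UNIV Q" and osc: "\<And>x y. norm (Q x - Q y) \<le> R"
    and lat: "\<zeta> \<in> int_lattice" "\<zeta>' \<in> int_lattice" "\<zeta> \<noteq> \<zeta>'"
    and L: "0 < L" and p: "u \<le> p" "p + L \<le> p'" "p' + L \<le> v"
    and near: "\<And>x. x \<in> {p..p + L} \<Longrightarrow> norm (Q x - \<zeta>) < r" "\<And>x. x \<in> {p'..p' + L} \<Longrightarrow> norm (Q x - \<zeta>') < r"
    and c: "0 < c" and \<alpha>: "0 < \<alpha>"
  shows "layer_cost c \<le> ennreal (1 + \<alpha>) * interaction {u..v} Q + pot (\<lambda>x. c * indicator {u..v} x) Q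
    + ennreal ((1 + 1 / \<alpha>) * (2 * (R + 1)\<^sup>2)) * (cutoff_cost L + cutoff_cost L)
    + ennreal (c * C0 / c0) * (pot (indicator {p..<p + L}) Q + pot (indicator {p'..<p' + L}) Q)"
proof -
  define \<phi> where "\<phi> x = 1 - ramp p L x" for x
  define \<phi>' where "\<phi>' x = ramp p' L x" for x
  define T where "T x = (1 - \<phi> x - \<phi>' x) *\<^sub>R Q x + \<phi> x *\<^sub>R \<zeta> + \<phi>' x *\<^sub>R \<zeta>'" for x
  have [measurable]: "Q \<in> borel_measurable borel"
    using Q by (rule borel_measurable_continuous_onI)
  have cont: "continuous_on UNIV \<phi>" "continuous_on UNIV \<phi>'"
    unfolding \<phi>_def \<phi>'_def by (intro continuous_intros ramp_continuous L)+
  have Tc: "continuous_on UNIV T"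
    unfolding T_def by (intro continuous_intros cont Q)
  have [measurable]: "T \<in> borel_measurable borel" "\<phi> \<in> borel_measurable borel" "\<phi>' \<in> borel_measurable borel"
    using Tc cont by (auto intro: borel_measurable_continuous_onI)
  have \<phi>_vals: "\<And>x. x \<le> p \<Longrightarrow> \<phi> x = 1" "\<And>x. p + L \<le> x \<Longrightarrow> \<phi> x = 0"
    and \<phi>'_vals: "\<And>x. x \<le> p' \<Longrightarrow> \<phi>' x = 0" "\<And>x. p' + L \<le> x \<Longrightarrow> \<phi>' x = 1"
    using L by (auto simp: \<phi>_def \<phi>'_def ramp_left ramp_right)
  have \<phi>_bounds: "0 \<le> \<phi> x" "\<phi> x \<le> 1" "0 \<le> \<phi>' x" "\<phi>' x \<le> 1" for x
    using ramp_bounds[of p L x] ramp_bounds[of p' L x] by (auto simp: \<phi>_def \<phi>'_def)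
  have s_bounds: "0 \<le> 1 - \<phi> x - \<phi>' x" "1 - \<phi> x - \<phi>' x \<le> 1" for x
    using \<phi>_bounds[of x] \<phi>_vals(2)[of x] \<phi>'_vals(1)[of x] p by (cases "x \<le> p'"; auto)+
  have s_out: "1 - \<phi> x - \<phi>' x = 0" if "x \<notin> {u..v}" for x
    using that \<phi>_vals[of x] \<phi>'_vals[of x] p L by auto
  \<comment> \<open>On the blending blocks \<open>Q\<close> is within \<open>r < 1\<close> of the
    lattice points, hence the \<open>R + 1\<close>.\<close>
  have \<zeta>_near: "norm (\<zeta> - Q y) \<le> R + 1" "norm (\<zeta>' - Q y) \<le> R + 1" for y
    using norm_triangle_ineq[of "\<zeta> - Q p" "Q p - Q y"] near(1)[of p] osc[of p y]
      norm_triangle_ineq[of "\<zeta>' - Q p'" "Q p' - Q y"] near(2)[of p'] osc[of p' y] L r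
    by (auto simp: norm_minus_commute)
  have T_layer: "T \<in> layers"
    unfolding layers_def
  proof (intro CollectI conjI Tc bexI exI[of _ "max \<bar>p\<bar> \<bar>p' + L\<bar>"] allI impI)
    fix x
    show "T x = \<zeta>" if "x \<le> - max \<bar>p\<bar> \<bar>p' + L\<bar>"
    proof -
      have "x \<le> p" "x \<le> p'" using that p L by auto
      then show ?thesis by (simp add: T_def \<phi>_vals \<phi>'_vals)
    qed
    show "T x = \<zeta>'" if "max \<bar>p\<bar> \<bar>p' + L\<bar> \<le> x"
    proof -
      have "p' + L \<le> x" "p + L \<le> x" using that p L by auto
      then show ?thesis by (simp add: T_def \<phi>_vals \<phi>'_vals)
    qed
  qed (use lat in auto)
  \<comment> \<open>An upper bound for the square of the part of \<open>T x - T y\<close> produced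
    by the cutoffs; the \<open>2\<close> comes from
    \<open>(a + d)\<^sup>2 \<le> 2 * (a\<^sup>2 + d\<^sup>2)\<close>.\<close>
  define E where "E x y = 2 * (R + 1)\<^sup>2 * ((norm (\<phi> x - \<phi> y))\<^sup>2 + (norm (\<phi>' x - \<phi>' y))\<^sup>2)" for x y
  have E_sym: "E x y = E y x" for x y
    by (simp add: E_def abs_minus_commute)
  have E0: "0 \<le> E x y" for x y
    by (simp add: E_def)
  \<comment> \<open>Exchanging \<open>x\<close> and \<open>y\<close> covers the remaining case, so the increment of \<open>Q\<close> is only ever multiplied
    by a coefficient that vanishes outside \<open>{u..v}\<close>.\<close>
  have key: "(norm (T x - T y))\<^sup>2 \<le> (1 + \<alpha>) * ((norm (Q x - Q y))\<^sup>2 * indicator ({u..v} \<times> {u..v}) (x, y)) + (1 + 1 / \<alpha>) * E x y"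
    if xy: "x \<notin> {u..v} \<or> (x \<in> {u..v} \<and> y \<in> {u..v})" for x y
  proof -
    define b where "b = (\<phi> x - \<phi> y) *\<^sub>R (\<zeta> - Q y) + (\<phi>' x - \<phi>' y) *\<^sub>R (\<zeta>' - Q y)"
    have T_diff: "T x - T y = (1 - \<phi> x - \<phi>' x) *\<^sub>R (Q x - Q y) + b"
      unfolding T_def b_def by (simp add: algebra_simps)
    have "norm b \<le> \<bar>\<phi> x - \<phi> y\<bar> * norm (\<zeta> - Q y) + \<bar>\<phi>' x - \<phi>' y\<bar> * norm (\<zeta>' - Q y)"
      unfolding b_def by (rule order_trans[OF norm_triangle_ineq]) simp
    also have "\<dots> \<le> \<bar>\<phi> x - \<phi> y\<bar> * (R + 1) + \<bar>\<phi>' x - \<phi>' y\<bar> * (R + 1)"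
      by (intro add_mono mult_left_mono \<zeta>_near) auto
    finally have "(norm b)\<^sup>2 \<le> ((R + 1) * (\<bar>\<phi> x - \<phi> y\<bar> + \<bar>\<phi>' x - \<phi>' y\<bar>))\<^sup>2"
      by (intro power_mono) (auto simp: algebra_simps)
    also have "\<dots> = (R + 1)\<^sup>2 * (\<bar>\<phi> x - \<phi> y\<bar> + \<bar>\<phi>' x - \<phi>' y\<bar>)\<^sup>2"
      by (simp add: power_mult_distrib)
    also have "\<dots> \<le> (R + 1)\<^sup>2 * (2 * (\<bar>\<phi> x - \<phi> y\<bar>\<^sup>2 + \<bar>\<phi>' x - \<phi>' y\<bar>\<^sup>2))"
    proof (rule mult_left_mono)
      show "(a + d)\<^sup>2 \<le> 2 * (a\<^sup>2 + d\<^sup>2)" for a d :: real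
        using sum_squares_bound[of a d] by (simp add: power2_sum)
    qed simp
    finally have b: "(norm b)\<^sup>2 \<le> E x y"
      by (simp add: E_def algebra_simps)
    show ?thesis
    proof (cases "x \<in> {u..v}")
      case True
      have "(norm (T x - T y))\<^sup>2 \<le> (1 + \<alpha>) * (norm ((1 - \<phi> x - \<phi>' x) *\<^sub>R (Q x - Q y)))\<^sup>2 + (1 + 1 / \<alpha>) * (norm b)\<^sup>2"
        unfolding T_diff by (rule norm_add_square_le[OF \<alpha>])
      also have "\<dots> \<le> (1 + \<alpha>) * (norm (Q x - Q y))\<^sup>2 + (1 + 1 / \<alpha>) * E x y"
      proof (intro add_mono mult_left_mono b power_mono)
        show "norm ((1 - \<phi> x - \<phi>' x) *\<^sub>R (Q x - Q y)) \<le> norm (Q x - Q y)"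
          using s_bounds[of x] mult_right_mono[of "1 - \<phi> x - \<phi>' x" 1 "norm (Q x - Q y)"] by simp
      qed (use \<alpha> in auto)
      finally show ?thesis
        using xy True by simp
    next
      case False
      have "(norm (T x - T y))\<^sup>2 = (norm b)\<^sup>2"
        unfolding T_diff s_out[OF False] by simp
      also have "\<dots> \<le> 1 * E x y"
        using b by simp
      also have "\<dots> \<le> (1 + 1 / \<alpha>) * E x y"
        using \<alpha> by (intro mult_right_mono E0) auto
      finally show ?thesis
        using False by (auto simp: indicator_def)
    qed
  qed
  have key': "(norm (T x - T y))\<^sup>2 \<le> (1 + \<alpha>) * ((norm (Q x - Q y))\<^sup>2 * indicator ({u..v} \<times> {u..v}) (x, y)) + (1 + 1 / \<alpha>) * E x y" for x y
  proof (cases "x \<notin> {u..v} \<or> (x \<in> {u..v} \<and> y \<in> {u..v})")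
    case False
    then have "y \<notin> {u..v} \<or> (y \<in> {u..v} \<and> x \<in> {u..v})" by blast
    from key[OF this] show ?thesis
      by (simp add: norm_minus_commute E_sym indicator_def conj_commute)
  qed (rule key)
  define K where "K = (1 + 1 / \<alpha>) * (2 * (R + 1)\<^sup>2)"
  have K0: "0 \<le> K"
    using \<alpha> by (simp add: K_def)
  have meas: "(\<lambda>z. ennreal (density Q z) * indicator ({u..v} \<times> {u..v}) z) \<in> borel_measurable lborel"
    "(\<lambda>z. ennreal (density \<phi> z)) \<in> borel_measurable lborel"
    "(\<lambda>z. ennreal (density \<phi>' z)) \<in> borel_measurable lborel"
    using interaction_measurable(2)[of Q "{u..v}"] interaction_measurable(1)[of \<phi>] interaction_measurable(1)[of \<phi>']
    by simp_all
  have "interaction UNIV T \<le> (\<integral>\<^sup>+z. ennreal (1 + \<alpha>) * (ennreal (density Q z) * indicator ({u..v} \<times> {u..v}) z)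
      + ennreal K * (ennreal (density \<phi> z) + ennreal (density \<phi>' z)) \<partial>lborel)"
    unfolding interaction_def
  proof (rule nn_integral_mono)
    fix z :: "real \<times> real"
    obtain x y where z: "z = (x, y)" by force
    have "k (x - y) * (norm (T x - T y))\<^sup>2 \<le> k (x - y) * ((1 + \<alpha>) * ((norm (Q x - Q y))\<^sup>2 * indicator ({u..v} \<times> {u..v}) (x, y)) + (1 + 1 / \<alpha>) * E x y)"
      by (rule mult_left_mono[OF key' k_nonneg])
    also have "\<dots> = (1 + \<alpha>) * (k (x - y) * (norm (Q x - Q y))\<^sup>2 * indicator ({u..v} \<times> {u..v}) (x, y))
       + K * (k (x - y) * (norm (\<phi> x - \<phi> y))\<^sup>2 + k (x - y) * (norm (\<phi>' x - \<phi>' y))\<^sup>2)"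
      by (simp only: E_def K_def distrib_left mult_ac)
    finally have "ennreal (k (x - y) * (norm (T x - T y))\<^sup>2) \<le> ennreal \<dots>"
      by (rule ennreal_leI)
    also have "\<dots> = ennreal (1 + \<alpha>) * (ennreal (k (x - y) * (norm (Q x - Q y))\<^sup>2) * indicator ({u..v} \<times> {u..v}) (x, y))
      + ennreal K * (ennreal (k (x - y) * (norm (\<phi> x - \<phi> y))\<^sup>2) + ennreal (k (x - y) * (norm (\<phi>' x - \<phi>' y))\<^sup>2))"
      using \<alpha> K0 k_nonneg[of "x - y"]
      by (subst ennreal_plus; simp add: ennreal_mult ennreal_plus ennreal_indicator)
    finally show "ennreal (density T z) * indicator (UNIV \<times> UNIV) z
      \<le> ennreal (1 + \<alpha>) * (ennreal (density Q z) * indicator ({u..v} \<times> {u..v}) z)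
      + ennreal K * (ennreal (density \<phi> z) + ennreal (density \<phi>' z))"
      unfolding z by (simp only: fst_conv snd_conv) simp
  qed
  also have "\<dots> = ennreal (1 + \<alpha>) * interaction {u..v} Q + ennreal K * (interaction UNIV \<phi> + interaction UNIV \<phi>')"
    unfolding interaction_def using meas
    by (simp add: nn_integral_add nn_integral_cmult)
  also have "interaction UNIV \<phi> = interaction UNIV (ramp p L)"
    unfolding interaction_def \<phi>_def by (simp add: abs_minus_commute)
  also have "ennreal (1 + \<alpha>) * interaction {u..v} Q + ennreal K * (interaction UNIV (ramp p L) + interaction UNIV \<phi>')
    \<le> ennreal (1 + \<alpha>) * interaction {u..v} Q + ennreal K * (cutoff_cost L + cutoff_cost L)"
    unfolding \<phi>'_def by (intro add_left_mono mult_left_mono add_mono interaction_ramp L) auto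
  finally have I: "interaction UNIV T \<le> ennreal (1 + \<alpha>) * interaction {u..v} Q + ennreal K * (cutoff_cost L + cutoff_cost L)" .
  \<comment> \<open>Moving towards a lattice point inside its ball of radius \<open>r\<close>
    increases \<open>W\<close> at most by the ratio of the two quadratic bounds.\<close>
  have W1: "W (T x) \<le> C0 / c0 * W (Q x)" if "norm (T x - \<eta>) \<le> norm (Q x - \<eta>)" "norm (Q x - \<eta>) < r" "\<eta> \<in> int_lattice" for x \<eta>
  proof -
    have "W (T x) \<le> C0 * (norm (T x - \<eta>))\<^sup>2"
      using that by (intro W_quadratic_lattice) auto
    also have "\<dots> \<le> C0 * (norm (Q x - \<eta>))\<^sup>2"
      using that C0 by (intro mult_left_mono power_mono) auto
    also have "\<dots> = C0 / c0 * (c0 * (norm (Q x - \<eta>))\<^sup>2)"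
      using c0 by simp
    also have "\<dots> \<le> C0 / c0 * W (Q x)"
      using that C0 c0 by (intro mult_left_mono W_quadratic_lattice) auto
    finally show ?thesis .
  qed
  have rhs_nonneg: "0 \<le> indicator {u..v} x * W (Q x)
      + C0 / c0 * (indicator {p..<p + L} x * W (Q x) + indicator {p'..<p' + L} x * W (Q x))" for x
    using C0 c0 by (intro add_nonneg_nonneg mult_nonneg_nonneg W_nonneg) auto
  have W2: "W (T x) \<le> indicator {u..v} x * W (Q x)
      + C0 / c0 * (indicator {p..<p + L} x * W (Q x) + indicator {p'..<p' + L} x * W (Q x))" for x
  proof -
    consider "x < p" | "x \<in> {p..<p + L}" | "p + L \<le> x" "x < p'" | "x \<in> {p'..<p' + L}" | "p' + L \<le> x"
      by fastforce
    then show ?thesis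
    proof cases
      case 1
      then have "T x = \<zeta>"
        using p L by (simp add: T_def \<phi>_vals \<phi>'_vals)
      then show ?thesis
        using W_lattice[OF lat(1)] rhs_nonneg[of x] by simp
    next
      case 2
      then have "T x - \<zeta> = (1 - \<phi> x) *\<^sub>R (Q x - \<zeta>)"
        using p L by (simp add: T_def \<phi>'_vals algebra_simps)
      then have "norm (T x - \<zeta>) \<le> norm (Q x - \<zeta>)"
        using \<phi>_bounds[of x] by (simp add: mult_left_le_one_le)
      then have "W (T x) \<le> C0 / c0 * W (Q x)"
        using near(1)[of x] 2 lat(1) by (intro W1[of _ \<zeta>]) auto
      then show ?thesis
        using 2 p L W_nonneg[of "Q x"] by (auto simp: indicator_def)
    next
      case 3
      then have "T x = Q x"
        using p L by (simp add: T_def \<phi>_vals \<phi>'_vals)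
      then show ?thesis
        using 3 p L by (auto simp: indicator_def)
    next
      case 4
      then have "T x - \<zeta>' = (1 - \<phi>' x) *\<^sub>R (Q x - \<zeta>')"
        using p L by (simp add: T_def \<phi>_vals algebra_simps)
      then have "norm (T x - \<zeta>') \<le> norm (Q x - \<zeta>')"
        using \<phi>_bounds[of x] by (simp add: mult_left_le_one_le)
      then have "W (T x) \<le> C0 / c0 * W (Q x)"
        using near(2)[of x] 4 lat(2) by (intro W1[of _ \<zeta>']) auto
      then show ?thesis
        using 4 p L W_nonneg[of "Q x"] by (auto simp: indicator_def)
    next
      case 5
      then have "T x = \<zeta>'"
        using p L by (simp add: T_def \<phi>_vals \<phi>'_vals)
      then show ?thesis
        using W_lattice[OF lat(2)] rhs_nonneg[of x] by simp
    qed
  qed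
  have "pot (\<lambda>_. c) T \<le> (\<integral>\<^sup>+x. ennreal (c * indicator {u..v} x * W (Q x))
      + ennreal (c * C0 / c0) * (ennreal (indicator {p..<p + L} x * W (Q x)) + ennreal (indicator {p'..<p' + L} x * W (Q x))) \<partial>lborel)"
    unfolding pot_def
  proof (rule nn_integral_mono)
    fix x
    have "ennreal (c * W (T x)) \<le> ennreal (c * indicator {u..v} x * W (Q x)
      + c * C0 / c0 * (indicator {p..<p + L} x * W (Q x) + indicator {p'..<p' + L} x * W (Q x)))"
      using mult_left_mono[OF W2[of x], of c] c by (intro ennreal_leI) (simp add: algebra_simps)
    also have "\<dots> = ennreal (c * indicator {u..v} x * W (Q x))
      + ennreal (c * C0 / c0) * (ennreal (indicator {p..<p + L} x * W (Q x)) + ennreal (indicator {p'..<p' + L} x * W (Q x)))"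
      using c C0 c0 by (intro ennreal_add_mult_add mult_nonneg_nonneg W_nonneg) auto
    finally show "ennreal (c * W (T x)) \<le> \<dots>" .
  qed
  also have "\<dots> = pot (\<lambda>x. c * indicator {u..v} x) Q
    + ennreal (c * C0 / c0) * (pot (indicator {p..<p + L}) Q + pot (indicator {p'..<p' + L}) Q)"
    unfolding pot_def by (simp add: nn_integral_add nn_integral_cmult)
  finally have V: "pot (\<lambda>_. c) T \<le> \<dots>" .
  have "layer_cost c \<le> action (\<lambda>_. c) T"
    unfolding layer_cost_def using T_layer by (rule INF_lower)
  also have "\<dots> \<le> (ennreal (1 + \<alpha>) * interaction {u..v} Q + ennreal K * (cutoff_cost L + cutoff_cost L))
    + (pot (\<lambda>x. c * indicator {u..v} x) Q
    + ennreal (c * C0 / c0) * (pot (indicator {p..<p + L}) Q + pot (indicator {p'..<p' + L}) Q))"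
    unfolding action_def by (rule add_mono[OF I V])
  finally show ?thesis
    unfolding K_def by (simp only: add_ac)
qed

text \<open>Pigeonhole: \<open>M\<close> disjoint blocks cannot all carry more than
  \<open>\<omega>\<close>. A block with little potential is the place to blend, since the potential
  there gets multiplied by \<open>C0 / c0\<close>.\<close>

lemma good_block:
  fixes Q :: "real \<Rightarrow> real ^ 'n" and M :: nat
  assumes "Q \<in> borel_measurable borel" "pot (\<lambda>_. 1) Q \<le> ennreal B" "0 \<le> B" "0 < \<omega>" "B < real M * \<omega>" "0 < L"
  obtains j where "j < M" "pot (indicator {u + real j * L..<u + real j * L + L}) Q \<le> ennreal \<omega>"
proof -
  define b where "b j = {u + real j * L..<u + real j * L + L}" for j :: nat
  note [measurable] = assms(1)
  have [measurable]: "b j \<in> sets borel" for j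
    by (simp add: b_def)
  have "\<exists>j<M. pot (indicator (b j)) Q \<le> ennreal \<omega>"
  proof (rule ccontr)
    assume "\<not> (\<exists>j<M. pot (indicator (b j)) Q \<le> ennreal \<omega>)"
    then have neg: "ennreal \<omega> \<le> pot (indicator (b j)) Q" if "j < M" for j
      using that by (metis linorder_le_cases)
    have disj: "i = j" if "x \<in> b i" "x \<in> b j" for i j x
    proof (rule ccontr)
      assume "i \<noteq> j"
      then consider "real i + 1 \<le> real j" | "real j + 1 \<le> real i" by linarith
      then show False
      proof cases
        case 1
        from mult_right_mono[OF this, of L] that assms(6) show False
          by (auto simp: b_def algebra_simps)
      next
        case 2
        from mult_right_mono[OF this, of L] that assms(6) show False
          by (auto simp: b_def algebra_simps)
      qed
    qed
    have "ennreal (real M * \<omega>) = (\<Sum>j<M. ennreal \<omega>)"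
      using assms(4) by (subst sum_ennreal) auto
    also have "\<dots> \<le> (\<Sum>j<M. pot (indicator (b j)) Q)"
      by (intro sum_mono neg) auto
    also have "\<dots> = (\<integral>\<^sup>+x. (\<Sum>j<M. ennreal (indicator (b j) x * W (Q x))) \<partial>lborel)"
      unfolding pot_def by (rule nn_integral_sum[symmetric]) auto
    also have "\<dots> \<le> pot (\<lambda>_. 1) Q"
      unfolding pot_def
    proof (rule nn_integral_mono)
      fix x
      show "(\<Sum>j<M. ennreal (indicator (b j) x * W (Q x))) \<le> ennreal (1 * W (Q x))"
        using disj W_nonneg
        by (intro sum_at_most_one_le) (auto simp: indicator_def split: if_splits)
    qed
    also have "\<dots> \<le> ennreal B"
      by (rule assms(2))
    finally have "real M * \<omega> \<le> B"
      using assms(3) by simp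
    with assms(5) show False by simp
  qed
  then show ?thesis
    using that by (auto simp: b_def)
qed

text \<open>The error in \<open>cut_layer\<close> has three parts, each brought below
  \<open>\<mu> / 3\<close>: Young's parameter times the energy bound, the cutoff cost of long
  blocks, and the potential on blocks selected by pigeonhole. \<open>D\<close> leaves room for
  \<open>M\<close> sufficiently long blocks; it depends on \<open>B\<close>, \<open>c\<close> and
  \<open>\<mu>\<close> but not on \<open>Q\<close>.\<close>

lemma cell_cost:
  assumes c: "0 < c" and B: "0 \<le> B" and \<mu>: "0 < \<mu>"
  obtains D where "0 < D"
    "\<And>Q u v h \<zeta> \<zeta>'. continuous_on UNIV Q \<Longrightarrow> interaction UNIV Q \<le> ennreal B \<Longrightarrow> pot (\<lambda>_. 1) Q \<le> ennreal B \<Longrightarrow>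
      \<zeta> \<in> int_lattice \<Longrightarrow> \<zeta>' \<in> int_lattice \<Longrightarrow> \<zeta> \<noteq> \<zeta>' \<Longrightarrow> D \<le> h \<Longrightarrow> u + h \<le> v - h \<Longrightarrow>
      (\<And>x. x \<in> {u..u + h} \<Longrightarrow> norm (Q x - \<zeta>) < r) \<Longrightarrow> (\<And>x. x \<in> {v - h..v} \<Longrightarrow> norm (Q x - \<zeta>') < r) \<Longrightarrow>
      layer_cost c \<le> interaction {u..v} Q + pot (\<lambda>x. c * indicator {u..v} x) Q + ennreal \<mu>"
proof -
  obtain R where R: "0 < R" "\<And>(Q :: real \<Rightarrow> real ^ 'n) x y. continuous_on UNIV Q \<Longrightarrow> interaction UNIV Q \<le> ennreal B \<Longrightarrow>
       pot (\<lambda>_. 1) Q \<le> ennreal B \<Longrightarrow> norm (Q x - Q y) \<le> R"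
    using oscillation_bound[OF B] by blast
  define \<alpha> where "\<alpha> = \<mu> / (3 * (B + 1))"
  have \<alpha>: "0 < \<alpha>" "\<alpha> * B \<le> \<mu> / 3"
    using B \<mu> by (auto simp: \<alpha>_def field_simps)
  define K where "K = (1 + 1 / \<alpha>) * (2 * (R + 1)\<^sup>2)"
  have K: "0 < K"
    using \<alpha> R(1) unfolding K_def by (intro mult_pos_pos add_pos_pos) auto
  define \<omega> where "\<omega> = \<mu> * c0 / (6 * c * C0)"
  have \<omega>: "0 < \<omega>" "c * C0 / c0 * (\<omega> + \<omega>) = \<mu> / 3"
    using \<mu> c c0 C0 by (auto simp: \<omega>_def field_simps)
  obtain M :: nat where "B / \<omega> < M"
    using reals_Archimedean2 by blast
  then have M: "B < real M * \<omega>"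
    using \<omega>(1) by (simp add: pos_divide_less_eq)
  then have M: "B < real M * \<omega>" "0 < real M"
    using B by (cases M; simp)+
  have "eventually (\<lambda>L. cutoff_cost L < ennreal (\<mu> / (6 * K))) at_top"
    using \<mu> K by (intro order_tendstoD(2)[OF cutoff_cost_tendsto_0]) auto
  then obtain L0 where L0: "\<And>L. L0 \<le> L \<Longrightarrow> cutoff_cost L < ennreal (\<mu> / (6 * K))"
    by (auto simp: eventually_at_top_linorder)
  define D where "D = real M * max 1 L0"
  show ?thesis
  proof (rule that[of D])
    show "0 < D"
      using M(2) by (simp add: D_def)
    fix Q u v h \<zeta> \<zeta>'
    assume Q: "continuous_on UNIV Q" "interaction UNIV Q \<le> ennreal B" "pot (\<lambda>_. 1) Q \<le> ennreal B"
      and lat: "\<zeta> \<in> int_lattice" "\<zeta>' \<in> int_lattice" "\<zeta> \<noteq> \<zeta>'" and h: "D \<le> h" "u + h \<le> v - h"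
      and near: "\<And>x. x \<in> {u..u + h} \<Longrightarrow> norm (Q x - \<zeta>) < r" "\<And>x. x \<in> {v - h..v} \<Longrightarrow> norm (Q x - \<zeta>') < r"
    \<comment> \<open>Each outer zone of length \<open>h\<close> is split into \<open>M\<close>
      equal blocks, one of which will carry the cutoff; \<open>D \<le> h\<close> makes them at least
      as long as \<open>L0\<close>.\<close>
    define L where "L = h / real M"
    have hL: "h = real M * L"
      using M(2) by (simp add: L_def)
    have "max 1 L0 \<le> L"
      using h(1) M(2) unfolding L_def D_def by (subst pos_le_divide_eq) (simp_all only: mult.commute)
    then have L: "0 < L" "L0 \<le> L" by auto
    have Qm: "Q \<in> borel_measurable borel"
      using Q(1) by (rule borel_measurable_continuous_onI)
    obtain i where i: "i < M" "pot (indicator {u + real i * L..<u + real i * L + L}) Q \<le> ennreal \<omega>"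
      using good_block[OF Qm Q(3) B \<omega>(1) M(1) L(1)] by metis
    obtain j where j: "j < M" "pot (indicator {v - h + real j * L..<v - h + real j * L + L}) Q \<le> ennreal \<omega>"
      using good_block[OF Qm Q(3) B \<omega>(1) M(1) L(1)] by metis
    have inside: "0 \<le> real l * L" "real l * L + L \<le> h" if "l < M" for l
    proof -
      show "0 \<le> real l * L" using L by simp
      have "(real l + 1) * L \<le> real M * L"
        using that L by (intro mult_right_mono) auto
      then show "real l * L + L \<le> h"
        by (simp add: hL algebra_simps)
    qed
    have "layer_cost c \<le> ennreal (1 + \<alpha>) * interaction {u..v} Q + pot (\<lambda>x. c * indicator {u..v} x) Q
      + ennreal ((1 + 1 / \<alpha>) * (2 * (R + 1)\<^sup>2)) * (cutoff_cost L + cutoff_cost L)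
      + ennreal (c * C0 / c0) * (pot (indicator {u + real i * L..<u + real i * L + L}) Q
         + pot (indicator {v - h + real j * L..<v - h + real j * L + L}) Q)"
    proof (rule cut_layer[OF Q(1) R(2)[OF Q] lat L(1) _ _ _ _ _ c \<alpha>(1)])
      show "u \<le> u + real i * L" "u + real i * L + L \<le> v - h + real j * L" "v - h + real j * L + L \<le> v"
        using inside[OF i(1)] inside[OF j(1)] h by auto
      show "norm (Q x - \<zeta>) < r" if "x \<in> {u + real i * L..u + real i * L + L}" for x
      proof (rule near(1))
        show "x \<in> {u..u + h}"
          using that inside[OF i(1)] unfolding atLeastAtMost_iff by linarith
      qed
      show "norm (Q x - \<zeta>') < r" if "x \<in> {v - h + real j * L..v - h + real j * L + L}" for x
      proof (rule near(2))
        show "x \<in> {v - h..v}"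
          using that inside[OF j(1)] unfolding atLeastAtMost_iff by linarith
      qed
    qed
    also have "\<dots> \<le> (interaction {u..v} Q + ennreal (\<mu> / 3)) + pot (\<lambda>x. c * indicator {u..v} x) Q + ennreal (\<mu> / 3) + ennreal (\<mu> / 3)"
    proof (intro add_mono order_refl)
      have "ennreal (1 + \<alpha>) * interaction {u..v} Q = interaction {u..v} Q + ennreal \<alpha> * interaction {u..v} Q"
        using \<alpha> by (simp add: ennreal_plus distrib_right)
      also have "ennreal \<alpha> * interaction {u..v} Q \<le> ennreal \<alpha> * ennreal B"
        by (intro mult_left_mono order_trans[OF interaction_mono Q(2)]) auto
      also have "\<dots> \<le> ennreal (\<mu> / 3)"
        using \<alpha> B by (simp add: ennreal_mult[symmetric] ennreal_leI)
      finally show "ennreal (1 + \<alpha>) * interaction {u..v} Q \<le> interaction {u..v} Q + ennreal (\<mu> / 3)"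
        by simp
      have "ennreal K * (cutoff_cost L + cutoff_cost L) \<le> ennreal K * (ennreal (\<mu> / (6 * K)) + ennreal (\<mu> / (6 * K)))"
        by (intro mult_left_mono add_mono less_imp_le[OF L0] L) auto
      also have "\<dots> = ennreal (K * (\<mu> / (6 * K) + \<mu> / (6 * K)))"
        using K \<mu> by (simp add: ennreal_mult[symmetric] ennreal_plus[symmetric] del: ennreal_plus)
      also have "K * (\<mu> / (6 * K) + \<mu> / (6 * K)) = \<mu> / 3"
        using K by (simp add: field_simps)
      finally show "ennreal ((1 + 1 / \<alpha>) * (2 * (R + 1)\<^sup>2)) * (cutoff_cost L + cutoff_cost L) \<le> ennreal (\<mu> / 3)"
        by (simp add: K_def)
      have "ennreal (c * C0 / c0) * (pot (indicator {u + real i * L..<u + real i * L + L}) Q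
         + pot (indicator {v - h + real j * L..<v - h + real j * L + L}) Q) \<le> ennreal (c * C0 / c0) * (ennreal \<omega> + ennreal \<omega>)"
        by (intro mult_left_mono add_mono i j) auto
      also have "\<dots> = ennreal (c * C0 / c0 * (\<omega> + \<omega>))"
        using c c0 C0 \<omega>(1) by (simp add: ennreal_mult[symmetric] ennreal_plus[symmetric] del: ennreal_plus)
      finally show "ennreal (c * C0 / c0) * (pot (indicator {u + real i * L..<u + real i * L + L}) Q
         + pot (indicator {v - h + real j * L..<v - h + real j * L + L}) Q) \<le> ennreal (\<mu> / 3)"
        by (simp only: \<omega>(2))
    qed
    also have "\<dots> = interaction {u..v} Q + pot (\<lambda>x. c * indicator {u..v} x) Q + (ennreal (\<mu> / 3) + ennreal (\<mu> / 3) + ennreal (\<mu> / 3))"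
      by (simp only: add_ac)
    also have "ennreal (\<mu> / 3) + ennreal (\<mu> / 3) + ennreal (\<mu> / 3) = ennreal \<mu>"
      using \<mu> by (simp add: ennreal_plus[symmetric] del: ennreal_plus)
    finally show "layer_cost c \<le> interaction {u..v} Q + pot (\<lambda>x. c * indicator {u..v} x) Q + ennreal \<mu>" .
  qed
qed

end

section \<open>Interaction at large distances\<close>

context kernel
begin

definition far_interaction :: "real \<Rightarrow> (real \<Rightarrow> 'a::euclidean_space) \<Rightarrow> ennreal" where
  "far_interaction D Q = (\<integral>\<^sup>+p. ennreal (density Q p)
     * indicator (far D) p \<partial>lborel)"

lemma far_measurable:
  fixes Q :: "real \<Rightarrow> 'a::euclidean_space"
  assumes "Q \<in> borel_measurable borel"
  shows "(\<lambda>p. ennreal (density Q p)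
     * indicator (far D) p) \<in> borel_measurable borel"
proof -
  have "{p :: real \<times> real. D \<le> \<bar>fst p - snd p\<bar>} \<in> sets borel"
    by (intro borel_closed closed_Collect_le continuous_intros)
  then show ?thesis
    by (intro borel_measurable_times_ennreal interaction_measurable(1)[OF assms] borel_measurable_indicator)
qed

lemma far_interaction_shift:
  fixes Q :: "real \<Rightarrow> 'a::euclidean_space"
  assumes "Q \<in> borel_measurable borel"
  shows "far_interaction D (\<lambda>x. Q (x - c)) = far_interaction D Q"
  using nn_integral_shift[OF far_measurable[OF assms, of D], of c]
  unfolding far_interaction_def by (simp add: indicator_def)

text \<open>Dominated convergence with the whole energy density as majorant: every fixed pair of
  points is eventually closer than \<open>D\<close>.\<close>

lemma far_interaction_tendsto_0:
  fixes Q :: "real \<Rightarrow> 'a::euclidean_space"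
  assumes Q: "Q \<in> borel_measurable borel" "interaction UNIV Q < \<infinity>"
  shows "((\<lambda>D. far_interaction D Q) \<longlongrightarrow> 0) at_top"
proof (rule tendsto_at_topI_sequentially)
  fix X :: "nat \<Rightarrow> real"
  assume X: "filterlim X at_top sequentially"
  let ?w = "\<lambda>p. ennreal (density Q p)"
  have "(\<lambda>n. far_interaction (X n) Q) \<longlonglongrightarrow> (\<integral>\<^sup>+p. 0 \<partial>(lborel :: (real \<times> real) measure))"
    unfolding far_interaction_def
  proof (rule nn_integral_dominated_convergence[where w = ?w])
    show "?w \<in> borel_measurable lborel"
      using interaction_measurable(1)[OF Q(1)] by simp
    show "(\<lambda>p. ?w p * indicator (far (X n)) p) \<in> borel_measurable lborel" for n
      using far_measurable[OF Q(1), of "X n"] by simp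
    show "(\<integral>\<^sup>+p. ?w p \<partial>lborel) < \<infinity>"
      using Q(2) by (simp add: interaction_def)
    show "AE p in lborel. ?w p * indicator (far (X n)) p \<le> ?w p" for n
      by (intro AE_I2) (auto simp: indicator_def)
    show "AE p in lborel. (\<lambda>n. ?w p * indicator (far (X n)) p) \<longlonglongrightarrow> 0"
    proof (rule AE_I2)
      fix p :: "real \<times> real"
      have "eventually (\<lambda>n. \<bar>fst p - snd p\<bar> < X n) sequentially"
        using X by (auto simp: filterlim_at_top_dense)
      then have "eventually (\<lambda>n. ?w p * indicator (far (X n)) p = 0) sequentially"
        by eventually_elim simp
      then show "(\<lambda>n. ?w p * indicator (far (X n)) p) \<longlonglongrightarrow> 0"
        by (rule tendsto_eventually)
    qed
  qed simp
  then show "(\<lambda>n. far_interaction (X n) Q) \<longlonglongrightarrow> 0"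
    by simp
qed

end

section \<open>Superposition of translated transitions\<close>

context transition_problem
begin

lemma pot_shift:
  assumes [measurable]: "Q \<in> borel_measurable borel" "a \<in> borel_measurable borel"
  shows "pot a (\<lambda>x. Q (x - t)) = pot (\<lambda>x. a (x + t)) Q"
  unfolding pot_def
  using nn_integral_real_affine[of "\<lambda>x. ennreal (a x * W (Q (x - t)))" 1 t]
  by (simp add: add.commute)

text \<open>Each summand of \<open>P\<close> is \<open>0\<close> before its transition and
  \<open>\<eta>' - \<eta>\<close> after it, and \<open>2 * R \<le> T\<close> keeps the transitions
  apart. Hence at each point at most one translate is off the lattice, and by periodicity the
  potential is that of this translate. Two points closer than \<open>T - 2 * R\<close> see at most
  one transition, so the squared increments simply add; for the other pairs the Cauchy-Schwarz
  inequality costs a factor \<open>n\<close>, whence the far interaction in the bound.\<close>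

lemma chain_upper_bound:
  fixes q :: "real \<Rightarrow> real ^ 'n" and n :: nat and a :: "real \<Rightarrow> real"
  assumes q: "continuous_on UNIV q" and lat: "\<zeta>\<^sub>1 \<in> int_lattice" "\<eta> \<in> int_lattice" "\<eta>' \<in> int_lattice"
    and ends: "\<And>x. x \<le> - R \<Longrightarrow> q x = \<eta>" "\<And>x. R \<le> x \<Longrightarrow> q x = \<eta>'"
    and T: "0 < T" "2 * R \<le> T"
    and a: "a \<in> borel_measurable borel" "\<And>x. 0 \<le> a x"
    and well: "\<And>i x. i \<in> {1..n} \<Longrightarrow> \<bar>x\<bar> \<le> R \<Longrightarrow> a (x + (2 * real i - 1) * T / 2) \<le> c'"
    and P_def: "P = (\<lambda>x. \<zeta>\<^sub>1 + (\<Sum>i\<in>{1..n}. q (x - (2 * real i - 1) * T / 2) - \<eta>))"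
  shows "continuous_on UNIV P"
    and "\<And>i x. i \<in> {1..n + 1} \<Longrightarrow> i = 1 \<or> (2 * real i - 3) * T / 2 + R \<le> x \<Longrightarrow>
       i = n + 1 \<or> x \<le> (2 * real i - 1) * T / 2 - R \<Longrightarrow> P x = \<zeta>\<^sub>1 + (real i - 1) *\<^sub>R (\<eta>' - \<eta>)"
    and "action a P \<le> of_nat n * (action (\<lambda>_. c') q + of_nat n * far_interaction (T - 2 * R) q)"
proof -
  define X where "X i = (2 * real i - 1) * T / 2" for i :: nat
  define p where "p i x = q (x - X i)" for i x
  have P: "P x = \<zeta>\<^sub>1 + (\<Sum>i\<in>{1..n}. p i x - \<eta>)" for x
    by (simp add: P_def p_def X_def)
  have pc: "continuous_on UNIV (p i)" for i
    unfolding p_def by (intro continuous_on_compose2[OF q] continuous_intros) auto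
  have qm[measurable]: "q \<in> borel_measurable borel" and pm[measurable]: "p i \<in> borel_measurable borel"
    and am[measurable]: "a \<in> borel_measurable borel" for i
    using q pc a(1) by (auto intro: borel_measurable_continuous_onI)
  show Pc: "continuous_on UNIV P"
    unfolding P_def by (intro continuous_intros continuous_on_compose2[OF q]) auto
  have X_gap: "X j + T \<le> X i" if "j < i" for i j
  proof -
    have "1 * T \<le> (real i - real j) * T"
      using that T by (intro mult_right_mono) auto
    then show ?thesis by (simp add: X_def field_simps)
  qed
  have p_ends: "p i x = \<eta>" if "x \<le> X i - R" for i x
    using that ends(1)[of "x - X i"] by (simp add: p_def)
  have p_ends': "p i x = \<eta>'" if "X i + R \<le> x" for i x
    using that ends(2)[of "x - X i"] by (simp add: p_def)
  show "P x = \<zeta>\<^sub>1 + (real i - 1) *\<^sub>R (\<eta>' - \<eta>)"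
    if i: "i \<in> {1..n + 1}" and l: "i = 1 \<or> (2 * real i - 3) * T / 2 + R \<le> x"
      and u: "i = n + 1 \<or> x \<le> (2 * real i - 1) * T / 2 - R" for i x
  proof -
    have "p j x - \<eta> = (if j < i then \<eta>' - \<eta> else 0)" if "j \<in> {1..n}" for j
    proof (cases "j < i")
      case True
      then have "j < i - 1 \<or> j = i - 1" by linarith
      then have "X j \<le> X (i - 1)"
        using X_gap[of j "i - 1"] T by auto
      moreover have "X (i - 1) + R \<le> x"
        using l True that by (auto simp: X_def of_nat_diff algebra_simps)
      ultimately show ?thesis
        using True p_ends'[of j x] by auto
    next
      case False
      then have "X i \<le> X j"
        using X_gap[of i j] T by (cases "j = i") auto
      moreover have "x \<le> X i - R"
        using u False that by (auto simp: X_def)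
      ultimately show ?thesis
        using False p_ends[of x j] by auto
    qed
    then have "(\<Sum>j\<in>{1..n}. p j x - \<eta>) = (\<Sum>j\<in>{1..n}. if j < i then \<eta>' - \<eta> else 0)"
      by (intro sum.cong) auto
    also have "\<dots> = (\<Sum>j\<in>{1..n} \<inter> {j. j < i}. \<eta>' - \<eta>)"
      by (simp add: sum.If_cases)
    also have "{1..n} \<inter> {j. j < i} = {1..<i}"
      using i by auto
    also have "(\<Sum>j\<in>{1..<i}. \<eta>' - \<eta>) = (real i - 1) *\<^sub>R (\<eta>' - \<eta>)"
      using i by (simp add: of_nat_diff sum_constant_scaleR del: sum_constant)
    finally show ?thesis
      by (simp add: P)
  qed
  have "pot a P \<le> (\<Sum>i\<in>{1..n}. pot (\<lambda>_. c') q)"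
  proof -
    have sum_lat: "\<zeta>\<^sub>1 + (\<Sum>i\<in>I. p i x - \<eta>) \<in> int_lattice"
      if "finite I" "\<And>i. i \<in> I \<Longrightarrow> p i x = \<eta> \<or> p i x = \<eta>'" for x I
    proof -
      have "(\<Sum>i\<in>I. p i x - \<eta>) \<in> int_lattice"
        using that
      proof (induction I rule: finite_induct)
        case empty
        then show ?case by (simp add: int_lattice_def)
      next
        case (insert i I)
        have "p i x - \<eta> \<in> int_lattice"
          using insert(4)[of i] lat by (auto simp: int_lattice_def)
        then show ?case
          using insert by (auto intro: lattice_add)
      qed
      then show ?thesis
        by (rule lattice_add[OF lat(1)])
    qed
    have W_le: "W (P x) \<le> (\<Sum>i\<in>{1..n}. W (p i x))" for x
    proof (cases "\<exists>i\<in>{1..n}. p i x \<noteq> \<eta> \<and> p i x \<noteq> \<eta>'")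
      case True
      then obtain i where i: "i \<in> {1..n}" "p i x \<noteq> \<eta>" "p i x \<noteq> \<eta>'" by blast
      then have xi: "X i - R < x" "x < X i + R"
        using p_ends[of x i] p_ends'[of i x] by (meson not_le)+
      have others: "p j x = \<eta> \<or> p j x = \<eta>'" if j: "j \<in> {1..n} - {i}" for j
      proof -
        consider "j < i" | "i < j" using j by force
        then show ?thesis
          using X_gap[of j i] X_gap[of i j] xi T p_ends[of x j] p_ends'[of j x] by cases auto
      qed
      have "P x = p i x + ((\<zeta>\<^sub>1 + (\<Sum>j\<in>{1..n} - {i}. p j x - \<eta>)) + (- \<eta>))"
        using i(1) by (simp add: P sum.remove[of _ i])
      moreover have "(\<zeta>\<^sub>1 + (\<Sum>j\<in>{1..n} - {i}. p j x - \<eta>)) + (- \<eta>) \<in> int_lattice"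
        by (intro lattice_add lattice_uminus lat(2) sum_lat others) auto
      ultimately have "W (P x) = W (p i x)"
        by (simp only: W_periodic)
      also have "\<dots> \<le> (\<Sum>i\<in>{1..n}. W (p i x))"
        using i(1) by (intro member_le_sum W_nonneg) auto
      finally show ?thesis .
    next
      case False
      then have "P x \<in> int_lattice"
        unfolding P by (intro sum_lat) auto
      then show ?thesis
        by (simp add: W_lattice sum_nonneg W_nonneg)
    qed
    have "pot a P \<le> (\<integral>\<^sup>+x. (\<Sum>i\<in>{1..n}. ennreal (a x * W (p i x))) \<partial>lborel)"
      unfolding pot_def
    proof (rule nn_integral_mono)
      fix x
      have "a x * W (P x) \<le> (\<Sum>i\<in>{1..n}. a x * W (p i x))"
        using mult_left_mono[OF W_le[of x] a(2)[of x]] by (simp add: sum_distrib_left)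
      then show "ennreal (a x * W (P x)) \<le> (\<Sum>i\<in>{1..n}. ennreal (a x * W (p i x)))"
        using a(2) W_nonneg by (subst sum_ennreal) (auto intro: ennreal_leI)
    qed
    also have "\<dots> = (\<Sum>i\<in>{1..n}. pot a (p i))"
      unfolding pot_def by (rule nn_integral_sum) measurable
    also have "\<dots> \<le> (\<Sum>i\<in>{1..n}. pot (\<lambda>_. c') q)"
    proof (rule sum_mono)
      fix i
      assume i: "i \<in> {1..n}"
      have "pot a (p i) = pot (\<lambda>x. a (x + X i)) q"
        unfolding p_def by (rule pot_shift) measurable
      also have "\<dots> \<le> pot (\<lambda>_. c') q"
        unfolding pot_def
      proof (intro nn_integral_mono ennreal_leI)
        fix x
        \<comment> \<open>The bound \<open>c'\<close> on the weight is available only near the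
          centre of the transition; elsewhere \<open>q\<close> is a lattice point and
          \<open>W\<close> vanishes.\<close>
        show "a (x + X i) * W (q x) \<le> c' * W (q x)"
        proof (cases "\<bar>x\<bar> \<le> R")
          case True
          then show ?thesis
            using well[OF i True] W_nonneg by (intro mult_right_mono) (auto simp: X_def)
        next
          case False
          then have "q x = \<eta> \<or> q x = \<eta>'"
            using ends(1)[of x] ends(2)[of x] by linarith
          then show ?thesis
            using lat W_lattice by auto
        qed
      qed
      finally show "pot a (p i) \<le> pot (\<lambda>_. c') q" .
    qed
    finally show ?thesis .
  qed
  then have V: "pot a P \<le> of_nat n * pot (\<lambda>_. c') q"
    by simp
  define D where "D = T - 2 * R"
  have pt: "(norm (P x - P y))\<^sup>2 \<le> (\<Sum>i\<in>{1..n}. (norm (p i x - p i y))\<^sup>2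
      + real n * ((norm (p i x - p i y))\<^sup>2 * indicator (far D) (x, y)))" for x y
  proof -
    have dP: "P x - P y = (\<Sum>i\<in>{1..n}. p i x - p i y)"
      by (simp add: P sum_subtractf)
    show ?thesis
    proof (cases "D \<le> \<bar>x - y\<bar>")
      case True
      have "(norm (P x - P y))\<^sup>2 \<le> (\<Sum>i\<in>{1..n}. norm (p i x - p i y))\<^sup>2"
        unfolding dP by (intro power_mono norm_sum) auto
      also have "\<dots> \<le> (\<Sum>i\<in>{1..n}. (norm (p i x - p i y))\<^sup>2) * card {1..n}"
        by (rule sum_squared_le_sum_of_squares) 
      also have "\<dots> = (\<Sum>i\<in>{1..n}. real n * (norm (p i x - p i y))\<^sup>2)"
        by (simp add: sum_distrib_left mult.commute)
      also have "\<dots> \<le> (\<Sum>i\<in>{1..n}. (norm (p i x - p i y))\<^sup>2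
        + real n * ((norm (p i x - p i y))\<^sup>2 * indicator (far D) (x, y)))"
        using True by (intro sum_mono) simp
      finally show ?thesis .
    next
      case False
      have "(norm (P x - P y))\<^sup>2 \<le> (\<Sum>i\<in>{1..n}. (norm (p i x - p i y))\<^sup>2)"
      proof (cases "\<exists>i\<in>{1..n}. p i x \<noteq> p i y")
        case True
        then obtain i where i: "i \<in> {1..n}" "p i x \<noteq> p i y" by blast
        \<comment> \<open>A translate changes between \<open>x\<close> and \<open>y\<close> only if
          the interval between them meets its transition; two such translates would force
          \<open>\<bar>x - y\<bar> > T - 2 * R\<close>.\<close>
        have straddle: "min x y < X j + R" "X j - R < max x y" if "p j x \<noteq> p j y" for j
          using that p_ends[of x j] p_ends[of y j] p_ends'[of j x] p_ends'[of j y]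
          by (auto simp: min_less_iff_disj less_max_iff_disj not_le[symmetric])
        have "p j x = p j y" if "j \<in> {1..n} - {i}" for j
        proof (rule ccontr)
          assume "p j x \<noteq> p j y"
          from straddle[OF this] straddle[OF i(2)] have "\<bar>X i - X j\<bar> - 2 * R < \<bar>x - y\<bar>"
            by (auto simp: min_def max_def abs_if split: if_splits)
          moreover have "T \<le> \<bar>X i - X j\<bar>"
            using that X_gap[of i j] X_gap[of j i] T by (cases "i < j") auto
          ultimately show False
            using False by (simp add: D_def)
        qed
        then have "P x - P y = p i x - p i y"
          unfolding dP using i(1) by (subst sum.remove[of _ i]) auto
        then have "(norm (P x - P y))\<^sup>2 = (norm (p i x - p i y))\<^sup>2" by simp
        also have "\<dots> \<le> (\<Sum>i\<in>{1..n}. (norm (p i x - p i y))\<^sup>2)"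
          using i(1) by (intro member_le_sum) auto
        finally show ?thesis .
      qed (simp add: dP sum_nonneg)
      then show ?thesis
        using False by (simp add: indicator_def)
    qed
  qed
  have "interaction UNIV P \<le> (\<integral>\<^sup>+z. (\<Sum>i\<in>{1..n}. ennreal (density (p i) z)
      + ennreal (real n) * (ennreal (density (p i) z) * indicator (far D) z)) \<partial>lborel)"
    unfolding interaction_def
  proof (rule nn_integral_mono)
    fix z :: "real \<times> real"
    obtain x y where z: "z = (x, y)" by force
    define S where "S = {p :: real \<times> real. D \<le> \<bar>fst p - snd p\<bar>}"
    have "k (x - y) * (norm (P x - P y))\<^sup>2 \<le> (\<Sum>i\<in>{1..n}. k (x - y) * (norm (p i x - p i y))\<^sup>2
      + real n * (k (x - y) * (norm (p i x - p i y))\<^sup>2 * indicator S (x, y)))"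
      using mult_left_mono[OF pt[of x y] k_nonneg[of "x - y"]]
      unfolding S_def by (simp add: sum_distrib_left distrib_left mult_ac)
    then have "ennreal (k (x - y) * (norm (P x - P y))\<^sup>2) \<le> ennreal (\<Sum>i\<in>{1..n}. k (x - y) * (norm (p i x - p i y))\<^sup>2
      + real n * (k (x - y) * (norm (p i x - p i y))\<^sup>2 * indicator S (x, y)))"
      by (rule ennreal_leI)
    also have "\<dots> = (\<Sum>i\<in>{1..n}. ennreal (k (x - y) * (norm (p i x - p i y))\<^sup>2
      + real n * (k (x - y) * (norm (p i x - p i y))\<^sup>2 * indicator S (x, y))))"
      using k_nonneg by (intro sum_ennreal[symmetric]) auto
    also have "\<dots> = (\<Sum>i\<in>{1..n}. ennreal (k (x - y) * (norm (p i x - p i y))\<^sup>2)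
      + ennreal (real n) * (ennreal (k (x - y) * (norm (p i x - p i y))\<^sup>2) * indicator S (x, y)))"
      using k_nonneg by (intro sum.cong refl) (simp add: ennreal_mult ennreal_indicator)
    finally show "ennreal (density P z) * indicator (UNIV \<times> UNIV) z
      \<le> (\<Sum>i\<in>{1..n}. ennreal (density (p i) z)
      + ennreal (real n) * (ennreal (density (p i) z) * indicator (far D) z))"
      unfolding z S_def by (simp only: fst_conv snd_conv) simp
  qed
  also have "\<dots> = (\<Sum>i\<in>{1..n}. interaction UNIV (p i) + ennreal (real n) * far_interaction D (p i))"
  proof -
    have m: "(\<lambda>z. ennreal (density (p i) z)) \<in> borel_measurable lborel"
      "(\<lambda>z. ennreal (density (p i) z) * indicator (far D) z) \<in> borel_measurable lborel" for i
      using interaction_measurable(1)[OF pm[of i]] far_measurable[OF pm[of i], of D] by simp_all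
    show ?thesis
      unfolding interaction_def far_interaction_def
      using m by (simp add: nn_integral_sum nn_integral_add nn_integral_cmult)
  qed
  also have "\<dots> = of_nat n * (interaction UNIV q + of_nat n * far_interaction D q)"
    unfolding p_def interaction_shift[OF qm] far_interaction_shift[OF qm] by (simp add: ennreal_of_nat_eq_real_of_nat)
  finally have "action a P \<le> of_nat n * (interaction UNIV q + of_nat n * far_interaction D q) + of_nat n * pot (\<lambda>_. c') q"
    unfolding action_def using V by (rule add_mono)
  then show "action a P \<le> of_nat n * (action (\<lambda>_. c') q + of_nat n * far_interaction (T - 2 * R) q)"
    by (simp add: D_def action_def distrib_left add_ac)
qed

end

section \<open>Multibump minimizers\<close>

text \<open>For \<open>1 < i < N\<close> this is the closed interval of radius \<open>T / 4\<close>
  about \<open>(i - 1) * T\<close>, a maximum of \<open>a\<close> when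
  \<open>T = 2 * pi / \<epsilon>\<close>. The end points are written relative to the neighbouring
  minima \<open>(2 * i - 3) * T / 2\<close> and \<open>(2 * i - 1) * T / 2\<close>, where the
  transitions are centred.\<close>

definition plateau :: "nat \<Rightarrow> real \<Rightarrow> nat \<Rightarrow> real set" where
  "plateau N T i = {x. (i = 1 \<or> (2 * real i - 3) * T / 2 + T / 4 \<le> x) \<and>
     (i = N \<or> x \<le> (2 * real i - 1) * T / 2 - T / 4)}"

context kernel
begin

text \<open>Pairs in different cells are discarded. Adjacent squares share only a corner on the
  diagonal, where the density vanishes, so the comparison holds at every point.\<close>

lemma sum_interaction_cells_le:
  fixes Q :: "real \<Rightarrow> 'a::euclidean_space"
  assumes Qm: "Q \<in> borel_measurable borel" and T: "0 < T"
  shows "(\<Sum>i<n. interaction {real i * T..(real i + 1) * T} Q) \<le> interaction UNIV Q"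
proof -
  let ?C = "\<lambda>i::nat. {real i * T..(real i + 1) * T}"
  let ?w = "\<lambda>z. ennreal (density Q z)"
  have "(\<Sum>i<n. interaction (?C i) Q) = (\<integral>\<^sup>+z. (\<Sum>i<n. ?w z * indicator (?C i \<times> ?C i) z) \<partial>lborel)"
    unfolding interaction_def
    using interaction_measurable(2)[OF Qm] by (intro nn_integral_sum[symmetric]) simp
  also have "\<dots> \<le> interaction UNIV Q"
    unfolding interaction_def
  proof (rule nn_integral_mono)
    fix z :: "real \<times> real"
    show "(\<Sum>i<n. ?w z * indicator (?C i \<times> ?C i) z) \<le> ?w z * indicator (UNIV \<times> UNIV) z"
    proof (rule sum_at_most_one_le)
      fix i j
      assume nz: "?w z * indicator (?C i \<times> ?C i) z \<noteq> 0" "?w z * indicator (?C j \<times> ?C j) z \<noteq> 0"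
      then have ne: "fst z \<noteq> snd z" by auto
      have z: "z \<in> ?C i \<times> ?C i" "z \<in> ?C j \<times> ?C j"
        using nz by (auto simp: indicator_def split: if_splits)
      show "i = j"
      proof (rule ccontr)
        assume "i \<noteq> j"
        then consider "real i + 1 \<le> real j" | "real j + 1 \<le> real i" by linarith
        then have "(real i + 1) * T \<le> real j * T \<or> (real j + 1) * T \<le> real i * T"
          using T by (meson less_imp_le mult_right_mono)
        with z ne show False
          by (cases z) auto
      qed
    qed (auto simp: indicator_def)
  qed
  finally show ?thesis .
qed

end

section \<open>Contact with the constraints, limits at infinity, strict minimality\<close>

context transition_problem
begin

text \<open>Around \<open>p\<close> the values of \<open>Q\<close> stay in the annulus between the
  radii \<open>d / 2\<close> and \<open>r\<close>, where the quadratic lower bound keeps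
  \<open>W\<close> away from \<open>0\<close>. This serves both for a contact with the constraint
  and, with weight \<open>1\<close>, for the limits at infinity.\<close>

lemma contact_cost:
  fixes Q :: "real \<Rightarrow> real ^ 'n"
  assumes lat: "\<zeta> \<in> int_lattice" and d: "0 < d" "2 * d < r" and l: "0 < l" and c: "0 \<le> c"
    and Q: "d \<le> norm (Q p - \<zeta>)" "norm (Q p - \<zeta>) \<le> r - d"
    and mod: "\<And>x. \<bar>x - p\<bar> \<le> l \<Longrightarrow> norm (Q x - Q p) \<le> d / 2"
  shows "ennreal (c * (c0 * (d / 2)\<^sup>2) * (2 * l)) \<le> pot (\<lambda>x. c * indicator {p - l..p + l} x) Q"
proof -
  have "c * (c0 * (d / 2)\<^sup>2) \<le> c * indicator {p - l..p + l} x * W (Q x)" if x: "x \<in> {p - l..p + l}" for x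
  proof -
    have "norm (Q x - Q p) \<le> d / 2"
      using x by (intro mod) (auto simp: abs_le_iff)
    then have "d / 2 \<le> norm (Q x - \<zeta>)" "norm (Q x - \<zeta>) < r"
      using Q norm_triangle_ineq[of "Q x - Q p" "Q p - \<zeta>"] norm_triangle_ineq[of "Q p - Q x" "Q x - \<zeta>"] d
      by (auto simp: norm_minus_commute)
    then have "c0 * (d / 2)\<^sup>2 \<le> c0 * (norm (Q x - \<zeta>))\<^sup>2" "c0 * (norm (Q x - \<zeta>))\<^sup>2 \<le> W (Q x)"
      using d c0 W_quadratic_lattice[OF lat] by (auto intro!: mult_left_mono power_mono)
    then show ?thesis
      using x c by (auto intro: mult_left_mono)
  qed
  moreover have "0 \<le> c * (c0 * (d / 2)\<^sup>2)"
    using c c0 by simp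
  ultimately show ?thesis
    using pot_interval_lower[of "p - l" "p + l" "c * (c0 * (d / 2)\<^sup>2)" "\<lambda>x. c * indicator {p - l..p + l} x" Q] l
    by simp
qed

text \<open>A point where \<open>Q\<close> is at distance at least \<open>\<tau>\<close> from
  \<open>\<zeta>\<close> carries a fixed amount of potential in its neighbourhood, which is
  impossible far out because the tails of a finite integral tend to \<open>0\<close>. Assuming
  closeness only on a unit neighbourhood lets the same statement serve both ends of the
  line.\<close>

lemma tail_limit:
  fixes Q :: "real \<Rightarrow> real ^ 'n"
  assumes Q: "continuous_on UNIV Q" "interaction UNIV Q \<le> ennreal B" "0 \<le> B" "pot (\<lambda>_. 1) Q < \<infinity>"
    and lat: "\<zeta> \<in> int_lattice" and \<tau>: "0 < \<tau>"
  obtains Y where "\<And>x. Y \<le> \<bar>x\<bar> \<Longrightarrow> (\<And>y. \<bar>y - x\<bar> \<le> 1 \<Longrightarrow> norm (Q y - \<zeta>) \<le> r / 2) \<Longrightarrow> norm (Q x - \<zeta>) < \<tau>"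
proof -
  \<comment> \<open>\<open>d \<le> r / 4\<close> gives \<open>r / 2 \<le> r - d\<close>, the outer
    bound required by \<open>contact_cost\<close>. Below, \<open>l \<le> 1\<close> keeps the
    interval around \<open>x\<close> inside the tail
    \<open>real m \<le> \<bar>y\<bar>\<close>.\<close>
  define d where "d = min \<tau> (r / 4)"
  have d: "0 < d" "d \<le> \<tau>" "2 * d < r" "d \<le> r / 4"
    using \<tau> r by (auto simp: d_def)
  obtain l0 where l0: "0 < l0" "\<And>x y. \<bar>x - y\<bar> \<le> l0 \<Longrightarrow> norm (Q x - Q y) \<le> d / 2"
    using modulus_of_continuity[of "d / 2" B] d Q by (metis half_gt_zero)
  define l where "l = min l0 1"
  have l: "0 < l" "l \<le> l0" "l \<le> 1" using l0 by (auto simp: l_def)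
  define \<delta> where "\<delta> = 1 * (c0 * (d / 2)\<^sup>2) * (2 * l)"
  have \<delta>: "0 < \<delta>"
    using c0 d l by (simp add: \<delta>_def)
  have [measurable]: "Q \<in> borel_measurable borel"
    using Q(1) by (rule borel_measurable_continuous_onI)
  have [measurable]: "{x :: real. real m \<le> \<bar>x\<bar>} \<in> sets borel" for m
    by (intro borel_closed closed_Collect_le continuous_intros)
  have "(\<lambda>m. pot (indicator {x. real m \<le> \<bar>x\<bar>}) Q) \<longlonglongrightarrow> (\<integral>\<^sup>+x. 0 \<partial>(lborel :: real measure))"
    unfolding pot_def
  proof (rule nn_integral_dominated_convergence[where w = "\<lambda>x. ennreal (1 * W (Q x))"])
    show "AE x in lborel. ennreal (indicator {x. real m \<le> \<bar>x\<bar>} x * W (Q x)) \<le> ennreal (1 * W (Q x))" for m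
      using W_nonneg by (intro AE_I2) (auto simp: indicator_def)
    show "AE x in lborel. (\<lambda>m. ennreal (indicator {x. real m \<le> \<bar>x\<bar>} x * W (Q x))) \<longlonglongrightarrow> 0"
    proof (rule AE_I2)
      fix x :: real
      have "eventually (\<lambda>m. \<bar>x\<bar> < real m) sequentially"
        using filterlim_real_sequentially by (auto simp: filterlim_at_top_dense)
      then have "eventually (\<lambda>m. ennreal (indicator {x. real m \<le> \<bar>x\<bar>} x * W (Q x)) = 0) sequentially"
        by eventually_elim simp
      then show "(\<lambda>m. ennreal (indicator {x. real m \<le> \<bar>x\<bar>} x * W (Q x))) \<longlonglongrightarrow> 0"
        by (rule tendsto_eventually)
    qed
  qed (use Q(4) in \<open>auto simp: pot_def\<close>)
  then have "eventually (\<lambda>m. pot (indicator {x. real m \<le> \<bar>x\<bar>}) Q < ennreal \<delta>) sequentially"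
    using \<delta> by (intro order_tendstoD(2)) auto
  then obtain m where m: "pot (indicator {x. real m \<le> \<bar>x\<bar>}) Q < ennreal \<delta>"
    by (auto simp: eventually_sequentially)
  show ?thesis
  proof (rule that[of "real m + 1"], rule ccontr)
    fix x
    assume x: "real m + 1 \<le> \<bar>x\<bar>" and near: "\<And>y. \<bar>y - x\<bar> \<le> 1 \<Longrightarrow> norm (Q y - \<zeta>) \<le> r / 2"
      and neg: "\<not> norm (Q x - \<zeta>) < \<tau>"
    have "ennreal \<delta> \<le> pot (\<lambda>y. 1 * indicator {x - l..x + l} y) Q"
      unfolding \<delta>_def
    proof (rule contact_cost[OF lat d(1,3) l(1)])
      show "norm (Q x - \<zeta>) \<le> r - d"
        using near[of x] d by simp
      show "norm (Q y - Q x) \<le> d / 2" if "\<bar>y - x\<bar> \<le> l" for y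
        using that l by (intro l0) auto
    qed (use neg d in auto)
    also have "\<dots> \<le> pot (indicator {x. real m \<le> \<bar>x\<bar>}) Q"
      using x l by (intro pot_mono) (auto simp: indicator_def)
    finally show False
      using m by simp
  qed
qed

lemma cos_well_estimates:
  fixes \<epsilon> :: real
  assumes "0 < \<epsilon>" and T: "T = 2 * pi / \<epsilon>"
  shows "\<bar>x - real i * T\<bar> \<le> T / 4 \<Longrightarrow> 0 \<le> cos (\<epsilon> * x)"
    and "cos (\<epsilon> * (real i * T)) = 1"
    and "cos (\<epsilon> * (x + (2 * real i - 1) * T / 2)) = - cos (\<epsilon> * x)"
    and "\<bar>cos (\<epsilon> * x) - cos (\<epsilon> * y)\<bar> \<le> \<epsilon> * \<bar>x - y\<bar>"
proof -
  have eT: "\<epsilon> * T = 2 * pi"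
    using assms by simp
  have per: "cos (\<epsilon> * (x + real i * T)) = cos (\<epsilon> * x)" for x
  proof -
    have "\<epsilon> * (x + real i * T) = \<epsilon> * x + real i * (\<epsilon> * T)"
      by (simp add: algebra_simps)
    also have "\<dots> = \<epsilon> * x + 2 * real i * pi"
      by (simp add: eT)
    finally show ?thesis
      by (simp add: cos_add)
  qed
  show "0 \<le> cos (\<epsilon> * x)" if "\<bar>x - real i * T\<bar> \<le> T / 4"
  proof -
    have "\<bar>\<epsilon> * (x - real i * T)\<bar> \<le> \<epsilon> * (T / 4)"
      using that assms(1) by (simp add: abs_mult)
    also have "\<dots> = pi / 2"
      using eT by simp
    finally have "0 \<le> cos (\<epsilon> * (x - real i * T))"
      by (intro cos_ge_zero) (auto simp: abs_le_iff)
    then show ?thesis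
      using per[of "x - real i * T"] by simp
  qed
  show "cos (\<epsilon> * (real i * T)) = 1"
    using per[of 0] by simp
  show "cos (\<epsilon> * (x + (2 * real i - 1) * T / 2)) = - cos (\<epsilon> * x)"
  proof -
    have "\<epsilon> * (x + (2 * real i - 1) * T / 2) = \<epsilon> * ((x - T / 2) + real i * T)"
      by (simp add: field_simps)
    then have "cos (\<epsilon> * (x + (2 * real i - 1) * T / 2)) = cos (\<epsilon> * (x - T / 2))"
      using per by metis
    also have "\<epsilon> * (x - T / 2) = \<epsilon> * x - pi"
      using eT by (simp add: algebra_simps)
    finally show ?thesis
      by (simp add: cos_diff)
  qed
  show "\<bar>cos (\<epsilon> * x) - cos (\<epsilon> * y)\<bar> \<le> \<epsilon> * \<bar>x - y\<bar>"
  proof -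
    have "norm (cos (\<epsilon> * x) - cos (\<epsilon> * y)) \<le> 1 * norm (\<epsilon> * x - \<epsilon> * y)"
    proof (rule differentiable_bound[of UNIV cos "\<lambda>x h. - sin x * h"])
      fix u :: real
      show "(cos has_derivative (\<lambda>h. - sin u * h)) (at u within UNIV)"
        by (auto intro!: derivative_eq_intros)
      show "onorm (\<lambda>h. - sin u * h) \<le> 1"
        by (intro onorm_le) (auto simp: abs_mult mult_left_le_one_le)
    qed auto
    then show ?thesis
      using assms(1) by (simp add: right_diff_distrib[symmetric] abs_mult)
  qed
qed

text \<open>\<open>Q\<close> satisfies the constraints strictly, while its competitors range over
  the closed ones. This gap is what makes small compactly supported perturbations of
  \<open>Q\<close> admissible.\<close>

definition interior_minimizer ::
  "nat \<Rightarrow> real \<Rightarrow> (real \<Rightarrow> real) \<Rightarrow> (nat \<Rightarrow> real ^ 'n) \<Rightarrow> (real \<Rightarrow> real ^ 'n) \<Rightarrow> bool" where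
  "interior_minimizer N T a \<zeta> Q \<longleftrightarrow> continuous_on UNIV Q \<and> action a Q < \<infinity> \<and>
     (\<forall>i\<in>{1..N}. \<forall>x\<in>plateau N T i. norm (Q x - \<zeta> i) < r / 2) \<and>
     (\<forall>P. continuous_on UNIV P \<longrightarrow> (\<forall>i\<in>{1..N}. \<forall>x\<in>plateau N T i. norm (P x - \<zeta> i) \<le> r / 2) \<longrightarrow>
        action a Q \<le> action a P)"

text \<open>The constants are chosen in the order \<open>B\<close>, \<open>l\<close>,
  \<open>w\<close>, \<open>\<mu>\<close>, \<open>q\<close>, \<open>\<sigma>\<close>,
  \<open>D\<close>, and \<open>\<epsilon>\<close> last. The upper bound exceeds \<open>n * m\<close>
  by at most \<open>3 * n * \<mu>\<close> and the \<open>n\<close> cells lose at most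
  \<open>n * \<mu>\<close>, while a contact adds \<open>w\<close>, which is at least
  \<open>8 * n * \<mu>\<close>: a contradiction. The jump \<open>v\<close> is that of
  \<open>q\<close>, so one \<open>v\<close> serves all small \<open>\<epsilon>\<close>.\<close>

lemma multibump_minimizer:
  fixes a1 a2 :: real and N :: nat and \<zeta>\<^sub>1 :: "real ^ 'n"
  assumes a: "0 < a2" "a2 < a1" and \<zeta>\<^sub>1: "\<zeta>\<^sub>1 \<in> int_lattice" and N: "2 \<le> N"
  shows "\<exists>v\<in>int_lattice. v \<noteq> 0 \<and> (\<forall>\<^sub>F \<epsilon> in at_right 0. 6 \<le> 2 * pi / \<epsilon> \<and> (\<exists>Q. interior_minimizer N (2 * pi / \<epsilon>) (\<lambda>x. a1 + a2 * cos (\<epsilon> * x)) (\<lambda>i. \<zeta>\<^sub>1 + (real i - 1) *\<^sub>R v) Q))"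
proof -
  define n where "n = N - 1"
  define c where "c = a1 - a2"
  define m where "m = enn2real (layer_cost c)"
  have n: "1 \<le> n" "N = n + 1" and c: "0 < c"
    using N a by (auto simp: n_def c_def)
  have m: "layer_cost c = ennreal m" "0 \<le> m"
    using layer_cost_finite[of c] c by (auto simp: m_def)
  \<comment> \<open>A bound for the action of the minimizer that is available before
    \<open>\<mu>\<close> is chosen; it suffices because \<open>3 * \<mu> \<le> 1\<close>.\<close>
  define B where "B = real n * (m + 1)"
  define B' where "B' = max B (B / c)"
  have B: "0 \<le> B" "0 \<le> B'" "B \<le> B'" "B / c \<le> B'"
    using m c by (auto simp: B_def B'_def le_max_iff_disj)
  define d' where "d' = r / 4"
  have d': "0 < d'" "2 * d' < r"
    using r by (auto simp: d'_def)
  obtain l where l: "0 < l"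
    "\<And>(Q :: real \<Rightarrow> real ^ 'n) x y. continuous_on UNIV Q \<Longrightarrow> interaction UNIV Q \<le> ennreal B' \<Longrightarrow>
       \<bar>x - y\<bar> \<le> l \<Longrightarrow> norm (Q x - Q y) \<le> d' / 2"
    using modulus_of_continuity[of "d' / 2" B'] d' B by (metis half_gt_zero)
  \<comment> \<open>The weight spent on a contact has to fit under \<open>a\<close> together with
    the weight \<open>c\<close> of the cells: inside the cells only the excess \<open>a2 / 2\<close>
    is available, outside them all of \<open>a\<close>, which is at least \<open>c\<close>.\<close>
  define \<kappa> where "\<kappa> = min (a2 / 2) c"
  have \<kappa>: "0 < \<kappa>" "\<kappa> \<le> a2 / 2" "\<kappa> \<le> c"
    using a c by (auto simp: \<kappa>_def)
  define w where "w = \<kappa> * (c0 * (d' / 2)\<^sup>2) * (2 * l)"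
  have w: "0 < w"
    using \<kappa> c0 d' l by (simp add: w_def)
  define \<mu> where "\<mu> = min (w / (8 * real n)) (1 / 4)"
  have \<mu>: "0 < \<mu>" "8 * real n * \<mu> \<le> w" "\<mu> \<le> 1 / 4"
  proof -
    show "0 < \<mu>" "\<mu> \<le> 1 / 4" using w n by (auto simp: \<mu>_def)
    have "\<mu> \<le> w / (8 * real n)" by (simp add: \<mu>_def)
    then show "8 * real n * \<mu> \<le> w"
      using n by (simp add: pos_le_divide_eq mult.commute)
  qed
  have "layer_cost c < ennreal (m + \<mu>)"
    using m \<mu> by (simp add: ennreal_lessI)
  then obtain q where q: "q \<in> layers" "action (\<lambda>_. c) q < ennreal (m + \<mu>)"
    unfolding layer_cost_def by (auto simp: INF_less_iff)
  from q(1) obtain \<eta> \<eta>' R0 where qc: "continuous_on UNIV q" and \<eta>: "\<eta> \<in> int_lattice" "\<eta>' \<in> int_lattice" "\<eta> \<noteq> \<eta>'"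
    and R0: "\<And>x. x \<le> - R0 \<Longrightarrow> q x = \<eta>" "\<And>x. R0 \<le> x \<Longrightarrow> q x = \<eta>'"
    unfolding layers_def by blast
  define R where "R = max R0 1"
  have R: "1 \<le> R" "\<And>x. x \<le> - R \<Longrightarrow> q x = \<eta>" "\<And>x. R \<le> x \<Longrightarrow> q x = \<eta>'"
    using R0 by (auto simp: R_def)
  have qm[measurable]: "q \<in> borel_measurable borel"
    using qc by (rule borel_measurable_continuous_onI)
  have q_fin: "interaction UNIV q < \<infinity>" "pot (\<lambda>_. c) q < \<infinity>"
    using q(2) by (auto simp: action_def dest: order.strict_trans[OF _ ennreal_less_top])
  have "pot (\<lambda>_. c) q = ennreal c * pot (\<lambda>_. 1) q"
    using pot_cmult[OF qm, of "\<lambda>_. 1" c] c by simp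
  then have q_pot: "pot (\<lambda>_. 1) q < \<infinity>"
    using q_fin(2) c by (auto simp: ennreal_mult_less_top)
  define V where "V = enn2real (pot (\<lambda>_. 1) q)"
  have V: "pot (\<lambda>_. 1) q = ennreal V" "0 \<le> V"
    using q_pot by (auto simp: V_def)
  \<comment> \<open>Near its minima \<open>a\<close> exceeds \<open>c\<close> slightly; an excess of
    \<open>\<sigma>\<close> adds at most \<open>\<mu>\<close> to the action of
    \<open>q\<close>.\<close>
  define \<sigma> where "\<sigma> = \<mu> / (V + 1)"
  have \<sigma>: "0 < \<sigma>" "\<sigma> * V \<le> \<mu>"
    using \<mu> V(2) by (auto simp: \<sigma>_def field_simps)
  have q_up: "action (\<lambda>_. c + \<sigma>) q \<le> ennreal (m + 2 * \<mu>)"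
  proof -
    have "action (\<lambda>_. c + \<sigma>) q = action (\<lambda>_. c) q + ennreal (\<sigma> * V)"
      unfolding action_def
      using pot_add[OF qm, of "\<lambda>_. c" "\<lambda>_. \<sigma>"] pot_cmult[OF qm, of "\<lambda>_. 1" \<sigma>] \<sigma> c V
      by (simp add: ennreal_mult add.assoc)
    also have "\<dots> \<le> ennreal (m + \<mu>) + ennreal \<mu>"
      using q(2) \<sigma> by (intro add_mono ennreal_leI) auto
    also have "\<dots> = ennreal (m + 2 * \<mu>)"
      using m \<mu> by (simp add: ennreal_plus[symmetric] del: ennreal_plus)
    finally show ?thesis .
  qed
  obtain D where D: "0 < D"
    "\<And>Q u v h \<zeta> \<zeta>'. continuous_on UNIV Q \<Longrightarrow> interaction UNIV Q \<le> ennreal B' \<Longrightarrow> pot (\<lambda>_. 1) Q \<le> ennreal B' \<Longrightarrow>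
      \<zeta> \<in> int_lattice \<Longrightarrow> \<zeta>' \<in> int_lattice \<Longrightarrow> \<zeta> \<noteq> \<zeta>' \<Longrightarrow> D \<le> h \<Longrightarrow> u + h \<le> v - h \<Longrightarrow>
      (\<And>x. x \<in> {u..u + h} \<Longrightarrow> norm (Q x - \<zeta>) < r) \<Longrightarrow> (\<And>x. x \<in> {v - h..v} \<Longrightarrow> norm (Q x - \<zeta>') < r) \<Longrightarrow>
      layer_cost c \<le> interaction {u..v} Q + pot (\<lambda>x. c * indicator {u..v} x) Q + ennreal \<mu>"
    using cell_cost[OF c B(2) \<mu>(1)] by blast
  define v where "v = \<eta>' - \<eta>"
  have v: "v \<in> int_lattice" "v \<noteq> 0"
    using lattice_add[OF \<eta>(2) lattice_uminus[OF \<eta>(1)]] \<eta>(3) by (auto simp: v_def)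
  have T_top: "LIM \<epsilon> at_right 0. 2 * pi / \<epsilon> :> at_top"
    unfolding divide_inverse
    by (rule filterlim_tendsto_pos_mult_at_top[OF tendsto_const _ filterlim_inverse_at_top_right]) simp
  have "eventually (\<lambda>D. far_interaction D q < ennreal (\<mu> / real n)) at_top"
    using \<mu> n by (intro order_tendstoD(2)[OF far_interaction_tendsto_0[OF qm q_fin(1)]]) auto
  then obtain D1 where D1: "\<And>D. D1 \<le> D \<Longrightarrow> far_interaction D q < ennreal (\<mu> / real n)"
    by (auto simp: eventually_at_top_linorder)
  \<comment> \<open>In this order: consecutive \<open>b i\<close> will be \<open>3\<close> apart;
    transitions of radius \<open>R\<close> fit between the plateaus; half a plateau is long enough
    for \<open>cell_cost\<close>; the far interaction of \<open>q\<close> is below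
    \<open>\<mu> / n\<close>.\<close>
  have evT: "\<forall>\<^sub>F \<epsilon> in at_right 0. max (max 6 (4 * R)) (max (4 * D) (D1 + 2 * R)) \<le> 2 * pi / \<epsilon>"
    using T_top unfolding filterlim_at_top by blast
  \<comment> \<open>The first bound makes \<open>a \<le> c + \<sigma>\<close> within distance
    \<open>R\<close> of a minimum; the second makes \<open>cos (\<epsilon> * x)\<close> change by at
    most \<open>1/2\<close> over a length \<open>l\<close>.\<close>
  have ev\<epsilon>: "\<forall>\<^sub>F \<epsilon> in at_right (0::real). 0 < \<epsilon> \<and> \<epsilon> < min (\<sigma> / (a2 * R)) (1 / (2 * l))"
  proof -
    have "0 < min (\<sigma> / (a2 * R)) (1 / (2 * l))"
      using \<sigma>(1) a(1) R(1) l(1) by simp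
    from eventually_at_right_real[OF this] show ?thesis
      by eventually_elim auto
  qed
  have "\<forall>\<^sub>F \<epsilon> in at_right 0. 6 \<le> 2 * pi / \<epsilon> \<and> (\<exists>Q. interior_minimizer N (2 * pi / \<epsilon>) (\<lambda>x. a1 + a2 * cos (\<epsilon> * x)) (\<lambda>i. \<zeta>\<^sub>1 + (real i - 1) *\<^sub>R v) Q)"
    using evT ev\<epsilon>
  proof eventually_elim
    case (elim \<epsilon>)
    define T where "T = 2 * pi / \<epsilon>"
    define J where "J = plateau N T"
    define A where "A = (\<lambda>x. a1 + a2 * cos (\<epsilon> * x))"
    define \<zeta> where "\<zeta> = (\<lambda>i::nat. \<zeta>\<^sub>1 + (real i - 1) *\<^sub>R v)"
    have T: "6 \<le> T" "4 * R \<le> T" "4 * D \<le> T" "D1 \<le> T - 2 * R" "0 < T"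
      using elim(1) by (auto simp: T_def[symmetric])
    have \<epsilon>: "0 < \<epsilon>" "\<epsilon> * (a2 * R) \<le> \<sigma>" "\<epsilon> * l \<le> 1 / 2"
      using elim(2) a R l by (auto simp: field_simps)
    note cw = cos_well_estimates[OF \<epsilon>(1) T_def]
    have A_cont: "continuous_on UNIV A"
      unfolding A_def by (intro continuous_intros)
    have Am[measurable]: "A \<in> borel_measurable borel"
      using A_cont by (rule borel_measurable_continuous_onI)
    have A_ge: "c \<le> A x" for x
    proof -
      have "a2 * (-1) \<le> a2 * cos (\<epsilon> * x)"
        using a by (intro mult_left_mono) auto
      then show ?thesis by (simp add: A_def c_def)
    qed
    have lat: "\<zeta> i \<in> int_lattice" if "1 \<le> i" for i
      using lattice_add[OF \<zeta>\<^sub>1 lattice_scale[OF v(1), of "i - 1"]] that by (simp add: \<zeta>_def of_nat_diff)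
    have \<zeta>_ne: "\<zeta> i \<noteq> \<zeta> (i + 1)" for i
      using v(2) by (simp add: \<zeta>_def algebra_simps)
    define P where "P = (\<lambda>x. \<zeta>\<^sub>1 + (\<Sum>i\<in>{1..n}. q (x - (2 * real i - 1) * T / 2) - \<eta>))"
    have well: "A (x + (2 * real i - 1) * T / 2) \<le> c + \<sigma>" if "\<bar>x\<bar> \<le> R" for i :: nat and x
    proof -
      have "1 - cos (\<epsilon> * x) \<le> \<epsilon> * \<bar>x\<bar>"
        using cw(4)[of 0 x] by simp
      also have "\<dots> \<le> \<epsilon> * R"
        using that \<epsilon> by (intro mult_left_mono) auto
      finally have "a2 * (1 - cos (\<epsilon> * x)) \<le> a2 * (\<epsilon> * R)"
        using a by (intro mult_left_mono) auto
      also have "\<dots> \<le> \<sigma>"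
        using \<epsilon>(2) by (simp add: mult_ac)
      finally show ?thesis
        unfolding A_def cw(3) by (simp add: c_def algebra_simps)
    qed
    have A0: "0 \<le> A x" for x
      using A_ge[of x] c by simp
    have T2R: "2 * R \<le> T" using T R by linarith
    note chain = chain_upper_bound[OF qc \<zeta>\<^sub>1 \<eta>(1,2) R(2,3) T(5) T2R Am A0 well P_def]
    have P_cont: "continuous_on UNIV P"
      by (rule chain(1)) auto
    have P_J: "P x = \<zeta> i" if "i \<in> {1..N}" "x \<in> J i" for i x
      unfolding \<zeta>_def v_def
      using that n T by (intro chain(2)) (auto simp: J_def plateau_def)
    have "action A P \<le> of_nat n * (action (\<lambda>_. c + \<sigma>) q + of_nat n * far_interaction (T - 2 * R) q)"
      by (rule chain(3)) auto
    also have "\<dots> \<le> of_nat n * (ennreal (m + 2 * \<mu>) + of_nat n * ennreal (\<mu> / real n))"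
      by (intro mult_left_mono add_mono q_up less_imp_le[OF D1] T) auto
    also have "\<dots> = ennreal (real n * (m + 3 * \<mu>))"
    proof -
      have "of_nat n * ennreal (\<mu> / real n) = ennreal \<mu>"
        using n \<mu> by (simp add: ennreal_of_nat_eq_real_of_nat ennreal_mult[symmetric])
      then show ?thesis
        using m \<mu> by (simp add: ennreal_of_nat_eq_real_of_nat ennreal_mult[symmetric] ennreal_plus[symmetric] del: ennreal_plus)
    qed
    finally have P_action: "action A P \<le> ennreal (real n * (m + 3 * \<mu>))" .
    \<comment> \<open>The constraints as one closed set per point; off the plateaus the index set is
      empty and \<open>S x\<close> is the whole space. The point \<open>0\<close> lies on the first
      plateau and provides the bounded constraint that \<open>minimizer_exists\<close>
      requires.\<close>
    define S where "S x = (\<Inter>i\<in>{i\<in>{1..N}. x \<in> J i}. cball (\<zeta> i) (r / 2))" for x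
    have S_iff: "(\<forall>x. F x \<in> S x) \<longleftrightarrow> (\<forall>i\<in>{1..N}. \<forall>x\<in>J i. norm (F x - \<zeta> i) \<le> r / 2)" for F
      by (auto simp: S_def dist_norm norm_minus_commute)
    have S_closed: "closed (S x)" for x
      unfolding S_def by (intro closed_INT) auto
    have S_bdd: "bounded (S 0)"
    proof (rule bounded_subset)
      have "0 \<in> J 1"
        using T N by (auto simp: J_def plateau_def)
      then show "S 0 \<subseteq> cball (\<zeta> 1) (r / 2)"
        using N by (auto simp: S_def)
    qed simp
    have P_S: "P x \<in> S x" for x
      using S_iff[of P] P_J r by auto
    have "action A P < \<infinity>"
      using P_action by (rule le_less_trans) simp
    then obtain Q where Q: "continuous_on UNIV Q" "\<And>x. Q x \<in> S x"
      "\<And>F. continuous_on UNIV F \<Longrightarrow> (\<And>x. F x \<in> S x) \<Longrightarrow> action A Q \<le> action A F"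
      using minimizer_exists[OF Am c A_ge S_closed S_bdd P_cont P_S] by blast
    have Q_action: "action A Q \<le> ennreal (real n * (m + 3 * \<mu>))"
      using Q(3)[OF P_cont P_S] P_action by (rule order_trans)
    have Qm[measurable]: "Q \<in> borel_measurable borel"
      using Q(1) by (rule borel_measurable_continuous_onI)
    have Q_B: "action A Q \<le> ennreal B"
      using \<mu> n by (intro order_trans[OF Q_action] ennreal_leI) (auto simp: B_def intro!: mult_left_mono)
    have en: "interaction UNIV Q \<le> ennreal B'" "pot (\<lambda>_. 1) Q \<le> ennreal B'"
      using pot_le_action[OF Qm c A_ge Q_B B(1)] B by (auto intro: order_trans ennreal_leI)
    have Q_J: "norm (Q x - \<zeta> i) \<le> r / 2" if "i \<in> {1..N}" "x \<in> J i" for i x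
      using S_iff[of Q] Q(2) that by blast
    have strict: "norm (Q p - \<zeta> i) < r / 2" if i: "i \<in> {1..N}" and p: "p \<in> J i" for i p
    proof (rule ccontr)
      assume neg: "\<not> norm (Q p - \<zeta> i) < r / 2"
      \<comment> \<open>A cell runs from the centre \<open>j * T\<close> of plateau
        \<open>j + 1\<close> to the centre of plateau \<open>j + 2\<close>, so its outer quarters
        lie in these plateaus, where \<open>Q\<close> is within \<open>r / 2\<close> of two distinct
        lattice points.\<close>
      define C where "C j = {real j * T..(real j + 1) * T}" for j :: nat
      have cell: "ennreal m \<le> interaction (C j) Q + pot (\<lambda>x. c * indicator (C j) x) Q + ennreal \<mu>" if j: "j < n" for j
        unfolding C_def m(1)[symmetric]
      proof (rule D(2)[OF Q(1) en lat[of "j + 1"] lat[of "j + 2"], of "T / 4"])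
        show "\<zeta> (j + 1) \<noteq> \<zeta> (j + 2)"
          using \<zeta>_ne[of "j + 1"] by simp
        show "D \<le> T / 4" using T by simp
        show "real j * T + T / 4 \<le> (real j + 1) * T - T / 4"
          using T by (simp add: algebra_simps)
        show "norm (Q x - \<zeta> (j + 1)) < r" if x: "x \<in> {real j * T..real j * T + T / 4}" for x
        proof -
          have "x \<in> J (j + 1)"
            using x T j n by (auto simp: J_def plateau_def field_simps)
          then have "norm (Q x - \<zeta> (j + 1)) \<le> r / 2"
            using j n by (intro Q_J) auto
          then show ?thesis using r by simp
        qed
        show "norm (Q x - \<zeta> (j + 2)) < r" if x: "x \<in> {(real j + 1) * T - T / 4..(real j + 1) * T}" for x
        proof -
          have "x \<in> J (j + 2)"
            using x T j n by (auto simp: J_def plateau_def field_simps)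
          then have "norm (Q x - \<zeta> (j + 2)) \<le> r / 2"
            using j n by (intro Q_J) auto
          then show ?thesis using r by simp
        qed
      qed auto
      \<comment> \<open>At a contact the distance to \<open>\<zeta> i\<close> is exactly
        \<open>r / 2\<close>, well inside the range from \<open>d' = r / 4\<close> to
        \<open>r - d'\<close>.\<close>
      have touch: "ennreal w \<le> pot (\<lambda>x. \<kappa> * indicator {p - l..p + l} x) Q"
        unfolding w_def
      proof (rule contact_cost[OF lat[of i] d' l(1)])
        show "d' \<le> norm (Q p - \<zeta> i)" "norm (Q p - \<zeta> i) \<le> r - d'"
          using neg Q_J[OF i p] r by (auto simp: d'_def)
        show "norm (Q x - Q p) \<le> d' / 2" if "\<bar>x - p\<bar> \<le> l" for x
          using that by (rule l(2)[OF Q(1) en(1)])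
      qed (use \<kappa> i in auto)
      \<comment> \<open>Neighbouring cells share an end point, hence the exceptional set.\<close>
      have sum_le: "(\<Sum>j<n. c * indicator (C j) x) \<le> c" if x: "x \<notin> (\<lambda>j. real j * T) ` {..n}" for x
      proof (rule sum_at_most_one_le)
        fix i j
        assume ij: "i < n" "j < n" and nz: "c * indicator (C i) x \<noteq> 0" "c * indicator (C j) x \<noteq> 0"
        then have xC: "x \<in> C i" "x \<in> C j"
          by (auto simp: indicator_def split: if_splits)
        show "i = j"
        proof (rule ccontr)
          assume "i \<noteq> j"
          then consider "real i + 1 \<le> real j" | "real j + 1 \<le> real i" by linarith
          then have "(real i + 1) * T \<le> real j * T \<or> (real j + 1) * T \<le> real i * T"
            using T by (meson less_imp_le mult_right_mono)
          with xC have "x = real i * T \<or> x = real j * T"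
            by (auto simp: C_def)
          with x ij show False
            by (auto simp: image_iff)
        qed
      qed (use c in \<open>auto simp: indicator_def\<close>)
      \<comment> \<open>The pointwise core of the contradiction: the weight \<open>c\<close> used on
        the cells and the weight \<open>\<kappa>\<close> used at the contact fit together under the
        true weight.\<close>
      have weight: "(\<Sum>j<n. c * indicator (C j) x) + \<kappa> * indicator {p - l..p + l} x \<le> A x"
        if x: "x \<notin> (\<lambda>j. real j * T) ` {..n}" for x
      proof (cases "x \<in> {p - l..p + l} \<and> (\<exists>j<n. x \<in> C j)")
        case True
        then obtain j where j: "j < n" "x \<in> C j" and in_l: "x \<in> {p - l..p + l}" by blast
        have range: "0 \<le> x" "x \<le> real n * T"
        proof -
          show "0 \<le> x" using j(2) T by (auto simp: C_def intro: order_trans[rotated])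
          have "(real j + 1) * T \<le> real n * T"
            using j(1) T by (intro mult_right_mono) auto
          then show "x \<le> real n * T" using j(2) by (simp add: C_def)
        qed
        \<comment> \<open>Some point within \<open>l\<close> of \<open>x\<close> has nonnegative
          cosine: \<open>p\<close> itself if it lies between \<open>0\<close> and
          \<open>n * T\<close>; otherwise \<open>p\<close> is on one of the outer half-lines, and
          the contact interval reaches a cell only across \<open>0\<close> or \<open>n * T\<close>,
          a maximum of the cosine.\<close>
        obtain y where y: "\<bar>x - y\<bar> \<le> l" "0 \<le> cos (\<epsilon> * y)"
        proof -
          consider "p < 0" | "real n * T < p" | "0 \<le> p" "p \<le> real n * T" by linarith
          then show thesis
          proof cases
            case 1
            then show thesis
              using that[of 0] in_l range by auto
          next
            case 2
            then show thesis
              using that[of "real n * T"] in_l range cw(2)[of n] by auto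
          next
            case 3
            have "\<bar>p - real (i - 1) * T\<bar> \<le> T / 4"
            proof -
              have pred: "real (i - 1) = real i - 1" using i by (simp add: of_nat_diff)
              have "(real i - 1) * T - T / 4 \<le> p"
                using p 3 T by (auto simp: J_def plateau_def field_simps)
              moreover have "p \<le> (real i - 1) * T + T / 4"
                using p 3 T n by (auto simp: J_def plateau_def field_simps)
              ultimately show ?thesis unfolding pred abs_le_iff by linarith
            qed
            from cw(1)[OF this] show thesis
              using that[of p] in_l by (auto simp: abs_le_iff)
          qed
        qed
        have "\<epsilon> * \<bar>x - y\<bar> \<le> \<epsilon> * l"
          using y \<epsilon> by (intro mult_left_mono) auto
        then have "- (1 / 2) \<le> cos (\<epsilon> * x)"
          using cw(4)[of x y] y(2) \<epsilon>(3) by linarith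
        then have "a2 * (- (1 / 2)) \<le> a2 * cos (\<epsilon> * x)"
          using a by (intro mult_left_mono) auto
        then have "c + a2 / 2 \<le> A x"
          by (simp add: A_def c_def)
        moreover have "\<kappa> * indicator {p - l..p + l} x \<le> a2 / 2"
          using in_l \<kappa> by simp
        ultimately show ?thesis
          using sum_le[OF x] by linarith
      next
        case False
        then consider "x \<notin> {p - l..p + l}" | "\<forall>j<n. x \<notin> C j" by blast
        then show ?thesis
        proof cases
          case 1
          then have "\<kappa> * indicator {p - l..p + l} x = 0" by simp
          then show ?thesis
            using sum_le[OF x] A_ge[of x] by linarith
        next
          case 2
          then have "(\<Sum>j<n. c * indicator (C j) x) = 0"
            by (intro sum.neutral) auto
          then show ?thesis
            using 2 \<kappa> A_ge[of x] A0[of x] by (auto simp: indicator_def)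
        qed
      qed
      have Cm[measurable]: "C j \<in> sets borel" for j
        by (simp add: C_def)
      have pots: "(\<Sum>j<n. pot (\<lambda>x. c * indicator (C j) x) Q) + pot (\<lambda>x. \<kappa> * indicator {p - l..p + l} x) Q \<le> pot A Q"
      proof -
        have "(\<Sum>j<n. pot (\<lambda>x. c * indicator (C j) x) Q) + pot (\<lambda>x. \<kappa> * indicator {p - l..p + l} x) Q
          = (\<integral>\<^sup>+x. (\<Sum>j<n. ennreal (c * indicator (C j) x * W (Q x))) + ennreal (\<kappa> * indicator {p - l..p + l} x * W (Q x)) \<partial>lborel)"
          unfolding pot_def by (simp add: nn_integral_add nn_integral_sum)
        also have "\<dots> \<le> pot A Q"
          unfolding pot_def
        proof (rule nn_integral_mono_AE)
          have "AE x in lborel. x \<notin> (\<lambda>j. real j * T) ` {..n}"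
            by (intro AE_not_in finite_imp_null_set_lborel) auto
          then show "AE x in lborel. (\<Sum>j<n. ennreal (c * indicator (C j) x * W (Q x))) + ennreal (\<kappa> * indicator {p - l..p + l} x * W (Q x))
             \<le> ennreal (A x * W (Q x))"
          proof eventually_elim
            case (elim x)
            have "(\<Sum>j<n. ennreal (c * indicator (C j) x * W (Q x))) = ennreal (\<Sum>j<n. c * indicator (C j) x * W (Q x))"
              using c W_nonneg by (intro sum_ennreal) auto
            then have "(\<Sum>j<n. ennreal (c * indicator (C j) x * W (Q x))) + ennreal (\<kappa> * indicator {p - l..p + l} x * W (Q x))
              = ennreal ((\<Sum>j<n. c * indicator (C j) x * W (Q x)) + \<kappa> * indicator {p - l..p + l} x * W (Q x))"
              using c \<kappa> W_nonneg by (simp add: ennreal_plus sum_nonneg)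
            also have "\<dots> \<le> ennreal (A x * W (Q x))"
              using mult_right_mono[OF weight[OF elim] W_nonneg[of "Q x"]]
              by (intro ennreal_leI) (simp only: sum_distrib_right distrib_right)
            finally show ?case .
          qed
        qed
        finally show ?thesis .
      qed
      have "ennreal (real n * m) = (\<Sum>j<n. ennreal m)"
        using m by (subst sum_ennreal) auto
      also have "\<dots> \<le> (\<Sum>j<n. interaction (C j) Q + pot (\<lambda>x. c * indicator (C j) x) Q + ennreal \<mu>)"
        by (intro sum_mono cell) auto
      also have "\<dots> = (\<Sum>j<n. interaction (C j) Q) + (\<Sum>j<n. pot (\<lambda>x. c * indicator (C j) x) Q) + ennreal (real n * \<mu>)"
        using \<mu> by (simp add: sum.distrib ennreal_of_nat_eq_real_of_nat ennreal_mult)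
      finally have 1: "ennreal (real n * m) \<le> \<dots>" .
      have "ennreal (real n * m + w) = ennreal (real n * m) + ennreal w"
        using m w by (simp add: ennreal_plus)
      also have "\<dots> \<le> (\<Sum>j<n. interaction (C j) Q) + (\<Sum>j<n. pot (\<lambda>x. c * indicator (C j) x) Q) + ennreal (real n * \<mu>)
        + pot (\<lambda>x. \<kappa> * indicator {p - l..p + l} x) Q"
        by (intro add_mono 1 touch)
      also have "\<dots> = (\<Sum>j<n. interaction (C j) Q) + ((\<Sum>j<n. pot (\<lambda>x. c * indicator (C j) x) Q)
        + pot (\<lambda>x. \<kappa> * indicator {p - l..p + l} x) Q) + ennreal (real n * \<mu>)"
        by (simp only: add_ac)
      also have "\<dots> \<le> interaction UNIV Q + pot A Q + ennreal (real n * \<mu>)"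
        unfolding C_def
        by (intro add_mono order_refl sum_interaction_cells_le Qm T pots[unfolded C_def])
      also have "\<dots> \<le> ennreal (real n * (m + 3 * \<mu>)) + ennreal (real n * \<mu>)"
        using Q_action by (intro add_mono order_refl) (simp add: action_def)
      also have "\<dots> = ennreal (real n * m + 4 * real n * \<mu>)"
        using m \<mu> by (simp add: ennreal_plus[symmetric] algebra_simps del: ennreal_plus)
      finally have "real n * m + w \<le> real n * m + 4 * real n * \<mu>"
        using m \<mu> by (subst (asm) ennreal_le_iff) auto
      with \<mu>(2) w show False by linarith
    qed
    have minQ: "action A Q \<le> action A F" if "continuous_on UNIV F" "\<forall>i\<in>{1..N}. \<forall>x\<in>J i. norm (F x - \<zeta> i) \<le> r / 2" for F
      using Q(3)[OF that(1)] S_iff[of F] that(2) by blast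
    have finQ: "action A Q < \<infinity>"
      using Q_B by (rule le_less_trans) simp
    show ?case
      unfolding interior_minimizer_def T_def[symmetric] A_def[symmetric] J_def[symmetric] \<zeta>_def[symmetric]
      using T(1) Q(1) finQ strict minQ by blast
  qed
  with v show ?thesis by blast
qed

end

section \<open>The weak solution\<close>

lemma plateau_closed: "closed (plateau N T i)"
  unfolding plateau_def
  by (intro closed_Collect_conj closed_Collect_disj closed_Collect_const closed_Collect_le continuous_intros)

text \<open>\<open>grad\<close> is a definite description, so the vector representing the derivative
  has to be shown to exist, from the values on the standard basis, and to be unique.\<close>

lemma has_derivative_grad:
  fixes W :: "real ^ 'n \<Rightarrow> real"
  assumes "W differentiable (at x)"
  shows "(W has_derivative (\<lambda>h. h \<bullet> grad W x)) (at x)"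
proof -
  obtain F where F: "(W has_derivative F) (at x)"
    using assms by (auto simp: differentiable_def)
  define D where "D = (\<Sum>b\<in>Basis. F b *\<^sub>R b)"
  have lin: "linear F"
    using F by (simp add: has_derivative_linear)
  have "F h = h \<bullet> D" for h
  proof -
    have "F h = F (\<Sum>b\<in>Basis. (h \<bullet> b) *\<^sub>R b)"
      by (simp only: euclidean_representation)
    also have "\<dots> = (\<Sum>b\<in>Basis. (h \<bullet> b) * F b)"
      using lin by (simp add: linear_sum linear_scale)
    also have "\<dots> = h \<bullet> D"
      by (simp add: D_def inner_sum_right mult.commute)
    finally show ?thesis .
  qed
  then have D: "GDERIV W x :> D"
    using F unfolding gderiv_def by (metis ext)
  have "D' = D" if "GDERIV W x :> D'" for D'
  proof -
    have "(\<lambda>h. h \<bullet> D') = (\<lambda>h. h \<bullet> D)"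
      using has_derivative_unique that D unfolding gderiv_def by blast
    then have "(D' - D) \<bullet> D' = (D' - D) \<bullet> D" by metis
    then have "(D' - D) \<bullet> (D' - D) = 0" by (simp add: inner_diff_right)
    then show ?thesis by simp
  qed
  then have grad: "grad W x = D"
    unfolding grad_def using D by (rule the_equality[rotated])
  show ?thesis
    using D unfolding grad gderiv_def .
qed

text \<open>Away from \<open>0\<close> the extended quotients are quotients of reals and
  \<open>K\<close> is finite. Borel measurability of the real kernel follows from its
  differentiability off the single point \<open>0\<close>.\<close>

lemma admissible_kernel_imp_kernel:
  assumes "admissible_kernel s K" "1/2 < s" "s < 1"
  shows "\<exists>\<rho> \<theta> \<Theta>. kernel (\<lambda>z. enn2real (K z)) s \<rho> \<theta> \<Theta>"
    and "z \<noteq> 0 \<Longrightarrow> K z = ennreal (enn2real (K z))"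
proof -
  from assms(1) obtain \<rho> \<theta> \<Theta> where par: "0 < \<rho>" "0 < \<theta>" "\<theta> \<le> \<Theta>"
    and low: "\<And>x. ennreal (\<theta> * (1 - s)) * indicator {- \<rho>..\<rho>} x / ennreal (\<bar>x\<bar> powr (1 + 2 * s)) \<le> K x"
    and up: "\<And>x. K x \<le> ennreal (\<Theta> * (1 - s)) / ennreal (\<bar>x\<bar> powr (1 + 2 * s))"
    unfolding admissible_kernel_def by blast
  from assms(1) have diff: "\<And>x. x \<noteq> 0 \<Longrightarrow> (\<lambda>y. enn2real (K y)) differentiable (at x)"
    unfolding admissible_kernel_def by blast
  have powr_eq: "t / \<bar>z\<bar> powr (1 + 2 * s) = t * \<bar>z\<bar> powr (- 1 - 2 * s)" if "z \<noteq> 0" for t z :: real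
    using powr_minus_divide[of "\<bar>z\<bar>" "1 + 2 * s"] by simp
  have up': "K z \<le> ennreal (\<Theta> * (1 - s) * \<bar>z\<bar> powr (- 1 - 2 * s))" if "z \<noteq> 0" for z
    using up[of z] that par assms powr_eq[of z "\<Theta> * (1 - s)"] by (simp add: divide_ennreal)
  have fin: "K z = ennreal (enn2real (K z))" if "z \<noteq> 0" for z
    using le_less_trans[OF up'[OF that] ennreal_less_top] by simp
  then show "z \<noteq> 0 \<Longrightarrow> K z = ennreal (enn2real (K z))" .
  have "kernel (\<lambda>z. enn2real (K z)) s \<rho> (\<theta> * (1 - s)) (\<Theta> * (1 - s))"
  proof
    show "(\<lambda>z. enn2real (K z)) \<in> borel_measurable borel"
    proof (rule borel_measurable_continuous_countable_exceptions[of "{0}"])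
      show "continuous_on (- {0}) (\<lambda>z. enn2real (K z))"
        using diff by (intro differentiable_imp_continuous_on)
          (auto simp: differentiable_on_def intro: differentiable_at_withinI)
    qed simp
    show "enn2real (K z) \<le> \<Theta> * (1 - s) * \<bar>z\<bar> powr (- 1 - 2 * s)" if "z \<noteq> 0" for z
      using up'[OF that] par assms by (intro enn2real_leI) auto
    show "\<theta> * (1 - s) * \<bar>z\<bar> powr (- 1 - 2 * s) \<le> enn2real (K z)" if "0 < \<bar>z\<bar>" "\<bar>z\<bar> \<le> \<rho>" for z
    proof -
      have z: "z \<noteq> 0" "z \<in> {- \<rho>..\<rho>}" using that by auto
      have "ennreal (\<theta> * (1 - s) * \<bar>z\<bar> powr (- 1 - 2 * s)) \<le> K z"
        using low[of z] z par assms powr_eq[OF z(1), of "\<theta> * (1 - s)"] by (simp add: divide_ennreal)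
      then have "ennreal (\<theta> * (1 - s) * \<bar>z\<bar> powr (- 1 - 2 * s)) \<le> ennreal (enn2real (K z))"
        using fin[OF z(1)] by simp
      then show ?thesis by simp
    qed
  qed (use par assms in auto)
  then show "\<exists>\<rho> \<theta> \<Theta>. kernel (\<lambda>z. enn2real (K z)) s \<rho> \<theta> \<Theta>" by blast
qed

lemma admissible_potential_imp_potential:
  fixes W :: "real ^ 'n \<Rightarrow> real"
  assumes "admissible_potential W"
  shows "\<exists>r c0 C0 Lg. potential W (grad W) r c0 C0 Lg"
proof -
  from assms obtain r c0 C0 where par: "0 < r" "r \<le> 1/4" "0 < c0" "1 < C0"
    and quad: "\<And>\<tau>. \<tau> \<in> ball 0 r \<Longrightarrow> c0 * (norm \<tau>)\<^sup>2 \<le> W \<tau> \<and> W \<tau> \<le> C0 * (norm \<tau>)\<^sup>2"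
    unfolding admissible_potential_def by blast
  from assms obtain L where L: "L-lipschitz_on UNIV (grad W)" and diff: "\<And>x. W differentiable (at x)"
    unfolding admissible_potential_def C11_def by blast
  have "potential W (grad W) r c0 C0 L"
  proof
    show "(W has_derivative (\<lambda>h. h \<bullet> grad W x)) (at x)" for x
      by (rule has_derivative_grad[OF diff])
    show "norm (grad W x - grad W y) \<le> L * norm (x - y)" for x y
      using lipschitz_onD[OF L, of x y] by (simp add: dist_norm)
  qed (use par quad assms in \<open>auto simp: admissible_potential_def\<close>)
  then show ?thesis by blast
qed

section \<open>From constrained minimizers to weak solutions\<close>

context transition_problem
begin

text \<open>Since \<open>\<psi>\<close> has compact support, adding \<open>t \<psi>\<close> affects
  only a compact part of each constrained region. There the strict inequality has a positive margin,
  so all small \<open>t\<close> of either sign are admissible and \<open>euler_lagrange\<close>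
  applies.\<close>

lemma constrained_minimizer_euler_lagrange:
  fixes Q :: "real \<Rightarrow> real ^ 'n" and a :: "real \<Rightarrow> real" and J :: "'b \<Rightarrow> real set" and \<zeta> :: "'b \<Rightarrow> real ^ 'n"
  assumes a: "continuous_on UNIV a" "\<And>x. 0 \<le> a x"
    and Q: "continuous_on UNIV Q" "action a Q < \<infinity>"
    and J: "finite I" "\<And>i. closed (J i)"
    and strict: "\<And>i x. i \<in> I \<Longrightarrow> x \<in> J i \<Longrightarrow> norm (Q x - \<zeta> i) < d"
    and min: "\<And>P. continuous_on UNIV P \<Longrightarrow> (\<And>i x. i \<in> I \<Longrightarrow> x \<in> J i \<Longrightarrow> norm (P x - \<zeta> i) \<le> d) \<Longrightarrow> action a Q \<le> action a P"
    and \<psi>: "\<psi> \<in> test_functions UNIV"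
  shows "interaction UNIV \<psi> < \<infinity>"
    and "integrable lborel (\<lambda>x. (a x *\<^sub>R g (Q x)) \<bullet> \<psi> x)"
    and "2 * (\<integral>p. cross_density Q \<psi> p \<partial>lborel)
      + (\<integral>x. (a x *\<^sub>R g (Q x)) \<bullet> \<psi> x \<partial>lborel) = 0"
proof -
  obtain R \<Lambda> M where R: "0 \<le> R" and \<psi>c: "continuous_on UNIV \<psi>" and supp: "\<And>x. R < \<bar>x\<bar> \<Longrightarrow> \<psi> x = 0"
    and M: "\<And>x. norm (\<psi> x) \<le> M" and \<Lambda>: "\<And>x y. norm (\<psi> x - \<psi> y) \<le> \<Lambda> * \<bar>x - y\<bar>"
    using test_function_regular[OF \<psi>] by metis
  show fin: "interaction UNIV \<psi> < \<infinity>"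
  \<comment> \<open>\<open>\<psi>\<close> is known to vanish only for
    \<open>R < \<bar>x\<bar>\<close>; the extra \<open>1\<close> makes both end values
    \<open>0\<close>.\<close>
  proof (rule interaction_layer_finite[OF \<psi>c, of "M + M" \<Lambda> "- R - 1" "R + 1"])
    show "norm (\<psi> x - \<psi> y) \<le> M + M" for x y
      using norm_triangle_ineq4[of "\<psi> x" "\<psi> y"] M[of x] M[of y] by linarith
  qed (use R \<Lambda> supp in auto)
  have "\<exists>\<delta>>0. \<forall>x\<in>J i \<inter> {-R..R}. norm (Q x - \<zeta> i) + \<delta> \<le> d" if i: "i \<in> I" for i
  proof (cases "J i \<inter> {-R..R} = {}")
    case False
    have "compact (J i \<inter> {-R..R})"
      using J(2) by (intro closed_Int_compact) auto
    moreover have "continuous_on (J i \<inter> {-R..R}) (\<lambda>x. norm (Q x - \<zeta> i))"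
      using Q(1) by (intro continuous_intros) (rule continuous_on_subset, auto)
    ultimately obtain y where y: "y \<in> J i \<inter> {-R..R}" "\<And>x. x \<in> J i \<inter> {-R..R} \<Longrightarrow> norm (Q x - \<zeta> i) \<le> norm (Q y - \<zeta> i)"
      using continuous_attains_sup[OF _ False] by blast
    have "norm (Q y - \<zeta> i) < d"
      using strict[OF i] y(1) by blast
    then show ?thesis
      using y(2) by (intro exI[of _ "d - norm (Q y - \<zeta> i)"]) auto
  qed (use zero_less_one in blast)
  then obtain \<delta> where \<delta>: "\<And>i. i \<in> I \<Longrightarrow> 0 < \<delta> i"
    "\<And>i x. i \<in> I \<Longrightarrow> x \<in> J i \<inter> {-R..R} \<Longrightarrow> norm (Q x - \<zeta> i) + \<delta> i \<le> d"
    by metis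
  \<comment> \<open>The \<open>1\<close> keeps the minimum meaningful when \<open>I\<close> is
    empty.\<close>
  define \<delta>0 where "\<delta>0 = Min (insert 1 (\<delta> ` I))"
  have \<delta>0: "0 < \<delta>0" "\<And>i. i \<in> I \<Longrightarrow> \<delta>0 \<le> \<delta> i"
    using \<delta>(1) J(1) by (auto simp: \<delta>0_def)
  have M0: "0 \<le> M"
    using order_trans[OF norm_ge_zero M] .
  have t0: "0 < \<delta>0 / (M + 1)"
    using \<delta>0 M0 by simp
  have var: "action a Q \<le> action a (\<lambda>x. Q x + t *\<^sub>R \<psi> x)" if t: "\<bar>t\<bar> \<le> \<delta>0 / (M + 1)" for t
  proof (rule min)
    show "continuous_on UNIV (\<lambda>x. Q x + t *\<^sub>R \<psi> x)"
      by (intro continuous_intros Q \<psi>c)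
    show "norm (Q x + t *\<^sub>R \<psi> x - \<zeta> i) \<le> d" if ix: "i \<in> I" "x \<in> J i" for i x
    proof (cases "R < \<bar>x\<bar>")
      case True
      then show ?thesis
        using supp[of x] strict[OF ix] by simp
    next
      case False
      have "norm (t *\<^sub>R \<psi> x) \<le> \<delta>0 / (M + 1) * (M + 1)"
        unfolding norm_scaleR using t M[of x] t0 by (intro mult_mono) auto
      also have "\<dots> = \<delta>0" using M0 by simp
      finally have "norm (t *\<^sub>R \<psi> x) \<le> \<delta> i"
        using \<delta>0(2)[OF ix(1)] by simp
      moreover have "norm (Q x - \<zeta> i) + \<delta> i \<le> d"
        using False ix by (intro \<delta>(2)) (auto simp: abs_le_iff)
      moreover have "norm (Q x + t *\<^sub>R \<psi> x - \<zeta> i) \<le> norm (Q x - \<zeta> i) + norm (t *\<^sub>R \<psi> x)"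
        using norm_triangle_ineq[of "Q x - \<zeta> i" "t *\<^sub>R \<psi> x"] by (simp add: algebra_simps)
      ultimately show ?thesis by linarith
    qed
  qed
  show "integrable lborel (\<lambda>x. (a x *\<^sub>R g (Q x)) \<bullet> \<psi> x)"
    by (rule euler_lagrange(1)[OF a Q \<psi>c supp fin t0 var])
  show "2 * (\<integral>p. cross_density Q \<psi> p \<partial>lborel)
      + (\<integral>x. (a x *\<^sub>R g (Q x)) \<bullet> \<psi> x \<partial>lborel) = 0"
    by (rule euler_lagrange(2)[OF a Q \<psi>c supp fin t0 var])
qed

text \<open>Far out on a half-line where \<open>Q\<close> is within \<open>r / 2\<close> of
  \<open>\<zeta>\<close>, unit neighbourhoods stay in the half-line, so \<open>tail_limit\<close>
  applies. The argument is run once, for an abstract filter.\<close>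

lemma limits_at_ends:
  fixes Q :: "real \<Rightarrow> real ^ 'n"
  assumes Q: "continuous_on UNIV Q" "interaction UNIV Q < \<infinity>" "pot (\<lambda>_. 1) Q < \<infinity>" and lat: "\<zeta> \<in> int_lattice"
  shows "(\<And>x. x \<le> b \<Longrightarrow> norm (Q x - \<zeta>) \<le> r / 2) \<Longrightarrow> (Q \<longlongrightarrow> \<zeta>) at_bot"
    and "(\<And>x. b \<le> x \<Longrightarrow> norm (Q x - \<zeta>) \<le> r / 2) \<Longrightarrow> (Q \<longlongrightarrow> \<zeta>) at_top"
proof -
  have B: "interaction UNIV Q \<le> ennreal (enn2real (interaction UNIV Q))"
    using Q(2) by simp
  have lim: "(Q \<longlongrightarrow> \<zeta>) F"
    if F: "\<And>Y. \<forall>\<^sub>F x in F. Y \<le> \<bar>x\<bar> \<and> (\<forall>y. \<bar>y - x\<bar> \<le> 1 \<longrightarrow> norm (Q y - \<zeta>) \<le> r / 2)" for F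
  proof (rule tendstoI)
    fix e :: real
    assume "0 < e"
    obtain Y where Y: "\<And>x. Y \<le> \<bar>x\<bar> \<Longrightarrow> (\<And>y. \<bar>y - x\<bar> \<le> 1 \<Longrightarrow> norm (Q y - \<zeta>) \<le> r / 2) \<Longrightarrow> norm (Q x - \<zeta>) < e"
      using tail_limit[OF Q(1) B enn2real_nonneg Q(3) lat \<open>0 < e\<close>] by blast
    show "\<forall>\<^sub>F x in F. dist (Q x) \<zeta> < e"
      using F[of Y] by eventually_elim (simp add: dist_norm Y)
  qed
  show "(Q \<longlongrightarrow> \<zeta>) at_bot" if near: "\<And>x. x \<le> b \<Longrightarrow> norm (Q x - \<zeta>) \<le> r / 2"
  proof (rule lim)
    fix Y
    show "\<forall>\<^sub>F x in at_bot. Y \<le> \<bar>x\<bar> \<and> (\<forall>y. \<bar>y - x\<bar> \<le> 1 \<longrightarrow> norm (Q y - \<zeta>) \<le> r / 2)"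
      using eventually_le_at_bot[of "min (- \<bar>Y\<bar>) (b - 1)"]
      by eventually_elim (use near in \<open>auto simp: abs_le_iff\<close>)
  qed
  show "(Q \<longlongrightarrow> \<zeta>) at_top" if near: "\<And>x. b \<le> x \<Longrightarrow> norm (Q x - \<zeta>) \<le> r / 2"
  proof (rule lim)
    fix Y
    show "\<forall>\<^sub>F x in at_top. Y \<le> \<bar>x\<bar> \<and> (\<forall>y. \<bar>y - x\<bar> \<le> 1 \<longrightarrow> norm (Q y - \<zeta>) \<le> r / 2)"
      using eventually_ge_at_top[of "max \<bar>Y\<bar> (b + 1)"]
      by eventually_elim (use near in \<open>auto simp: abs_le_iff\<close>)
  qed
qed

text \<open>Lebesgue measure is the completion of \<open>lborel\<close>, and completion does not
  change the integrals of Borel functions.\<close>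

lemma weak_solutionI:
  fixes Q :: "real \<Rightarrow> real ^ 'n" and K :: "real \<Rightarrow> ennreal"
  assumes K: "\<And>z. z \<noteq> 0 \<Longrightarrow> K z = ennreal (k z)" "\<And>z. k z = enn2real (K z)"
    and Q: "continuous_on UNIV Q" "interaction UNIV Q < \<infinity>"
    and f: "f \<in> borel_measurable borel"
    and EL: "\<And>\<psi> :: real \<Rightarrow> real ^ 'n. \<psi> \<in> test_functions UNIV \<Longrightarrow> interaction UNIV \<psi> < \<infinity>"
      "\<And>\<psi>. \<psi> \<in> test_functions UNIV \<Longrightarrow> integrable lborel (\<lambda>x. f x \<bullet> \<psi> x)"
      "\<And>\<psi>. \<psi> \<in> test_functions UNIV \<Longrightarrow>
        2 * (\<integral>p. cross_density Q \<psi> p \<partial>lborel)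
        + (\<integral>x. f x \<bullet> \<psi> x \<partial>lborel) = 0"
  shows "weak_solution K UNIV f Q"
  unfolding weak_solution_def
proof (intro conjI ballI)
  have Qm: "Q \<in> borel_measurable borel"
    using Q(1) by (rule borel_measurable_continuous_onI)
  then show "Q \<in> borel_measurable lebesgue"
    by (intro measurable_completion) simp
  have "energy K Q = (\<integral>\<^sup>+p. ennreal (density Q p) \<partial>lebesgue)"
    unfolding energy_def
  proof (rule nn_integral_cong)
    fix p :: "real \<times> real"
    \<comment> \<open>On the diagonal the increment vanishes, and in \<open>ennreal\<close> any
      value of \<open>K 0\<close>, even \<open>\<infinity>\<close>, times \<open>0\<close> is
      \<open>0\<close>.\<close>
    show "(case p of (x, y) \<Rightarrow> K (x - y) * ennreal ((norm (Q x - Q y))\<^sup>2))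
      = ennreal (density Q p)"
      using K(1)[of "fst p - snd p"] k_nonneg
      by (cases "fst p = snd p") (auto simp: split_beta ennreal_mult)
  qed
  also have "\<dots> = interaction UNIV Q"
    unfolding interaction_def using interaction_measurable(1)[OF Qm]
    by (simp add: nn_integral_completion)
  finally show "energy K Q < \<infinity>"
    using Q(2) by simp
  fix \<psi> :: "real \<Rightarrow> real ^ 'n"
  assume \<psi>: "\<psi> \<in> test_functions UNIV"
  obtain R \<Lambda> M where \<psi>c: "continuous_on UNIV \<psi>"
    using test_function_regular[OF \<psi>] by metis
  then have \<psi>m: "\<psi> \<in> borel_measurable borel"
    by (rule borel_measurable_continuous_onI)
  have cross: "integrable lborel (\<lambda>(x, y). k (x - y) * ((Q x - Q y) \<bullet> (\<psi> x - \<psi> y)))"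
    using interaction_cross_integrable[OF Qm Q(2) \<psi>m EL(1)[OF \<psi>]] by (simp add: case_prod_unfold)
  show "integrable lebesgue (\<lambda>(x, y). enn2real (K (x - y)) * ((Q x - Q y) \<bullet> (\<psi> x - \<psi> y)))"
    unfolding K(2)[symmetric] using cross
    by (subst integrable_completion) (auto dest: borel_measurable_integrable)
  show "integrable lebesgue (\<lambda>x. f x \<bullet> \<psi> x)"
    using EL(2)[OF \<psi>] by (subst integrable_completion) (auto dest: borel_measurable_integrable)
  have "(\<integral>(x, y). k (x - y) * ((Q x - Q y) \<bullet> (\<psi> x - \<psi> y)) \<partial>lebesgue)
    = (\<integral>p. cross_density Q \<psi> p \<partial>lborel)"
    using borel_measurable_integrable[OF cross] by (subst integral_completion) (auto simp: case_prod_unfold)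
  moreover have "(\<integral>x. f x \<bullet> \<psi> x \<partial>lebesgue) = (\<integral>x. f x \<bullet> \<psi> x \<partial>lborel)"
    using borel_measurable_integrable[OF EL(2)[OF \<psi>]] by (subst integral_completion) auto
  ultimately show "2 * (\<integral>(x, y). enn2real (K (x - y)) * ((Q x - Q y) \<bullet> (\<psi> x - \<psi> y)) \<partial>lebesgue)
        + (\<integral>x. f x \<bullet> \<psi> x \<partial>lebesgue) = 0"
    unfolding K(2)[symmetric] using EL(3)[OF \<psi>] by simp
qed

end

theorem theorem1p1:
  fixes s a1 a2 :: real
    and K :: "real \<Rightarrow> ennreal"
    and W :: "real ^ 'n \<Rightarrow> real"
    and \<zeta>1 :: "real ^ 'n"
    and N :: nat
  assumes "1/2 < s" and "s < 1"
    and "admissible_kernel s K"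
    and "admissible_potential W"
    and "a1 > a2" and "a2 > 0"
    and "\<zeta>1 \<in> int_lattice"
    and "N \<ge> 2"
  shows "\<exists>\<epsilon>\<^sub>0 > 0. \<forall>\<epsilon>. 0 < \<epsilon> \<and> \<epsilon> \<le> \<epsilon>\<^sub>0 \<longrightarrow>
    (\<exists>(\<zeta> :: nat \<Rightarrow> real ^ 'n) (b :: nat \<Rightarrow> real) (Q :: real \<Rightarrow> real ^ 'n).
      \<zeta> 1 = \<zeta>1 \<and>
      (\<forall>i \<in> {2..N}. \<zeta> i \<in> int_lattice) \<and>
      (\<forall>i \<in> {1..2 * N - 3}. b (i + 1) \<ge> b i + 3) \<and>
      continuous_on UNIV Q \<and>
      weak_solution K UNIV (\<lambda>x. (a1 + a2 * cos (\<epsilon> * x)) *\<^sub>R grad W (Q x)) Q \<and>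
      (\<forall>i \<in> {1..N - 1}. \<zeta> (i + 1) \<noteq> \<zeta> i) \<and>
      (Q \<longlongrightarrow> \<zeta> 1) at_bot \<and>
      (\<forall>x \<in> {..b 1}. norm (Q x - \<zeta> 1) \<le> 1/4) \<and>
      (\<forall>i \<in> {1..N - 2}. \<forall>x \<in> {b (2 * i)..b (2 * i + 1)}. norm (Q x - \<zeta> (i + 1)) \<le> 1/4) \<and>
      (\<forall>x \<in> {b (2 * N - 2)..}. norm (Q x - \<zeta> N) \<le> 1/4) \<and>
      (Q \<longlongrightarrow> \<zeta> N) at_top)"
proof -
  obtain \<rho> \<theta> \<Theta> where ker: "kernel (\<lambda>z. enn2real (K z)) s \<rho> \<theta> \<Theta>"
    using admissible_kernel_imp_kernel(1)[OF assms(3,1,2)] by blast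
  obtain r c0 C0 Lg where pot: "potential W (grad W) r c0 C0 Lg"
    using admissible_potential_imp_potential[OF assms(4)] by blast
  interpret transition_problem "\<lambda>z. enn2real (K z)" s \<rho> \<theta> \<Theta> W "grad W" r c0 C0 Lg
    using ker pot by (intro transition_problem.intro)
  obtain v where v: "v \<in> int_lattice" "v \<noteq> 0" and ev: "\<forall>\<^sub>F \<epsilon> in at_right 0. 6 \<le> 2 * pi / \<epsilon> \<and> (\<exists>Q. interior_minimizer N (2 * pi / \<epsilon>) (\<lambda>x. a1 + a2 * cos (\<epsilon> * x)) (\<lambda>i. \<zeta>1 + (real i - 1) *\<^sub>R v) Q)"
    using multibump_minimizer[OF assms(6,5,7,8)] by blast
  then obtain e where e: "0 < e" "\<And>\<epsilon>. 0 < \<epsilon> \<Longrightarrow> \<epsilon> < e \<Longrightarrow> 6 \<le> 2 * pi / \<epsilon> \<and> (\<exists>Q. interior_minimizer N (2 * pi / \<epsilon>) (\<lambda>x. a1 + a2 * cos (\<epsilon> * x)) (\<lambda>i. \<zeta>1 + (real i - 1) *\<^sub>R v) Q)"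
    unfolding eventually_at_right_field by blast
  show ?thesis
  \<comment> \<open>Half of \<open>e\<close>, because the minimizers are available for
    \<open>\<epsilon> < e\<close> while the goal includes
    \<open>\<epsilon> = \<epsilon>\<^sub>0\<close>.\<close>
  proof (intro exI[of _ "e / 2"] conjI allI impI, goal_cases)
    case 1
    show ?case using e by simp
  next
    case \<epsilon>: (2 \<epsilon>)
    define T where "T = 2 * pi / \<epsilon>"
    define a where "a = (\<lambda>x. a1 + a2 * cos (\<epsilon> * x))"
    define \<zeta> where "\<zeta> i = \<zeta>1 + (real i - 1) *\<^sub>R v" for i
    \<comment> \<open>The end points of the plateaus: for \<open>1 < i + 1 < N\<close>, plateau
      \<open>i + 1\<close> is \<open>{b (2 * i)..b (2 * i + 1)}\<close>. Consecutive values differ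
      by \<open>T / 2\<close>, which is at least \<open>3\<close>.\<close>
    define b where "b i = (real i - 1/2) * T / 2" for i
    from e(2)[of \<epsilon>] \<epsilon> e(1) obtain Q where T: "6 \<le> T" and Q: "continuous_on UNIV Q" "action a Q < \<infinity>"
      and strict: "\<And>i x. i \<in> {1..N} \<Longrightarrow> x \<in> plateau N T i \<Longrightarrow> norm (Q x - \<zeta> i) < r / 2"
      and min: "\<And>P. continuous_on UNIV P \<Longrightarrow> (\<And>i x. i \<in> {1..N} \<Longrightarrow> x \<in> plateau N T i \<Longrightarrow> norm (P x - \<zeta> i) \<le> r / 2) \<Longrightarrow> action a Q \<le> action a P"
      unfolding T_def a_def \<zeta>_def interior_minimizer_def by auto
    have near: "norm (Q x - \<zeta> i) \<le> 1/4" if "i \<in> {1..N}" "x \<in> plateau N T i" for i x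
      using strict[OF that] r by simp
    have lat: "\<zeta> i \<in> int_lattice" if "1 \<le> i" for i
      using lattice_add[OF assms(7) lattice_scale[OF v(1), of "i - 1"]] that by (simp add: \<zeta>_def of_nat_diff)
    have a_cont: "continuous_on UNIV a"
      unfolding a_def by (intro continuous_intros)
    have a_ge: "a1 - a2 \<le> a x" for x
    proof -
      have "a2 * (-1) \<le> a2 * cos (\<epsilon> * x)"
        using assms(6) by (intro mult_left_mono) auto
      then show ?thesis by (simp add: a_def)
    qed
    have a0: "0 \<le> a x" for x
      using a_ge[of x] assms(5) by simp
    have Qm: "Q \<in> borel_measurable borel"
      using Q(1) by (rule borel_measurable_continuous_onI)
    have fin: "interaction UNIV Q < \<infinity>" "pot (\<lambda>_. 1) Q < \<infinity>"
    proof -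
      have "action a Q \<le> ennreal (enn2real (action a Q))"
        using Q(2) by simp
      from pot_le_action[OF Qm _ a_ge this] assms(5)
      show "interaction UNIV Q < \<infinity>" "pot (\<lambda>_. 1) Q < \<infinity>"
        by (auto intro: le_less_trans)
    qed
    have EL: "interaction UNIV \<psi> < \<infinity>" "integrable lborel (\<lambda>x. (a x *\<^sub>R grad W (Q x)) \<bullet> \<psi> x)"
      "2 * (\<integral>p. enn2real (K (fst p - snd p)) * ((Q (fst p) - Q (snd p)) \<bullet> (\<psi> (fst p) - \<psi> (snd p))) \<partial>lborel)
        + (\<integral>x. (a x *\<^sub>R grad W (Q x)) \<bullet> \<psi> x \<partial>lborel) = 0"
      if "\<psi> \<in> test_functions UNIV" for \<psi>
      using constrained_minimizer_euler_lagrange[where I = "{1..N}" and J = "plateau N T" and \<zeta> = \<zeta> and d = "r / 2",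
        OF a_cont a0 Q finite_atLeastAtMost plateau_closed strict min that]
      by blast+
    have sol: "weak_solution K UNIV (\<lambda>x. a x *\<^sub>R grad W (Q x)) Q"
    proof (rule weak_solutionI[OF admissible_kernel_imp_kernel(2)[OF assms(3,1,2)] refl Q(1) fin(1) _ EL])
      have "continuous_on UNIV (\<lambda>x. a x *\<^sub>R grad W (Q x))"
        by (intro continuous_intros a_cont continuous_on_compose2[OF g_continuous[of UNIV] Q(1)]) auto
      then show "(\<lambda>x. a x *\<^sub>R grad W (Q x)) \<in> borel_measurable borel"
        by (rule borel_measurable_continuous_onI)
    qed
    have left: "x \<in> plateau N T 1" if "x \<le> b 1" for x
      using that T by (auto simp: plateau_def b_def)
    have right: "x \<in> plateau N T N" if "b (2 * N - 2) \<le> x" for x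
      using that T assms(8) by (auto simp: plateau_def b_def of_nat_diff field_simps)
    show ?case
    proof (intro exI[of _ \<zeta>] exI[of _ b] exI[of _ Q] conjI ballI)
      show "\<zeta> 1 = \<zeta>1" by (simp add: \<zeta>_def)
      show "\<zeta> i \<in> int_lattice" if "i \<in> {2..N}" for i
        using that by (intro lat) auto
      show "b i + 3 \<le> b (i + 1)" for i
        using T by (simp add: b_def field_simps)
      show "continuous_on UNIV Q" by (rule Q)
      show "weak_solution K UNIV (\<lambda>x. (a1 + a2 * cos (\<epsilon> * x)) *\<^sub>R grad W (Q x)) Q"
        using sol by (simp add: a_def)
      show "\<zeta> (i + 1) \<noteq> \<zeta> i" for i
        using v(2) by (simp add: \<zeta>_def algebra_simps)
      show "(Q \<longlongrightarrow> \<zeta> 1) at_bot"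
        using assms(8) left
        by (intro limits_at_ends(1)[OF Q(1) fin lat, of _ "b 1"] less_imp_le[OF strict]) auto
      show "(Q \<longlongrightarrow> \<zeta> N) at_top"
        using assms(8) right
        by (intro limits_at_ends(2)[OF Q(1) fin lat, of _ "b (2 * N - 2)"] less_imp_le[OF strict]) auto
      show "norm (Q x - \<zeta> 1) \<le> 1/4" if "x \<in> {..b 1}" for x
        using that assms(8) left by (intro near) auto
      show "norm (Q x - \<zeta> N) \<le> 1/4" if "x \<in> {b (2 * N - 2)..}" for x
        using that assms(8) right by (intro near) auto
      show "norm (Q x - \<zeta> (i + 1)) \<le> 1/4" if "i \<in> {1..N - 2}" "x \<in> {b (2 * i)..b (2 * i + 1)}" for i x
      proof (rule near)
        show "x \<in> plateau N T (i + 1)"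
          using that T by (auto simp: plateau_def b_def field_simps)
      qed (use that assms(8) in auto)
    qed
  qed
qed

end
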